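(* Let $H$ be an infinite dimensional real separable Hilbert space, let $Q(X)=(A_QX)\cdot X$ be a quadratic form on $H^2$ with $A_Q\in\mathcal L(H^2)$ selfadjoint, nonnegative and trace class, and let $F\in S(H^2,Q)$. Then the function $h\mapsto H_hF$ is $C^\infty$ on $[0,\infty)$ with values in the Banach space $S(H^2,Q)$. Moreover, for all $h>0$, the operator $H_h$ is an isomorphism from $S(H^2,Q)$ onto itself. As operators in $S(H^2,Q)$, $H_h$ and its inverse, denoted by $H_{-h}$, have norms satisfying $$\|H_h\|\le1,\qquad\|H_{-h}\|\le e^{(h/2)\mathrm{Tr}A_Q}.$$
   Context: For a nonnegative quadratic form $Q$ on $H^2$, $S(H^2,Q)$ is the set of $f\in C^\infty(H^2)$ for which there is $C(f)>0$ such that for all integers $m\ge0$ and all $X,V_1,\dots,V_m\in H^2$, $|(d^mf)(X)(V_1,\dots,V_m)|\le C(f)\prod_{j=1}^mQ(V_j)^{1/2}$; the smallest such $C(f)$ is the norm $\|f\|_Q$. Wiener space: $B\supset H$ is a Banach space with $B'\subset H'=H\subset B$, each dense in the next, such that for each $t>0$ there is a probability measure $\mu_{B,t}$ on the Borel $\sigma$-algebra of $B$ with $\int_Be^{ia(x)}d\mu_{B,t}(x)=e^{-\frac t2|a|^2}$ for $a\in B'$ (such $B$ exists by Gross's theorem); $\mu_{B^2,t}$ is the analogous measure on $B^2\supset H^2$. For $a\in H^2$, $\ell_a\in L^2(B^2,\mu_{B^2,h})$ is obtained by extending by density the map $a\mapsto a(\cdot)$ from $(B^2)'$. For a finite dimensional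 subspace $E\subset H^2$ with orthonormal basis $(u_j)$ put $\widetilde\pi_E(x)=\sum_j\ell_{u_j}(x)u_j$. A function $F$ on $H^2$ admits the stochastic extension $\widetilde F\in L^1(B^2,\mu_{B^2,h})$ if for every increasing sequence $(E_n)$ of finite dimensional subspaces of $H^2$ with dense union, $F\circ\widetilde\pi_{E_n}\to\widetilde F$ in $L^1(B^2,\mu_{B^2,h})$. It is known that functions in $S(H^2,Q)$, with $A_Q$ trace class, admit bounded measurable stochastic extensions. Heat operator: for $h>0$, $(H_hF)(X)=\int_{B^2}\widetilde F(X+Y)\,d\mu_{B^2,h}(Y)$, $X\in H^2$, and $H_0F=F$. *)

theory Defs
  imports "HOL-Probability.Probability"
begin

section \<open>The spaces \<open>S(V, Q)\<close>\<close>

text \<open>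
  \<open>iter_deriv f [V\<^sub>1, \<dots>, V\<^sub>m] X\<close> is \<open>(d\<^sup>m f)(X)(V\<^sub>1, \<dots>, V\<^sub>m)\<close>. It is only meaningful for functions that
  are smooth in the sense of \<open>frechet_smooth\<close> below.
\<close>
fun iter_deriv :: "('v::real_normed_vector \<Rightarrow> complex) \<Rightarrow> 'v list \<Rightarrow> 'v \<Rightarrow> complex" where
  "iter_deriv f [] X = f X"
| "iter_deriv f (V # Vs) X = frechet_derivative (iter_deriv f Vs) (at X) V"

text \<open>
  For every \<open>m\<close>, the map \<open>X \<mapsto> d\<^sup>m f(X)\<close> takes values in the bounded \<open>m\<close>-linear forms and is Frechet
  differentiable for the norm of that space, with derivative \<open>d\<^sup>m\<^sup>+\<^sup>1 f\<close>. Multilinearity of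
  \<open>d\<^sup>m f(X)\<close> need not be required, as it follows from the linearity of \<open>frechet_derivative\<close> at points
  of differentiability.
\<close>
definition frechet_smooth :: "('v::real_normed_vector \<Rightarrow> complex) \<Rightarrow> bool" where
  "frechet_smooth f \<longleftrightarrow>
    (\<forall>m X.
      (\<exists>K. \<forall>Vs. length Vs = m \<longrightarrow> norm (iter_deriv f Vs X) \<le> K * prod_list (map norm Vs)) \<and>
      (\<forall>Vs. length Vs = m \<longrightarrow> iter_deriv f Vs differentiable (at X)) \<and>
      (\<forall>\<epsilon>>0. \<exists>\<delta>>0. \<forall>Y Vs. norm Y < \<delta> \<longrightarrow> length Vs = m \<longrightarrow>
         norm (iter_deriv f Vs (X + Y) - iter_deriv f Vs X - iter_deriv f (Y # Vs) X)
           \<le> \<epsilon> * norm Y * prod_list (map norm Vs)))"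

definition S_bound :: "('v::real_normed_vector \<Rightarrow> real) \<Rightarrow> ('v \<Rightarrow> complex) \<Rightarrow> real \<Rightarrow> bool" where
  "S_bound Q f C \<longleftrightarrow>
    (\<forall>X Vs. norm (iter_deriv f Vs X) \<le> C * prod_list (map (\<lambda>V. sqrt (Q V)) Vs))"

definition S_space :: "('v::real_normed_vector \<Rightarrow> real) \<Rightarrow> ('v \<Rightarrow> complex) set" where
  "S_space Q = {f. frechet_smooth f \<and> (\<exists>C>0. S_bound Q f C)}"

text \<open>The infimum is a minimum unless \<open>f = 0\<close>, where it gives the value \<open>0\<close>.\<close>
definition S_norm :: "('v::real_normed_vector \<Rightarrow> real) \<Rightarrow> ('v \<Rightarrow> complex) \<Rightarrow> real" where
  "S_norm Q f = Inf {C. C > 0 \<and> S_bound Q f C}"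

text \<open>
  \<open>G\<close> is infinitely differentiable on \<open>T\<close> with values in the normed space \<open>S_space Q\<close>: \<open>D k\<close> is its
  \<open>k\<close>-th derivative, one-sided at end points of \<open>T\<close> that belong to \<open>T\<close>.
\<close>
definition S_smooth_on ::
    "('v::real_normed_vector \<Rightarrow> real) \<Rightarrow> real set \<Rightarrow> (real \<Rightarrow> 'v \<Rightarrow> complex) \<Rightarrow> bool" where
  "S_smooth_on Q T G \<longleftrightarrow>
    (\<exists>D :: nat \<Rightarrow> real \<Rightarrow> 'v \<Rightarrow> complex.
      (\<forall>t\<in>T. D 0 t = G t) \<and>
      (\<forall>k. \<forall>t\<in>T. D k t \<in> S_space Q) \<and>
      (\<forall>k. \<forall>t\<in>T.
        ((\<lambda>s. S_norm Q (\<lambda>X. (D k s X - D k t X) / of_real (s - t) - D (Suc k) t X)) \<longlongrightarrow> 0)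
          (at t within T)))"

text \<open>The operator norm on \<open>S_space Q\<close>, written like \<open>onorm\<close>; meaningful for bounded operators.\<close>
definition S_opnorm ::
    "('v::real_normed_vector \<Rightarrow> real) \<Rightarrow> (('v \<Rightarrow> complex) \<Rightarrow> ('v \<Rightarrow> complex)) \<Rightarrow> real" where
  "S_opnorm Q T = (SUP f\<in>S_space Q. S_norm Q (T f) / S_norm Q f)"

definition S_bounded_linear ::
    "('v::real_normed_vector \<Rightarrow> real) \<Rightarrow> (('v \<Rightarrow> complex) \<Rightarrow> ('v \<Rightarrow> complex)) \<Rightarrow> bool" where
  "S_bounded_linear Q T \<longleftrightarrow>
    T ` S_space Q \<subseteq> S_space Q \<and>
    (\<forall>f\<in>S_space Q. \<forall>g\<in>S_space Q. T (\<lambda>X. f X + g X) = (\<lambda>X. T f X + T g X)) \<and>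
    (\<forall>c. \<forall>f\<in>S_space Q. T (\<lambda>X. c * f X) = (\<lambda>X. c * T f X)) \<and>
    (\<exists>K. \<forall>f\<in>S_space Q. S_norm Q (T f) \<le> K * S_norm Q f)"

definition S_isomorphism ::
    "('v::real_normed_vector \<Rightarrow> real) \<Rightarrow> (('v \<Rightarrow> complex) \<Rightarrow> ('v \<Rightarrow> complex)) \<Rightarrow> bool" where
  "S_isomorphism Q T \<longleftrightarrow>
    bij_betw T (S_space Q) (S_space Q) \<and> S_bounded_linear Q T \<and>
    S_bounded_linear Q (inv_into (S_space Q) T)"

section \<open>Trace class operators\<close>

definition orthonormal :: "'v::real_inner set \<Rightarrow> bool" where
  "orthonormal U \<longleftrightarrow> pairwise orthogonal U \<and> (\<forall>u\<in>U. norm u = 1)"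

definition hilbert_basis :: "'v::real_inner set \<Rightarrow> bool" where
  "hilbert_basis U \<longleftrightarrow> orthonormal U \<and> closure (span U) = UNIV"

definition selfadjoint_op :: "('v::real_inner \<Rightarrow>\<^sub>L 'v) \<Rightarrow> bool" where
  "selfadjoint_op A \<longleftrightarrow> (\<forall>x y. A x \<bullet> y = x \<bullet> A y)"

definition nonneg_op :: "('v::real_inner \<Rightarrow>\<^sub>L 'v) \<Rightarrow> bool" where
  "nonneg_op A \<longleftrightarrow> (\<forall>x. 0 \<le> A x \<bullet> x)"

text \<open>
  \<open>P = \<bar>A\<bar>\<close>, the nonnegative selfadjoint square root of \<open>A\<^sup>* A\<close>: as \<open>P\<close> is selfadjoint, the last
  condition says \<open>P P = A\<^sup>* A\<close>.
\<close>
definition is_modulus :: "('v::real_inner \<Rightarrow>\<^sub>L 'v) \<Rightarrow> ('v \<Rightarrow>\<^sub>L 'v) \<Rightarrow> bool" where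
  "is_modulus A P \<longleftrightarrow> selfadjoint_op P \<and> nonneg_op P \<and> (\<forall>x y. P x \<bullet> P y = A x \<bullet> A y)"

definition trace_class :: "('v::real_inner \<Rightarrow>\<^sub>L 'v) \<Rightarrow> bool" where
  "trace_class A \<longleftrightarrow>
    (\<exists>P. is_modulus A P \<and> (\<forall>U. hilbert_basis U \<longrightarrow> (\<lambda>u. P u \<bullet> u) summable_on U))"

text \<open>For trace class operators, the trace does not depend on the chosen basis.\<close>
definition op_trace :: "('v::real_inner \<Rightarrow>\<^sub>L 'v) \<Rightarrow> real" where
  "op_trace A = (\<Sum>\<^sub>\<infinity>u\<in>(SOME U. hilbert_basis U). A u \<bullet> u)"

section \<open>Wiener spaces\<close>

text \<open>
  The inclusion of the Hilbert space in the Banach space is a bounded linear injection \<open>J\<close>. An element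
  \<open>a\<close> of the dual of the Banach space is then identified with the functional \<open>a o\<^sub>L J\<close> on the Hilbert
  space, and a vector \<open>u\<close> of the Hilbert space with the functional \<open>blinfun_inner_right u\<close>.
\<close>
definition wiener_measure ::
    "('h::real_inner \<Rightarrow>\<^sub>L 'b::real_normed_vector) \<Rightarrow> real \<Rightarrow> 'b measure \<Rightarrow> bool" where
  "wiener_measure J t \<mu> \<longleftrightarrow>
    sets \<mu> = sets borel \<and> prob_space \<mu> \<and>
    (\<forall>a :: 'b \<Rightarrow>\<^sub>L real.
      (\<integral>x. exp (\<i> * complex_of_real (blinfun_apply a x)) \<partial>\<mu>) = exp (- complex_of_real (t / 2 * (norm (a o\<^sub>L J))\<^sup>2)))"

definition wiener_embedding :: "('h::real_inner \<Rightarrow>\<^sub>L 'b::real_normed_vector) \<Rightarrow> bool" where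
  "wiener_embedding J \<longleftrightarrow>
    inj J \<and> closure (range J) = UNIV \<and>
    closure (range (\<lambda>a :: 'b \<Rightarrow>\<^sub>L real. a o\<^sub>L J)) = UNIV \<and>
    (\<forall>t>0. \<exists>\<mu>. wiener_measure J t \<mu>)"

definition square_embedding ::
    "('h::real_normed_vector \<Rightarrow>\<^sub>L 'b::real_normed_vector) \<Rightarrow> ('h \<times> 'h) \<Rightarrow>\<^sub>L ('b \<times> 'b)" where
  "square_embedding J = Blinfun (map_prod J J)"

text \<open>The next lemma ensures that \<open>Blinfun\<close> is applied to a bounded linear map.\<close>
lemma square_embedding_apply [simp]: "square_embedding J (x, y) = (J x, J y)"
proof -
  have "bounded_linear (\<lambda>p. (J (fst p), J (snd p)))"
    by (intro bounded_linear_Pair bounded_linear_compose[OF blinfun.bounded_linear_right]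
        bounded_linear_fst bounded_linear_snd)
  moreover have "map_prod J J = (\<lambda>p. (J (fst p), J (snd p)))"
    by auto
  ultimately show ?thesis
    by (simp add: square_embedding_def bounded_linear_Blinfun_apply)
qed

text \<open>
  \<open>wiener_functional J \<nu> u\<close> is (a representative of) \<open>\<ell>\<^sub>u \<in> L\<^sup>2(\<nu>)\<close>: the value at \<open>u\<close> of the extension
  by continuity of the map that sends a continuous functional \<open>a\<close>, seen in the Hilbert space,
  to the class of \<open>a\<close> in \<open>L\<^sup>2(\<nu>)\<close>.
\<close>
definition wiener_functional ::
    "('h::real_inner \<Rightarrow>\<^sub>L 'b::real_normed_vector) \<Rightarrow> 'b measure \<Rightarrow> 'h \<Rightarrow> 'b \<Rightarrow> real" where
  "wiener_functional J \<nu> u = (SOME f.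
    f \<in> borel_measurable \<nu> \<and> (\<integral>\<^sup>+x. ennreal ((f x)\<^sup>2) \<partial>\<nu>) < \<infinity> \<and>
    (\<forall>a :: nat \<Rightarrow> 'b \<Rightarrow>\<^sub>L real. (\<lambda>n. a n o\<^sub>L J) \<longlonglongrightarrow> blinfun_inner_right u \<longrightarrow>
      (\<lambda>n. \<integral>\<^sup>+x. ennreal ((blinfun_apply (a n) x - f x)\<^sup>2) \<partial>\<nu>) \<longlonglongrightarrow> 0))"

text \<open>\<open>proj_extension J \<nu> U\<close> is \<open>\<pi>~\<^sub>E\<close> for \<open>E = span U\<close>, where \<open>U\<close> is a finite orthonormal set.\<close>
definition proj_extension ::
    "('h::real_inner \<Rightarrow>\<^sub>L 'b::real_normed_vector) \<Rightarrow> 'b measure \<Rightarrow> 'h set \<Rightarrow> 'b \<Rightarrow> 'h" where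
  "proj_extension J \<nu> U x = (\<Sum>u\<in>U. wiener_functional J \<nu> u x *\<^sub>R u)"

text \<open>
  \<open>U n\<close> is an orthonormal basis of the finite dimensional space \<open>E n\<close>. Different choices of \<open>U n\<close>
  give almost everywhere equal functions \<open>proj_extension J \<nu> (U n)\<close>.
\<close>
definition stochastic_extension ::
    "('h::real_inner \<Rightarrow>\<^sub>L 'b::real_normed_vector) \<Rightarrow> 'b measure \<Rightarrow>
      ('h \<Rightarrow> complex) \<Rightarrow> ('b \<Rightarrow> complex) \<Rightarrow> bool" where
  "stochastic_extension J \<nu> F G \<longleftrightarrow>
    integrable \<nu> G \<and>
    (\<forall>E U. (\<forall>n. finite (U n) \<and> orthonormal (U n) \<and> span (U n) = E n) \<and>
        incseq E \<and> closure (\<Union>n. E n) = UNIV \<longrightarrow>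
      (\<forall>n. integrable \<nu> (\<lambda>x. F (proj_extension J \<nu> (U n) x))) \<and>
      (\<lambda>n. \<integral>\<^sup>+x. ennreal (norm (F (proj_extension J \<nu> (U n) x) - G x)) \<partial>\<nu>) \<longlonglongrightarrow> 0)"

text \<open>
  \<open>\<nu> h\<close> is the Gaussian measure with variance parameter \<open>h\<close>. The stochastic extension is unique up to
  \<open>\<nu> h\<close>-null sets, and translations by vectors of the Hilbert space preserve these, so the
  choice of a representative is immaterial. Negative values of \<open>h\<close> are not considered.
\<close>
definition heat_op ::
    "('h::real_inner \<Rightarrow>\<^sub>L 'b::real_normed_vector) \<Rightarrow> (real \<Rightarrow> 'b measure) \<Rightarrow> real \<Rightarrow>
      ('h \<Rightarrow> complex) \<Rightarrow> ('h \<Rightarrow> complex)" where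
  "heat_op J \<nu> h F X =
    (if h = 0 then F X
     else (\<integral>Y. (SOME G. stochastic_extension J (\<nu> h) F G) (J X + Y) \<partial>(\<nu> h)))"

end

(*
  Let T be a selfadjoint square root of A, so that Q(V)^(1/2) = |T V|, and let e be the Hilbert basis
  in which the trace is computed. Half the Laplacian, L f = 1/2 sum_j d^2 f(e_j, e_j), is bounded on
  S(V, Q) with norm at most Tr A / 2, hence generates the group exp(t L) there, which is smooth in t.
  The theorem follows from H_h = exp(h L). To see this identity, F is averaged over the Gaussian
  vectors X + r Z_n, where Z_n = sum_(j < n) l_(e_j) e_j. Integration by parts with respect to the
  Gaussian measure, the derivative of the Cameron-Martin formula, shows that the r-derivative of such
  averages is the average of 2 h r L_n F, with L_n the partial sum of L. The Cameron-Martin formula itself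
  compares characteristic functionals, which determine measures on a separable Banach space by the
  Hahn-Banach theorem. That H_h is a contraction is clear for averages and passes to the limit.
*)
theory Submission
  imports Defs
begin

text \<open>One device controls membership in \<open>S_space Q\<close>: a candidate family of
  derivatives that is linear in its newest direction, bounded by the weights, and has a remainder
  quadratic in |T Y| is the true family of derivatives. These conditions survive series and
  averages, so no derivative is ever exchanged with a limit by hand. The weights also make F
  Lipschitz for |T .|. As T is Hilbert-Schmidt, |T Z_n| has bounded second moments, while those of
  |Z_n| grow with n. The two norm bounds have different origins: exp (h Tr A / 2) is the crude bound
  of the exponential series at time - h, whereas the bound 1 is invisible in the series. To link
  series and averages, exp (h (1 - r^2) L) F is averaged over X + r Z_n: from r = 0 to r = 1 the
  growing variance compensates the shrinking time up to L - L_n, which is small uniformly in X,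
  being controlled by a tail of the trace. Trace class is defined through the modulus of A, so
  uniqueness of nonnegative square roots is needed to return to A itself.\<close>

lemma LIMSEQ_zero_squeeze:
  fixes f g :: "nat \<Rightarrow> real"
  assumes "\<And>n. 0 \<le> f n" "\<And>n. f n \<le> g n" "g \<longlonglongrightarrow> 0"
  shows "f \<longlonglongrightarrow> 0"
proof (rule tendsto_sandwich[where f = "\<lambda>_. 0" and h = g])
  show "\<forall>\<^sub>F n in sequentially. 0 \<le> f n" "\<forall>\<^sub>F n in sequentially. f n \<le> g n"
    by (rule always_eventually, rule allI, rule assms)+
qed (rule tendsto_const assms(3))+

lemma LIMSEQ_zero_of_norm_square:
  fixes x :: "nat \<Rightarrow> 'v::real_normed_vector"
  assumes "(\<lambda>n. (norm (x n))\<^sup>2) \<longlonglongrightarrow> 0"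
  shows "x \<longlonglongrightarrow> 0"
  using tendsto_real_sqrt[OF assms] by (simp add: tendsto_norm_zero_iff)

text \<open>Minimise |x|^2 - 2 phi x. The parallelogram law (\<open>par\<close>) makes a minimising
  sequence Cauchy, completeness gives a minimiser \<open>v\<close>, and its first variation is v . y
  = phi y.\<close>

lemma riesz_representation:
  fixes \<phi> :: "'v::{real_inner, banach} \<Rightarrow>\<^sub>L real"
  obtains v where "\<phi> = blinfun_inner_right v"
proof -
  define f where "f x = (norm x)\<^sup>2 - 2 * \<phi> x" for x
  define m where "m = Inf (range f)"
  have lower: "f x \<ge> - (norm \<phi>)\<^sup>2" for x
  proof -
    have "\<phi> x \<le> norm \<phi> * norm x"
      using norm_blinfun[of \<phi> x] by simp
    moreover have "(norm x - norm \<phi>)\<^sup>2 \<ge> 0" by simp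
    ultimately show ?thesis
      unfolding f_def by (simp add: power2_diff algebra_simps)
  qed
  then have bdd: "bdd_below (range f)" by (intro bdd_belowI[of _ "- (norm \<phi>)\<^sup>2"]) auto
  have m_le: "m \<le> f x" for x
    unfolding m_def using bdd by (simp add: cInf_lower)
  have "\<exists>x. f x < m + 1 / real (Suc n)" for n
  proof (rule ccontr)
    assume "\<not> ?thesis"
    then have "m + 1 / real (Suc n) \<le> m"
      unfolding m_def by (intro cInf_greatest) (auto simp: not_less)
    then show False by simp
  qed
  then obtain x where x: "f (x n) < m + 1 / real (Suc n)" for n by metis
  have par: "(norm (a - b))\<^sup>2 \<le> 2 * (f a - m) + 2 * (f b - m)" for a b
  proof -
    have "(norm (a - b))\<^sup>2 = 2 * f a + 2 * f b - 4 * f ((1/2) *\<^sub>R (a + b))"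
      by (simp add: f_def power2_norm_eq_inner inner_diff_left inner_diff_right inner_add_left
          inner_add_right blinfun.scaleR_right blinfun.add_right inner_commute algebra_simps)
    moreover note m_le[of "(1/2) *\<^sub>R (a + b)"]
    ultimately show ?thesis by (smt (verit))
  qed
  have "Cauchy x"
  proof (rule CauchyI)
    fix e :: real assume "e > 0"
    then obtain N where N: "4 * (1 / real (Suc N)) < e\<^sup>2"
      using reals_Archimedean[of "e\<^sup>2 / 4"] by (auto simp: field_simps inverse_eq_divide)
    have "norm (x k - x n) < e" if "k \<ge> N" "n \<ge> N" for k n
    proof -
      define t where "t i = 1 / real (Suc i)" for i
      have "t k \<le> t N" "t n \<le> t N"
        using that by (auto simp: t_def field_simps)
      then have "(norm (x k - x n))\<^sup>2 < e\<^sup>2"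
        using par[of "x k" "x n"] x[of k, folded t_def] x[of n, folded t_def] N[folded t_def] by (smt (verit))
      then show ?thesis using \<open>e > 0\<close> by (simp add: power2_less_imp_less)
    qed
    then show "\<exists>M. \<forall>m\<ge>M. \<forall>n\<ge>M. norm (x m - x n) < e" by blast
  qed
  then obtain v where v: "x \<longlonglongrightarrow> v" by (auto simp: Cauchy_convergent_iff convergent_def)
  have "(\<lambda>n. f (x n)) \<longlonglongrightarrow> f v"
    unfolding f_def by (intro tendsto_intros v)
  moreover have "(\<lambda>n. m + 1 / real (Suc n)) \<longlonglongrightarrow> m + 0"
    by (intro tendsto_intros LIMSEQ_Suc[OF lim_1_over_n])
  ultimately have fv: "f v \<le> m"
    by (intro LIMSEQ_le[of "\<lambda>n. f (x n)" "f v" "\<lambda>n. m + 1 / real (Suc n)" m]) (use x in \<open>auto intro: less_imp_le\<close>)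
  have "v \<bullet> y = \<phi> y" for y
  proof -
    \<comment> \<open>Moving from \<open>v\<close> by - c / d along \<open>y\<close> would lower
      \<open>f\<close> unless c = 0. The summand 1 in \<open>d\<close> avoids division by zero for y
      = 0 and keeps |y|^2 / d below 2.\<close>
    define c where "c = v \<bullet> y - \<phi> y"
    define d where "d = (norm y)\<^sup>2 + 1"
    have "f (v + (- c / d) *\<^sub>R y) - f v = 2 * (- c / d) * c + (- c / d)\<^sup>2 * (norm y)\<^sup>2"
    proof -
      have "(norm (v + t *\<^sub>R y))\<^sup>2 = (norm v)\<^sup>2 + 2 * t * (v \<bullet> y) + t\<^sup>2 * (norm y)\<^sup>2" for t
        unfolding power2_norm_eq_inner
        by (simp add: inner_add_left inner_add_right inner_commute power2_eq_square algebra_simps)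
      then show ?thesis
        by (simp only: f_def blinfun.add_right blinfun.scaleR_right) (simp add: c_def algebra_simps add_divide_distrib diff_divide_distrib)
    qed
    moreover have "\<dots> = - (c\<^sup>2 / d) * (2 - (norm y)\<^sup>2 / d)"
      by (simp add: power2_eq_square algebra_simps)
    moreover have "f (v + (- c / d) *\<^sub>R y) - f v \<ge> 0"
      using m_le fv by (metis diff_ge_0_iff_ge order_trans)
    ultimately have "(c\<^sup>2 / d) * (2 - (norm y)\<^sup>2 / d) \<le> 0" by linarith
    moreover have d: "d > 0" unfolding d_def by (simp add: add_nonneg_pos)
    moreover have "2 - (norm y)\<^sup>2 / d > 0" using d by (simp add: field_simps) (simp add: d_def)
    ultimately have "c\<^sup>2 / d \<le> 0" by (metis mult_le_0_iff not_less)
    with d have "c = 0" by (simp add: divide_le_0_iff)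
    then show ?thesis by (simp add: c_def)
  qed
  then have "\<phi> = blinfun_inner_right v" by (intro blinfun_eqI) simp
  then show ?thesis using that by blast
qed

lemma norm_blinfun_inner_right: "norm (blinfun_inner_right v) = norm v"
proof (rule antisym)
  show "norm (blinfun_inner_right v) \<le> norm v"
    by (intro norm_blinfun_bound) (auto simp: Cauchy_Schwarz_ineq2)
  have "norm v * norm v \<le> norm (blinfun_inner_right v) * norm v"
    using norm_blinfun[of "blinfun_inner_right v" v] by (simp flip: power2_norm_eq_inner power2_eq_square)
  then show "norm v \<le> norm (blinfun_inner_right v)"
    by (cases "v = 0") auto
qed

section \<open>Square roots of nonnegative operators\<close>

text \<open>The polynomial t -> A (x + t y) . (x + t y) is nonnegative, so its discriminant is not
  positive; c = 0 is the degenerate case in which it is affine.\<close>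

lemma nonneg_op_Cauchy_Schwarz:
  assumes "selfadjoint_op A" "nonneg_op A"
  shows "(A x \<bullet> y)\<^sup>2 \<le> (A x \<bullet> x) * (A y \<bullet> y)"
proof -
  define a b c where "a = A x \<bullet> x" and "b = A x \<bullet> y" and "c = A y \<bullet> y"
  have ge: "a + 2 * t * b + t\<^sup>2 * c \<ge> 0" for t
  proof -
    have "A (x + t *\<^sub>R y) \<bullet> (x + t *\<^sub>R y) = a + 2 * t * b + t\<^sup>2 * c"
      using assms(1) by (simp add: a_def b_def c_def selfadjoint_op_def blinfun.add_right
          blinfun.scaleR_right inner_add_left inner_add_right power2_eq_square algebra_simps)
        (metis inner_commute)
    then show ?thesis using assms(2) by (metis nonneg_op_def)
  qed
  have a: "a \<ge> 0" and c: "c \<ge> 0" using assms(2) by (auto simp: a_def c_def nonneg_op_def)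
  have "b\<^sup>2 \<le> a * c"
  proof (cases "c = 0")
    case True
    have "b = 0"
    proof (rule ccontr)
      assume "b \<noteq> 0"
      \<comment> \<open>At this t the affine polynomial a + 2 t b takes the value - 1.\<close>
      with ge[of "- (a + 1) / (2 * b)"] True show False by (simp add: field_simps)
    qed
    then show ?thesis using a c by simp
  next
    case False
    with c have c0: "c > 0" by simp
    have "a + 2 * (- b / c) * b + (- b / c)\<^sup>2 * c = a - b\<^sup>2 / c"
      using c0 by (simp add: power2_eq_square field_simps)
    with ge[of "- b / c"] have "b\<^sup>2 / c \<le> a" by linarith
    then show ?thesis using c0 by (simp add: field_simps)
  qed
  then show ?thesis by (simp add: a_def b_def c_def)
qed

text \<open>Cauchy-Schwarz for the form of \<open>A\<close> with y = A x, after which |A x|^2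
  cancels. It turns smallness of A x . x into smallness of A x.\<close>

lemma nonneg_op_norm_le:
  assumes "selfadjoint_op A" "nonneg_op A"
  shows "(norm (A x))\<^sup>2 \<le> norm A * (A x \<bullet> x)"
proof (cases "A x = 0")
  case True
  then show ?thesis by simp
next
  case False
  have "((norm (A x))\<^sup>2)\<^sup>2 = (A x \<bullet> A x)\<^sup>2" by (simp add: power2_norm_eq_inner)
  also have "\<dots> \<le> (A x \<bullet> x) * (A (A x) \<bullet> A x)"
    by (rule nonneg_op_Cauchy_Schwarz[OF assms])
  also have "\<dots> \<le> (A x \<bullet> x) * (norm A * (norm (A x))\<^sup>2)"
  proof (rule mult_left_mono)
    have "A (A x) \<bullet> A x \<le> norm (A (A x)) * norm (A x)" by (rule norm_cauchy_schwarz)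
    also have "\<dots> \<le> norm A * (norm (A x))\<^sup>2"
      using mult_right_mono[OF norm_blinfun[of A "A x"], of "norm (A x)"]
      by (simp add: power2_eq_square mult.assoc)
    finally show "A (A x) \<bullet> A x \<le> norm A * (norm (A x))\<^sup>2" .
  qed (use assms(2) in \<open>simp add: nonneg_op_def\<close>)
  finally have "((norm (A x))\<^sup>2) * (norm (A x))\<^sup>2 \<le> (norm A * (A x \<bullet> x)) * (norm (A x))\<^sup>2"
    by (simp add: power2_eq_square mult_ac)
  moreover have "(norm (A x))\<^sup>2 > 0" using False by simp
  ultimately show ?thesis by (rule mult_right_le_imp_le)
qed

text \<open>
  If \<open>0 \<le> A \<le> 1\<close> and \<open>R = 1 - A\<close>, then a fixed point \<open>S\<close> of \<open>S \<mapsto> (R + S\<^sup>2) / 2\<close> satisfies \<open>(1 - S)\<^sup>2 = A\<close>.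
  The iteration started at \<open>0\<close> is dominated by the scalar iteration with \<open>R = 1\<close>.
\<close>
lemma contraction_sqrt_exists:
  fixes R :: "'v::{real_inner, banach} \<Rightarrow>\<^sub>L 'v"
  assumes sa: "selfadjoint_op R" and R: "norm R \<le> 1"
  obtains S where "selfadjoint_op S" "\<And>x. 2 *\<^sub>R S x = R x + S (S x)"
proof -
  define S where "S = rec_nat (0 :: 'v \<Rightarrow>\<^sub>L 'v) (\<lambda>_ S. (1/2) *\<^sub>R (R + (S o\<^sub>L S)))"
  define s where "s = rec_nat (0 :: real) (\<lambda>_ s. (1/2) * (1 + s\<^sup>2))"
  have S0: "S 0 = 0" and SS: "S (Suc n) = (1/2) *\<^sub>R (R + (S n o\<^sub>L S n))" for n by (auto simp: S_def)
  have s0: "s 0 = 0" and sS: "s (Suc n) = (1/2) * (1 + (s n)\<^sup>2)" for n by (auto simp: s_def)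
  have s_bd: "0 \<le> s n \<and> s n \<le> 1" for n
  proof (induction n)
    case (Suc n)
    then have "(s n)\<^sup>2 \<le> 1" by (simp add: power_le_one)
    then show ?case by (simp add: sS)
  qed (simp add: s0)
  have s_mono: "s n \<le> s (Suc n)" for n
    using zero_le_power2[of "s n - 1"] by (simp add: sS power2_diff)
  have nS: "norm (S n) \<le> s n" for n
  proof (induction n)
    case (Suc n)
    have "norm (S n o\<^sub>L S n) \<le> (s n)\<^sup>2"
      using norm_blinfun_compose[of "S n" "S n"] mult_mono[OF Suc Suc] s_bd[of n]
      by (simp add: power2_eq_square)
    then have "norm (R + (S n o\<^sub>L S n)) \<le> 1 + (s n)\<^sup>2"
      using R norm_triangle_ineq[of R "S n o\<^sub>L S n"] by linarith
    then show ?case by (simp add: SS sS)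
  qed (simp add: S0 s0)
  have diff: "norm (S (Suc n) - S n) \<le> s (Suc n) - s n" for n
  proof (induction n)
    case 0
    then show ?case using R by (simp add: S0 SS s0 sS)
  next
    case (Suc n)
    let ?d = "S (Suc n) - S n"
    \<comment> \<open>A difference of squares in the order S' d + d S, valid without commuting the
      factors. The scalar iteration obeys the same identity, so it keeps dominating the
      increments.\<close>
    have "S (Suc (Suc n)) - S (Suc n) = (1/2) *\<^sub>R ((S (Suc n) o\<^sub>L ?d) + (?d o\<^sub>L S n))"
      unfolding SS[of "Suc n"] SS[of n]
      by (rule blinfun_eqI) (simp add: blinfun.diff_left blinfun.diff_right blinfun.add_left
          blinfun.add_right blinfun.scaleR_left algebra_simps)
    then have "norm (S (Suc (Suc n)) - S (Suc n)) = (1/2) * norm ((S (Suc n) o\<^sub>L ?d) + (?d o\<^sub>L S n))"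
      by simp
    also have "\<dots> \<le> (1/2) * (norm (S (Suc n)) * norm ?d + norm ?d * norm (S n))"
      by (intro mult_left_mono order_trans[OF norm_triangle_ineq] add_mono norm_blinfun_compose) simp
    also have "\<dots> \<le> (1/2) * (s (Suc n) * (s (Suc n) - s n) + (s (Suc n) - s n) * s n)"
      using nS s_bd Suc s_mono[of n] by (intro mult_left_mono add_mono mult_mono) auto
    also have "\<dots> = s (Suc (Suc n)) - s (Suc n)"
      by (simp add: sS[of "Suc n"] sS[of n] power2_eq_square field_simps)
    finally show ?case .
  qed
  have "convergent s"
    using s_bd s_mono by (intro Bseq_mono_convergent BseqI'[of _ 1]) (auto simp: incseq_SucI incseqD)
  \<comment> \<open>The increments of \<open>s\<close> telescope, so those of \<open>S\<close> are
    absolutely summable and \<open>S\<close> converges in operator norm.\<close>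
  then have "summable (\<lambda>n. s (Suc n) - s n)" by (simp add: convergent_LIMSEQ_iff telescope_summable)
  then have "summable (\<lambda>n. S (Suc n) - S n)"
    by (rule summable_comparison_test'[where N = 0]) (use diff in auto)
  then have "convergent (\<lambda>n. \<Sum>k<n. S (Suc k) - S k)" by (simp add: summable_iff_convergent)
  then have "convergent S" by (simp add: sum_lessThan_telescope S0)
  then obtain T where T: "S \<longlonglongrightarrow> T" by (auto simp: convergent_def)
  have Tx: "(\<lambda>n. S n x) \<longlonglongrightarrow> T x" for x by (intro tendsto_intros T)
  have "(\<lambda>n. 2 *\<^sub>R S (Suc n) x) \<longlonglongrightarrow> 2 *\<^sub>R T x" for x
    by (intro tendsto_intros LIMSEQ_Suc[OF T])
  moreover have "(\<lambda>n. R x + S n (S n x)) \<longlonglongrightarrow> R x + T (T x)" for x by (intro tendsto_intros T)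
  moreover have "2 *\<^sub>R S (Suc n) x = R x + S n (S n x)" for n x
    by (simp add: SS blinfun.scaleR_left blinfun.add_left)
  ultimately have fix_T: "2 *\<^sub>R T x = R x + T (T x)" for x
    using LIMSEQ_unique[of "\<lambda>n. 2 *\<^sub>R S (Suc n) x" "2 *\<^sub>R T x" "R x + T (T x)"] by simp
  have sa_S: "S n x \<bullet> y = x \<bullet> S n y" for n x y
  proof (induction n arbitrary: x y)
    case (Suc n)
    then show ?case using sa
      by (simp add: SS blinfun.scaleR_left blinfun.add_left inner_add_left inner_add_right selfadjoint_op_def)
  qed (simp add: S0)
  have "T x \<bullet> y = x \<bullet> T y" for x y
    using LIMSEQ_unique[OF tendsto_inner[OF Tx[of x] tendsto_const[of y]]]
      tendsto_inner[OF tendsto_const[of x] Tx[of y]] by (simp add: sa_S)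
  then show ?thesis using that fix_T by (auto simp: selfadjoint_op_def)
qed

text \<open>Rescaling by c = |A| makes R = 1 - A / c a contraction, and T = sqrt c (1 - S) squares
  to A. Only selfadjointness and T T = A are recorded; together they give A x . x = |T x|^2.\<close>

lemma nonneg_op_sqrt_exists:
  fixes A :: "'v::{real_inner, banach} \<Rightarrow>\<^sub>L 'v"
  assumes sa: "selfadjoint_op A" and nn: "nonneg_op A"
  obtains T where "selfadjoint_op T" "\<And>x. T (T x) = A x"
proof (cases "A = 0")
  case True
  then show ?thesis using that[of 0] by (simp add: selfadjoint_op_def)
next
  case False
  define c where "c = norm A"
  have c: "c > 0" using False by (simp add: c_def)
  define R where "R = id_blinfun - (1/c) *\<^sub>R A"
  have Rx: "R x = x - (1/c) *\<^sub>R A x" for x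
    by (simp add: R_def blinfun.diff_left blinfun.scaleR_left)
  have "selfadjoint_op R" using sa by (simp add: selfadjoint_op_def Rx inner_diff_left inner_diff_right)
  moreover have "norm R \<le> 1"
  proof (rule norm_blinfun_bound)
    fix x
    have "(norm (R x))\<^sup>2 = (norm x)\<^sup>2 - (2/c) * (A x \<bullet> x) + (1/c\<^sup>2) * (norm (A x))\<^sup>2"
      using dot_norm_neg[of x "(1/c) *\<^sub>R A x"] c
      by (simp add: Rx inner_commute[of x] power_divide field_simps)
    also have "\<dots> \<le> (norm x)\<^sup>2 - (2/c) * (A x \<bullet> x) + (1/c\<^sup>2) * (c * (A x \<bullet> x))"
      using nonneg_op_norm_le[OF sa nn, of x] c
      by (intro add_left_mono mult_left_mono) (auto simp: c_def)
    also have "\<dots> = (norm x)\<^sup>2 - (1/c) * (A x \<bullet> x)"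
      using c by (simp add: power2_eq_square field_simps)
    also have "\<dots> \<le> (norm x)\<^sup>2" using nn c by (simp add: nonneg_op_def)
    finally show "norm (R x) \<le> 1 * norm x" using power2_le_imp_le[of "norm (R x)" "norm x"] by simp
  qed simp
  ultimately obtain S where S: "selfadjoint_op S" "\<And>x. 2 *\<^sub>R S x = R x + S (S x)"
    using contraction_sqrt_exists by blast
  define T where "T = sqrt c *\<^sub>R (id_blinfun - S)"
  have Tx: "T x = sqrt c *\<^sub>R (x - S x)" for x
    by (simp add: T_def blinfun.diff_left blinfun.scaleR_left)
  have "T (T x) = A x" for x
  proof -
    have "T (T x) = c *\<^sub>R (x - 2 *\<^sub>R S x + S (S x))"
      using c by (simp add: Tx blinfun.diff_right blinfun.scaleR_right algebra_simps scaleR_2)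
    also have "x - 2 *\<^sub>R S x + S (S x) = (1/c) *\<^sub>R A x"
      by (simp add: S(2) Rx)
    finally show ?thesis using c by simp
  qed
  moreover have "selfadjoint_op T"
    using S(1) by (simp add: selfadjoint_op_def Tx inner_diff_left inner_diff_right)
  ultimately show ?thesis using that by blast
qed

text \<open>If every unit vector stayed below the value \<open>?b\<close> slightly under the norm,
  \<open>?b\<close> would itself be an operator bound. A positive norm makes \<open>?b\<close>
  strictly smaller than the norm.\<close>

lemma blinfun_approx_norm:
  fixes D :: "'v::real_normed_vector \<Rightarrow>\<^sub>L 'w::real_normed_vector"
  assumes "norm D > 0"
  obtains x where "\<And>n. norm (x n) = 1" "(\<lambda>n. norm (D (x n))) \<longlonglongrightarrow> norm D"
proof -
  have "\<exists>x. norm x = 1 \<and> norm D - norm D / real (Suc n) \<le> norm (D x)" for n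
  proof (rule ccontr)
    let ?b = "norm D - norm D / real (Suc n)"
    assume "\<not> ?thesis"
    then have *: "norm (D x) < ?b" if "norm x = 1" for x
      using that by (auto simp: not_le)
    have "norm (D x) \<le> ?b * norm x" for x
    proof (cases "x = 0")
      case False
      then have "norm (D ((1 / norm x) *\<^sub>R x)) < ?b" by (intro *) simp
      then show ?thesis using False by (simp add: blinfun.scaleR_right field_simps)
    qed simp
    moreover have "?b \<ge> 0" using assms by (simp add: field_simps)
    ultimately have "norm D \<le> ?b" by (intro norm_blinfun_bound)
    then show False using assms by (simp add: field_simps)
  qed
  then obtain x where x: "norm (x n) = 1" "norm D - norm D / real (Suc n) \<le> norm (D (x n))" for n
    by metis
  have lim: "(\<lambda>n. norm D - norm D * (1 / real (Suc n))) \<longlonglongrightarrow> norm D"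
    using tendsto_diff[OF tendsto_const tendsto_mult_right_zero[OF LIMSEQ_Suc[OF lim_1_over_n]], of "norm D" "norm D"]
    by simp
  have "norm (D (x n)) \<le> norm D" for n
    using norm_blinfun[of D "x n"] by (simp add: x)
  then have "(\<lambda>n. norm (D (x n))) \<longlonglongrightarrow> norm D"
    by (intro tendsto_sandwich[OF _ _ lim tendsto_const]) (use x in auto)
  with x(1) that show ?thesis by blast
qed

text \<open>
  Uniqueness of the nonnegative square root: \<open>D = A - P\<close> satisfies \<open>A D + D P = 0\<close>, and along a sequence
  of approximate eigenvectors of \<open>D\<^sup>2\<close> for \<open>\<parallel>D\<parallel>\<^sup>2\<close> this forces \<open>A x \<bullet> x\<close> and \<open>P x \<bullet> x\<close> to vanish in the limit.
\<close>
lemma is_modulus_nonneg_op: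
  fixes A P :: "'v::{real_inner, banach} \<Rightarrow>\<^sub>L 'v"
  assumes sa: "selfadjoint_op A" and nn: "nonneg_op A" and m: "is_modulus A P"
  shows "P = A"
proof (rule ccontr)
  assume "P \<noteq> A"
  define D where "D = A - P"
  define \<mu> where "\<mu> = norm D"
  have Dx: "D x = A x - P x" for x by (simp add: D_def blinfun.diff_left)
  have \<mu>: "\<mu> > 0" using \<open>P \<noteq> A\<close> by (simp add: \<mu>_def D_def)
  have saP: "selfadjoint_op P" and nnP: "nonneg_op P" and PA: "P x \<bullet> P y = A x \<bullet> A y" for x y
    using m by (auto simp: is_modulus_def)
  have saD: "D x \<bullet> y = x \<bullet> D y" for x y
    using sa saP by (simp add: Dx selfadjoint_op_def inner_diff_left inner_diff_right)
  obtain x where x: "\<And>n. norm (x n) = 1" "(\<lambda>n. norm (D (x n))) \<longlonglongrightarrow> \<mu>"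
    using blinfun_approx_norm[of D] \<mu> by (auto simp: \<mu>_def)
  \<comment> \<open>For a unit vector x and selfadjoint \<open>D\<close>, |D D x - mu^2 x|^2 = |D D
    x|^2 - 2 mu^2 |D x|^2 + mu^4, and the first term is at most mu^2 |D x|^2.\<close>
  have D2: "(\<lambda>n. D (D (x n)) - \<mu>\<^sup>2 *\<^sub>R x n) \<longlonglongrightarrow> 0"
  proof -
    have "(norm (D (D (x n)) - \<mu>\<^sup>2 *\<^sub>R x n))\<^sup>2 \<le> \<mu>\<^sup>2 * (\<mu>\<^sup>2 - (norm (D (x n)))\<^sup>2)" for n
    proof -
      have "(norm (D (D (x n)) - \<mu>\<^sup>2 *\<^sub>R x n))\<^sup>2
          = (norm (D (D (x n))))\<^sup>2 - 2 * \<mu>\<^sup>2 * (norm (D (x n)))\<^sup>2 + (\<mu>\<^sup>2)\<^sup>2 * (norm (x n))\<^sup>2"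
        by (simp add: power2_norm_eq_inner inner_diff_left inner_diff_right inner_commute saD
            power2_eq_square[of "\<mu>\<^sup>2"] algebra_simps)
      also have "(norm (D (D (x n))))\<^sup>2 \<le> \<mu>\<^sup>2 * (norm (D (x n)))\<^sup>2"
        using power_mono[OF norm_blinfun[of D "D (x n)"], of 2] by (simp add: \<mu>_def power_mult_distrib)
      finally show ?thesis by (simp add: x(1) power2_eq_square[of "\<mu>\<^sup>2"] algebra_simps)
    qed
    moreover have "(\<lambda>n. \<mu>\<^sup>2 * (\<mu>\<^sup>2 - (norm (D (x n)))\<^sup>2)) \<longlonglongrightarrow> \<mu>\<^sup>2 * (\<mu>\<^sup>2 - \<mu>\<^sup>2)"
      by (intro tendsto_intros x)
    ultimately have "(\<lambda>n. (norm (D (D (x n)) - \<mu>\<^sup>2 *\<^sub>R x n))\<^sup>2) \<longlonglongrightarrow> 0"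
      using LIMSEQ_zero_squeeze[of "\<lambda>n. (norm (D (D (x n)) - \<mu>\<^sup>2 *\<^sub>R x n))\<^sup>2"
        "\<lambda>n. \<mu>\<^sup>2 * (\<mu>\<^sup>2 - (norm (D (x n)))\<^sup>2)"] by simp
    then show ?thesis by (rule LIMSEQ_zero_of_norm_square)
  qed
  \<comment> \<open>In \<open>eq\<close> the term with \<open>C\<close> is nonnegative and D D x is
    close to mu^2 x, so mu^2 (B x . x) is squeezed between 0 and an error tending to 0. It is used
    for (B, C) = (P, A) and (A, P).\<close>
  have key: "(\<lambda>n. B (x n)) \<longlonglongrightarrow> 0"
    if B: "selfadjoint_op B" "nonneg_op B" and C: "nonneg_op C"
      and eq: "\<And>y. C (D y) \<bullet> D y + B y \<bullet> D (D y) = 0" for B C :: "'v \<Rightarrow>\<^sub>L 'v"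
  proof -
    define r where "r n = B (x n) \<bullet> (D (D (x n)) - \<mu>\<^sup>2 *\<^sub>R x n)" for n
    have "norm (r n) \<le> norm B * norm (D (D (x n)) - \<mu>\<^sup>2 *\<^sub>R x n)" for n
    proof -
      have "norm (r n) \<le> norm (B (x n)) * norm (D (D (x n)) - \<mu>\<^sup>2 *\<^sub>R x n)"
        unfolding r_def by (simp add: Cauchy_Schwarz_ineq2)
      also have "\<dots> \<le> norm B * norm (D (D (x n)) - \<mu>\<^sup>2 *\<^sub>R x n)"
        using norm_blinfun[of B "x n"] x(1)[of n] by (intro mult_right_mono) auto
      finally show ?thesis .
    qed
    then have "r \<longlonglongrightarrow> 0"
      by (intro Lim_null_comparison[OF always_eventually tendsto_mult_right_zero[OF tendsto_norm_zero[OF D2]]] allI)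
    moreover have "\<mu>\<^sup>2 * (B (x n) \<bullet> x n) \<le> - r n" for n
    proof -
      have "\<mu>\<^sup>2 * (B (x n) \<bullet> x n) = - r n - C (D (x n)) \<bullet> D (x n)"
        using eq[of "x n"] by (simp add: r_def inner_diff_right)
      then show ?thesis using C by (simp add: nonneg_op_def)
    qed
    moreover have "0 \<le> B (x n) \<bullet> x n" for n using B(2) by (simp add: nonneg_op_def)
    ultimately have "(\<lambda>n. \<mu>\<^sup>2 * (B (x n) \<bullet> x n)) \<longlonglongrightarrow> 0"
      using LIMSEQ_zero_squeeze[of "\<lambda>n. \<mu>\<^sup>2 * (B (x n) \<bullet> x n)" "\<lambda>n. - r n"] tendsto_minus[of r 0] by simp
    from tendsto_mult[OF tendsto_const[of "norm B / \<mu>\<^sup>2"] this]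
    have "(\<lambda>n. norm B * (B (x n) \<bullet> x n)) \<longlonglongrightarrow> 0" using \<mu> by simp
    then have "(\<lambda>n. (norm (B (x n)))\<^sup>2) \<longlonglongrightarrow> 0"
      using LIMSEQ_zero_squeeze[of "\<lambda>n. (norm (B (x n)))\<^sup>2" "\<lambda>n. norm B * (B (x n) \<bullet> x n)"]
        nonneg_op_norm_le[OF B] by simp
    then show ?thesis by (rule LIMSEQ_zero_of_norm_square)
  qed
  have "A (A y) \<bullet> z = P (P y) \<bullet> z" for y z
    using sa[unfolded selfadjoint_op_def] saP[unfolded selfadjoint_op_def] PA[of y z] by simp
  then have "A (A y) = P (P y)" for y using vector_eq_rdot by blast
  \<comment> \<open>Since A A = P P, A (A - P) + (A - P) P = A A - P P = 0, and likewise with the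
    roles of \<open>A\<close> and \<open>P\<close> exchanged.\<close>
  then have zero: "A (D y) + D (P y) = 0" "P (D y) + D (A y) = 0" for y
    by (simp_all add: Dx blinfun.diff_right)
  have "A (D y) \<bullet> D y + P y \<bullet> D (D y) = 0" "P (D y) \<bullet> D y + A y \<bullet> D (D y) = 0" for y
    using zero[of y, THEN arg_cong[where f = "\<lambda>z. z \<bullet> D y"]] by (simp_all add: inner_add_left saD)
  then have "(\<lambda>n. P (x n)) \<longlonglongrightarrow> 0" "(\<lambda>n. A (x n)) \<longlonglongrightarrow> 0"
    using key[OF saP nnP nn] key[OF sa nn nnP] by simp_all
  then have "(\<lambda>n. A (x n) - P (x n)) \<longlonglongrightarrow> 0 - 0" by (intro tendsto_diff)
  then have "(\<lambda>n. norm (D (x n))) \<longlonglongrightarrow> 0" by (simp add: Dx tendsto_norm_zero)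
  then show False using x(2) \<mu> LIMSEQ_unique by fastforce
qed

section \<open>Orthonormal systems\<close>

definition ortho_proj :: "'v::real_inner set \<Rightarrow> 'v \<Rightarrow> 'v" where
  "ortho_proj U x = (\<Sum>u\<in>U. (x \<bullet> u) *\<^sub>R u)"

lemma orthonormal_inner:
  assumes "orthonormal U" "u \<in> U" "v \<in> U"
  shows "u \<bullet> v = (if u = v then 1 else 0)"
  using assms by (auto simp: orthonormal_def pairwise_def orthogonal_def norm_eq_1)

context
  fixes U :: "'v::real_inner set"
  assumes fin: "finite U" and on: "orthonormal U"
begin

lemma ortho_proj_in_span: "ortho_proj U x \<in> span U"
  unfolding ortho_proj_def by (intro span_sum span_scale span_base)

lemma inner_sum_orthonormal:
  assumes "v \<in> U"
  shows "(\<Sum>u\<in>U. c u *\<^sub>R u) \<bullet> v = c v"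
proof -
  have "(\<Sum>u\<in>U. c u *\<^sub>R u) \<bullet> v = (\<Sum>u\<in>U. if u = v then c u else 0)"
    unfolding inner_sum_left
    by (intro sum.cong) (use orthonormal_inner[OF on] assms in auto)
  then show ?thesis using fin assms by simp
qed

lemma norm_sum_orthonormal: "(norm (\<Sum>u\<in>U. c u *\<^sub>R u))\<^sup>2 = (\<Sum>u\<in>U. (c u)\<^sup>2)"
proof -
  have "(norm (\<Sum>u\<in>U. c u *\<^sub>R u))\<^sup>2 = (\<Sum>v\<in>U. c v * ((\<Sum>u\<in>U. c u *\<^sub>R u) \<bullet> v))"
    by (simp add: power2_norm_eq_inner inner_sum_right)
  also have "\<dots> = (\<Sum>u\<in>U. (c u)\<^sup>2)"
    by (intro sum.cong) (auto simp: inner_sum_orthonormal power2_eq_square)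
  finally show ?thesis .
qed

lemma ortho_proj_residual:
  assumes "y \<in> span U"
  shows "(x - ortho_proj U x) \<bullet> y = 0"
  using assms
proof (induction rule: span_induct_alt)
  case (step c v z)
  then show ?case
    by (simp add: inner_add_right inner_diff_left ortho_proj_def inner_sum_orthonormal)
qed simp

text \<open>Pythagoras: the residual is orthogonal to \<open>span U\<close>, so the projection is
  the best approximation from there.\<close>

lemma norm_ortho_proj_residual_le:
  assumes "y \<in> span U"
  shows "norm (x - ortho_proj U x) \<le> norm (x - y)"
proof -
  define p where "p = ortho_proj U x"
  have "p - y \<in> span U" unfolding p_def by (intro span_diff ortho_proj_in_span assms)
  then have "(x - p) \<bullet> (p - y) = 0" unfolding p_def by (rule ortho_proj_residual)
  then have "(norm ((x - p) + (p - y)))\<^sup>2 = (norm (x - p))\<^sup>2 + (norm (p - y))\<^sup>2"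
    unfolding power2_norm_eq_inner by (simp only: inner_add_left inner_add_right inner_commute)
  then have "(norm (x - p))\<^sup>2 \<le> (norm (x - y))\<^sup>2" by simp
  then show ?thesis by (simp add: p_def)
qed

end

text \<open>A point y of the dense union lies in all later spans, so from then on the residual at x
  is at most |x - y|.\<close>

lemma ortho_proj_tendsto:
  fixes U :: "nat \<Rightarrow> 'v::real_inner set"
  assumes U: "\<And>n. finite (U n)" "\<And>n. orthonormal (U n)"
    and inc: "incseq (\<lambda>n. span (U n))" and dense: "closure (\<Union>n. span (U n)) = UNIV"
  shows "(\<lambda>n. ortho_proj (U n) x) \<longlonglongrightarrow> x"
proof (rule LIMSEQ_I)
  fix r :: real assume "r > 0"
  have "x \<in> closure (\<Union>n. span (U n))" using dense by simp
  then obtain y where "y \<in> (\<Union>n. span (U n))" "dist y x < r"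
    using \<open>r > 0\<close> closure_approachable by blast
  then obtain N where y: "y \<in> span (U N)" "norm (x - y) < r"
    by (auto simp: dist_norm norm_minus_commute)
  have "norm (ortho_proj (U n) x - x) < r" if "n \<ge> N" for n
  proof -
    have "y \<in> span (U n)" using y(1) incseqD[OF inc that] by blast
    then have "norm (x - ortho_proj (U n) x) \<le> norm (x - y)" by (intro norm_ortho_proj_residual_le U)
    then show ?thesis using y(2) by (simp add: norm_minus_commute)
  qed
  then show "\<exists>N. \<forall>n\<ge>N. norm (ortho_proj (U n) x - x) < r" by blast
qed

text \<open>
  A Hilbert basis is listed as a sequence; the entry \<open>0\<close> fills the remaining places if the basis is
  finite.
\<close>
locale hilbert_sequence =
  fixes e :: "nat \<Rightarrow> 'v::real_inner"
  assumes ortho: "i \<noteq> j \<Longrightarrow> e i \<bullet> e j = 0"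
    and unit: "e i \<noteq> 0 \<Longrightarrow> norm (e i) = 1"
    and total: "closure (span (range e)) = UNIV"
begin

text \<open>Without the filler zeros this is an orthonormal set even if the basis is finite;
  \<open>sum_basis\<close> translates its sums back to sums over indices.\<close>

definition basis :: "nat \<Rightarrow> 'v set" where "basis n = e ` {..<n} - {0}"

lemma finite_basis: "finite (basis n)" by (simp add: basis_def)

lemma inj_nonzero: "e i \<noteq> 0 \<Longrightarrow> e i = e j \<Longrightarrow> i = j"
  using ortho[of i j] by auto

lemma orthonormal_basis: "orthonormal (basis n)"
proof -
  have "e i \<bullet> e j = 0" if "e i \<noteq> e j" for i j using that ortho by metis
  then show ?thesis
    unfolding orthonormal_def basis_def pairwise_def orthogonal_def using unit by auto
qed

lemma sum_basis:
  fixes f :: "'v \<Rightarrow> 'w::real_vector"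
  assumes "f 0 = 0"
  shows "(\<Sum>u\<in>basis n. f u) = (\<Sum>i<n. f (e i))"
proof -
  have "(\<Sum>i<n. f (e i)) = (\<Sum>i\<in>{i. i < n \<and> e i \<noteq> 0}. f (e i))"
    by (intro sum.mono_neutral_right) (use assms in auto)
  also have "\<dots> = (\<Sum>u\<in>e ` {i. i < n \<and> e i \<noteq> 0}. f u)"
    by (subst sum.reindex) (auto intro!: inj_onI simp: inj_nonzero)
  also have "e ` {i. i < n \<and> e i \<noteq> 0} = basis n" by (auto simp: basis_def)
  finally show ?thesis by simp
qed

lemma incseq_basis: "incseq (\<lambda>n. span (basis n))"
  by (intro incseq_SucI span_mono) (auto simp: basis_def)

lemma closure_span_basis: "closure (\<Union>n. span (basis n)) = UNIV"
proof -
  have "span (range e) \<subseteq> (\<Union>n. span (basis n))"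
  proof
    fix x assume "x \<in> span (range e)"
    then show "x \<in> (\<Union>n. span (basis n))"
    proof (induction rule: span_induct_alt)
      case base
      then show ?case using span_zero by blast
    next
      case (step c v y)
      then obtain i n where i: "v = e i" and n: "y \<in> span (basis n)" by blast
      define m where "m = max (Suc i) n"
      have "e i \<in> insert 0 (basis m)" by (auto simp: basis_def m_def)
      then have "v \<in> span (basis m)" using i by (auto intro: span_base span_zero)
      moreover have "y \<in> span (basis m)" using n incseqD[OF incseq_basis, of n m] by (auto simp: m_def)
      ultimately show ?case by (blast intro: span_add span_scale)
    qed
  qed
  from closure_mono[OF this] total show ?thesis by auto
qed

lemma expansion: "(\<lambda>n. \<Sum>i<n. (x \<bullet> e i) *\<^sub>R e i) \<longlonglongrightarrow> x"
  using ortho_proj_tendsto[OF finite_basis orthonormal_basis incseq_basis closure_span_basis, of x]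
  by (simp add: ortho_proj_def sum_basis)

lemma parseval: "(\<lambda>i. (x \<bullet> e i)\<^sup>2) sums (norm x)\<^sup>2"
proof -
  have "(norm (\<Sum>i<n. (x \<bullet> e i) *\<^sub>R e i))\<^sup>2 = (\<Sum>i<n. (x \<bullet> e i)\<^sup>2)" for n
    using norm_sum_orthonormal[OF finite_basis orthonormal_basis, of "\<lambda>u. x \<bullet> u" n]
    by (simp add: sum_basis)
  then show ?thesis
    unfolding sums_def using tendsto_power[OF tendsto_norm[OF expansion[of x]], of 2] by simp
qed

end

text \<open>Distinct elements are sqrt 2 apart, so choosing for each a point of a countable dense
  set within 1/2 is injective.\<close>

lemma countable_orthonormal:
  fixes U :: "'v::{real_inner, second_countable_topology} set"
  assumes "orthonormal U"
  shows "countable U"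
proof -
  have far: "dist u v \<ge> 1" if "u \<in> U" "v \<in> U" "u \<noteq> v" for u v
  proof -
    have "(norm (u - v))\<^sup>2 = 2"
      using that orthonormal_inner[OF assms] unfolding power2_norm_eq_inner
      by (simp add: inner_diff_left inner_diff_right)
    then show ?thesis using power2_le_imp_le[of 1 "norm (u - v)"] by (simp add: dist_norm)
  qed
  obtain D :: "'v set" where D: "countable D" "\<And>X. open X \<Longrightarrow> X \<noteq> {} \<Longrightarrow> \<exists>d\<in>D. d \<in> X"
    using countable_dense_setE by metis
  have "\<exists>d\<in>D. dist u d < 1/2" for u
    using D(2)[of "ball u (1/2)"] by auto
  then obtain g where g: "g u \<in> D" "dist u (g u) < 1/2" for u by metis
  have "inj_on g U"
  proof (rule inj_onI, rule ccontr)
    fix u v assume *: "u \<in> U" "v \<in> U" "g u = g v" "u \<noteq> v"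
    have "dist u v \<le> dist u (g u) + dist v (g v)" using *(3) by (metis dist_triangle2)
    then have "dist u v < 1" using g(2)[of u] g(2)[of v] by linarith
    with far * show False by force
  qed
  moreover have "countable (g ` U)" using D(1) g(1) by (meson countable_subset image_subsetI)
  ultimately show ?thesis by (rule countable_image_inj_on[rotated])
qed

text \<open>An injection of \<open>U\<close> into the naturals gives each basis vector its index;
  every other index holds 0, whence the condition g 0 = 0. The second conclusion turns the unordered
  sum in \<open>op_trace\<close> into a series.\<close>

lemma hilbert_basis_enumerate:
  fixes U :: "'v::{real_inner, second_countable_topology} set"
  assumes "hilbert_basis U"
  obtains e where "hilbert_sequence e"
    "\<And>g :: 'v \<Rightarrow> real. g 0 = 0 \<Longrightarrow> g summable_on U \<Longrightarrow> (\<lambda>i. g (e i)) sums (\<Sum>\<^sub>\<infinity>u\<in>U. g u)"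
proof -
  have on: "orthonormal U" and cl: "closure (span U) = UNIV" using assms by (auto simp: hilbert_basis_def)
  have "countable U" by (rule countable_orthonormal[OF on])
  then obtain f :: "'v \<Rightarrow> nat" where f: "inj_on f U" by (auto simp: countable_def)
  define e where "e i = (if i \<in> f ` U then inv_into U f i else 0)" for i
  have e_f: "e (f u) = u" if "u \<in> U" for u using that f by (simp add: e_def)
  have e_cases: "e i = 0 \<or> (e i \<in> U \<and> f (e i) = i)" for i
    by (auto simp: e_def f_inv_into_f inv_into_into f)
  have "hilbert_sequence e"
  proof
    show "e i \<bullet> e j = 0" if "i \<noteq> j" for i j
      using e_cases[of i] e_cases[of j] that orthonormal_inner[OF on, of "e i" "e j"] by fastforce
    show "norm (e i) = 1" if "e i \<noteq> 0" for i
      using e_cases[of i] that on by (auto simp: orthonormal_def)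
    have "U \<subseteq> range e" using e_f by (metis rangeI subsetI)
    then have "closure (span U) \<subseteq> closure (span (range e))" by (intro closure_mono span_mono)
    then show "closure (span (range e)) = UNIV" using cl by auto
  qed
  moreover have "(\<lambda>i. g (e i)) sums (\<Sum>\<^sub>\<infinity>u\<in>U. g u)"
    if "g 0 = 0" "g summable_on U" for g :: "'v \<Rightarrow> real"
  proof -
    have "(g has_sum (\<Sum>\<^sub>\<infinity>u\<in>U. g u)) U" using that(2) by simp
    also have "(g has_sum (\<Sum>\<^sub>\<infinity>u\<in>U. g u)) U \<longleftrightarrow> ((\<lambda>i. g (e i)) has_sum (\<Sum>\<^sub>\<infinity>u\<in>U. g u)) (f ` U)"
      by (subst has_sum_reindex[OF f]) (auto simp: o_def e_f intro!: has_sum_cong)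
    also have "\<dots> \<longleftrightarrow> ((\<lambda>i. g (e i)) has_sum (\<Sum>\<^sub>\<infinity>u\<in>U. g u)) UNIV"
      by (intro has_sum_cong_neutral) (auto simp: e_def that(1))
    finally show ?thesis by (rule has_sum_imp_sums)
  qed
  ultimately show ?thesis using that by blast
qed

text \<open>Gram-Schmidt; a vanishing vector does not contribute, as \<open>x / 0 = 0\<close>.\<close>
lemma hilbert_basis_exists: "\<exists>U :: 'v::{real_inner, second_countable_topology} set. hilbert_basis U"
proof -
  obtain D :: "'v set" where D: "countable D" "\<And>X. open X \<Longrightarrow> X \<noteq> {} \<Longrightarrow> \<exists>d\<in>D. d \<in> X"
    using countable_dense_setE by metis
  have "D \<noteq> {}" using D(2)[of UNIV] by auto
  define d where "d = from_nat_into D"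
  have d: "range d = D" using D(1) \<open>D \<noteq> {}\<close> by (simp add: d_def range_from_nat_into)
  \<comment> \<open>Unnormalised Gram-Schmidt by recursion over all previous values. Normalisation
    is postponed to \<open>U\<close>, where the zero vectors are dropped.\<close>
  define w where "w = wfrec less_than (\<lambda>w n. d n - (\<Sum>k<n. ((d n \<bullet> w k) / (w k \<bullet> w k)) *\<^sub>R w k))"
  have w: "w n = d n - (\<Sum>k<n. ((d n \<bullet> w k) / (w k \<bullet> w k)) *\<^sub>R w k)" for n
    unfolding w_def by (subst wfrec[OF wf_less_than]) (simp add: cut_apply)
  have orth: "w n \<bullet> w k = 0" if "k < n" for n k
    using that
  proof (induction n arbitrary: k rule: less_induct)
    case (less n)
    have pair: "w i \<bullet> w k = 0" if "i < n" "i \<noteq> k" for i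
      using that less.IH[of i k] less.IH[of k i] less.prems by (metis inner_commute linorder_neqE_nat)
    have "(\<Sum>i<n. ((d n \<bullet> w i) / (w i \<bullet> w i)) *\<^sub>R w i) \<bullet> w k
        = (\<Sum>i<n. if i = k then d n \<bullet> w k else 0)"
      unfolding inner_sum_left by (intro sum.cong) (auto simp: pair)
    also have "\<dots> = d n \<bullet> w k" using less.prems by simp
    finally show ?case by (subst w) (simp add: inner_diff_left)
  qed
  then have orth': "w n \<bullet> w k = 0" if "k \<noteq> n" for n k
    using that by (metis inner_commute linorder_neqE_nat)
  define U where "U = (\<lambda>n. w n /\<^sub>R norm (w n)) ` {n. w n \<noteq> 0}"
  have "orthonormal U"
    unfolding orthonormal_def pairwise_def orthogonal_def U_def by (auto, metis orth')
  moreover have w_in: "w n \<in> span U" for n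
  proof (cases "w n = 0")
    case False
    then have "norm (w n) *\<^sub>R (w n /\<^sub>R norm (w n)) \<in> span U"
      by (intro span_scale span_base) (auto simp: U_def)
    then show ?thesis using False by simp
  qed (simp add: span_zero)
  have "d n \<in> span U" for n
  proof -
    have "d n = w n + (\<Sum>k<n. ((d n \<bullet> w k) / (w k \<bullet> w k)) *\<^sub>R w k)" by (simp add: w[of n])
    then show ?thesis using w_in by (metis (no_types, lifting) span_add span_scale span_sum)
  qed
  then have "D \<subseteq> span U" using d by auto
  moreover have "closure D = UNIV"
  proof -
    have "x \<in> closure D" for x
      unfolding closure_approachable using D(2)[of "ball x r" for r] by (force simp: dist_commute)
    then show ?thesis by auto
  qed
  ultimately have "hilbert_basis U"
    unfolding hilbert_basis_def by (metis closure_mono top.extremum_uniqueI)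
  then show ?thesis by blast
qed

section \<open>Calculus in \<open>S(V, Q)\<close>\<close>

lemma segment_bound:
  fixes g :: "real \<Rightarrow> 'a::real_normed_vector"
  assumes "\<And>t. 0 \<le> t \<Longrightarrow> t \<le> 1 \<Longrightarrow> (g has_vector_derivative g' t) (at t)"
    and "\<And>t. 0 \<le> t \<Longrightarrow> t \<le> 1 \<Longrightarrow> norm (g' t) \<le> B"
  shows "norm (g 1 - g 0) \<le> B"
proof -
  have "norm (g 1 - g 0) \<le> B * norm (1 - 0 :: real)"
  proof (rule differentiable_bound[where S = "{0..1}" and f' = "\<lambda>t h. h *\<^sub>R g' t"])
    show "(g has_derivative (\<lambda>h. h *\<^sub>R g' t)) (at t within {0..1})" if "t \<in> {0..1}" for t
      using assms(1)[of t] that by (auto simp: has_vector_derivative_def intro: has_derivative_at_withinI)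
    show "onorm (\<lambda>h. h *\<^sub>R g' t) \<le> B" if "t \<in> {0..1}" for t
    proof (rule onorm_bound)
      show "norm (h *\<^sub>R g' t) \<le> B * norm h" for h
        using mult_left_mono[OF assms(2)[of t], of "norm h"] that by (simp add: mult.commute)
      show "0 \<le> B" using order_trans[OF norm_ge_zero assms(2)[of t]] that by simp
    qed
  qed auto
  then show ?thesis by simp
qed

lemma iter_deriv_Nil: "iter_deriv f [] = f"
  by (simp add: fun_eq_iff)

locale form_space =
  fixes T :: "'v::real_normed_vector \<Rightarrow>\<^sub>L 'w::real_normed_vector" and Q :: "'v \<Rightarrow> real"
  assumes Q_eq: "Q X = (norm (T X))\<^sup>2"
begin

definition wt :: "'v list \<Rightarrow> real" where
  "wt Vs = prod_list (map (\<lambda>V. norm (T V)) Vs)"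

definition S_le :: "('v \<Rightarrow> complex) \<Rightarrow> real \<Rightarrow> bool" where
  "S_le f C \<longleftrightarrow> frechet_smooth f \<and> S_bound Q f C \<and> 0 \<le> C"

lemma wt_simps [simp]: "wt [] = 1" "wt (V # Vs) = norm (T V) * wt Vs" "wt (Vs @ Ws) = wt Vs * wt Ws"
  by (auto simp: wt_def)

lemma wt_nonneg [simp]: "0 \<le> wt Vs" by (induction Vs) auto

lemma wt_le: "wt Vs \<le> norm T ^ length Vs * prod_list (map norm Vs)"
proof (induction Vs)
  case (Cons V Vs)
  have "norm (T V) * wt Vs \<le> (norm T * norm V) * (norm T ^ length Vs * prod_list (map norm Vs))"
    by (intro mult_mono norm_blinfun Cons) auto
  then show ?case by (simp add: mult_ac)
qed simp

lemma S_bound_iff: "S_bound Q f C \<longleftrightarrow> (\<forall>X Vs. norm (iter_deriv f Vs X) \<le> C * wt Vs)"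
  by (simp add: S_bound_def wt_def Q_eq)

lemma S_le_bound: "S_le f C \<Longrightarrow> norm (iter_deriv f Vs X) \<le> C * wt Vs"
  by (simp add: S_le_def S_bound_iff)

lemma S_le_sup: "S_le f C \<Longrightarrow> norm (f X) \<le> C"
  using S_le_bound[of f C "[]" X] by simp

lemma S_le_nonneg: "S_le f C \<Longrightarrow> 0 \<le> C"
  by (simp add: S_le_def)

lemma S_le_has_derivative:
  assumes "S_le f C"
  shows "(iter_deriv f Vs has_derivative (\<lambda>Y. iter_deriv f (Y # Vs) X)) (at X)"
proof -
  have "iter_deriv f Vs differentiable (at X)"
    using assms by (auto simp: S_le_def frechet_smooth_def)
  then show ?thesis by (simp add: frechet_derivative_works)
qed

lemma S_le_linear: "S_le f C \<Longrightarrow> linear (\<lambda>Y. iter_deriv f (Y # Vs) X)"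
  using S_le_has_derivative has_derivative_bounded_linear bounded_linear.linear by blast

lemma S_le_path:
  assumes "S_le f C"
  shows "((\<lambda>t. iter_deriv f Vs (X + t *\<^sub>R Y)) has_vector_derivative iter_deriv f (Y # Vs) (X + t *\<^sub>R Y)) (at t)"
proof -
  have "((\<lambda>t. iter_deriv f Vs (X + t *\<^sub>R Y)) has_derivative
      (\<lambda>h. iter_deriv f ((h *\<^sub>R Y) # Vs) (X + t *\<^sub>R Y))) (at t)"
    by (rule has_derivative_compose[OF _ S_le_has_derivative[OF assms]])
      (auto intro!: derivative_eq_intros)
  moreover have "iter_deriv f ((h *\<^sub>R Y) # Vs) Z = h *\<^sub>R iter_deriv f (Y # Vs) Z" for h Z
    using linear_scale[OF S_le_linear[OF assms]] by simp
  ultimately show ?thesis by (simp add: has_vector_derivative_def)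
qed

text \<open>Mean value inequality along the segment: one more derivative in direction Y costs the
  factor |T Y|.\<close>

lemma S_le_lipschitz:
  assumes "S_le f C"
  shows "norm (iter_deriv f Vs (X + Y) - iter_deriv f Vs X) \<le> C * norm (T Y) * wt Vs"
proof -
  have "norm (iter_deriv f Vs (X + 1 *\<^sub>R Y) - iter_deriv f Vs (X + 0 *\<^sub>R Y)) \<le> C * norm (T Y) * wt Vs"
    by (rule segment_bound[of "\<lambda>t. iter_deriv f Vs (X + t *\<^sub>R Y)", OF S_le_path[OF assms]])
      (use S_le_bound[OF assms] in \<open>simp add: mult.assoc del: iter_deriv.simps\<close>, metis wt_simps(2) mult.assoc)
  then show ?thesis by simp
qed

text \<open>Subtracting the linear term from the path leaves a derivative that
  \<open>S_le_lipschitz\<close> bounds by t |T Y|^2. The result is uniform in X and has the form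
  that \<open>S_leI\<close> asks for.\<close>

lemma S_le_remainder:
  assumes "S_le f C"
  shows "norm (iter_deriv f Vs (X + Y) - iter_deriv f Vs X - iter_deriv f (Y # Vs) X)
    \<le> C * (norm (T Y))\<^sup>2 * wt Vs"
proof -
  define g where "g t = iter_deriv f Vs (X + t *\<^sub>R Y) - t *\<^sub>R iter_deriv f (Y # Vs) X" for t :: real
  define g' where "g' t = iter_deriv f (Y # Vs) (X + t *\<^sub>R Y) - iter_deriv f (Y # Vs) X" for t :: real
  have "norm (g 1 - g 0) \<le> C * (norm (T Y))\<^sup>2 * wt Vs"
  proof (rule segment_bound)
    fix t :: real assume t: "0 \<le> t" "t \<le> 1"
    show "(g has_vector_derivative g' t) (at t)"
      unfolding g_def g'_def
      by (rule derivative_eq_intros S_le_path[OF assms] refl)+ (simp del: iter_deriv.simps)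
    have "norm (g' t) \<le> C * norm (T (t *\<^sub>R Y)) * wt (Y # Vs)"
      unfolding g'_def by (rule S_le_lipschitz[OF assms])
    also have "\<dots> = t * (C * (norm (T Y))\<^sup>2 * wt Vs)"
      using t by (simp add: blinfun.scaleR_right power2_eq_square mult_ac)
    also have "\<dots> \<le> C * (norm (T Y))\<^sup>2 * wt Vs"
      using t S_le_nonneg[OF assms] by (intro mult_left_le_one_le) auto
    finally show "norm (g' t) \<le> C * (norm (T Y))\<^sup>2 * wt Vs" .
  qed
  then show ?thesis by (simp add: g_def del: iter_deriv.simps) (simp add: algebra_simps)
qed

text \<open>The assumptions on \<open>D\<close> are pointwise and stable under sums, series and
  limits of averages; derivatives, linear combinations, series and heat evolutions all enter
  \<open>S_space Q\<close> through this criterion. The constant \<open>K\<close> serves only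
  differentiability; the norm bound is \<open>C\<close>.\<close>

lemma S_leI:
  fixes D :: "'v list \<Rightarrow> 'v \<Rightarrow> complex"
  assumes C: "0 \<le> C"
    and lin: "\<And>Vs X. linear (\<lambda>Y. D (Y # Vs) X)"
    and bd: "\<And>Vs X. norm (D Vs X) \<le> C * wt Vs"
    and rem: "\<And>Vs X Y. norm (D Vs (X + Y) - D Vs X - D (Y # Vs) X) \<le> K * (norm (T Y))\<^sup>2 * wt Vs"
  shows "iter_deriv (D []) = D" and "S_le (D []) C"
proof -
  have prod_nonneg: "0 \<le> prod_list (map norm Vs)" for Vs :: "'v list"
    by (induction Vs) auto
  \<comment> \<open>Weights are at most |T|^m times the product of the norms, so the constant
    depends on the order m only, as the uniformity over \<open>Vs\<close> in
    \<open>frechet_smooth\<close> requires.\<close>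
  have rem': "\<exists>L\<ge>0. \<forall>X Y Vs. length Vs = m \<longrightarrow>
      norm (D Vs (X + Y) - D Vs X - D (Y # Vs) X) \<le> L * (norm Y)\<^sup>2 * prod_list (map norm Vs)" for m
  proof (intro exI[of _ "\<bar>K\<bar> * (norm T)\<^sup>2 * norm T ^ m"] conjI allI impI)
    fix X Y and Vs :: "'v list" assume m: "length Vs = m"
    have "norm (D Vs (X + Y) - D Vs X - D (Y # Vs) X) \<le> K * (norm (T Y))\<^sup>2 * wt Vs" by (rule rem)
    also have "\<dots> \<le> \<bar>K\<bar> * (norm T * norm Y)\<^sup>2 * (norm T ^ m * prod_list (map norm Vs))"
      using wt_le[of Vs] m by (intro mult_mono power_mono norm_blinfun) auto
    finally show "norm (D Vs (X + Y) - D Vs X - D (Y # Vs) X)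
        \<le> \<bar>K\<bar> * (norm T)\<^sup>2 * norm T ^ m * (norm Y)\<^sup>2 * prod_list (map norm Vs)"
      by (simp add: power_mult_distrib mult_ac)
  qed simp
  have eps: "\<exists>\<delta>>0. \<forall>Y Vs. norm Y < \<delta> \<longrightarrow> length Vs = m \<longrightarrow>
      norm (D Vs (X + Y) - D Vs X - D (Y # Vs) X) \<le> \<epsilon> * norm Y * prod_list (map norm Vs)"
    if "\<epsilon> > 0" for m X \<epsilon>
  proof -
    obtain L where L: "L \<ge> 0" "\<And>X Y Vs. length Vs = m \<Longrightarrow>
      norm (D Vs (X + Y) - D Vs X - D (Y # Vs) X) \<le> L * (norm Y)\<^sup>2 * prod_list (map norm Vs)"
      using rem'[of m] by blast
    show ?thesis
    proof (intro exI[of _ "\<epsilon> / (L + 1)"] conjI allI impI)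
      show "\<epsilon> / (L + 1) > 0" using that L(1) by simp
      fix Y :: 'v and Vs :: "'v list" assume Y: "norm Y < \<epsilon> / (L + 1)" and m: "length Vs = m"
      have "L * norm Y \<le> (L + 1) * norm Y" by (simp add: algebra_simps)
      also have "\<dots> \<le> \<epsilon>" using Y L(1) by (simp add: field_simps)
      finally have "L * (norm Y)\<^sup>2 * prod_list (map norm Vs) \<le> \<epsilon> * norm Y * prod_list (map norm Vs)"
        using mult_right_mono[of "L * norm Y" \<epsilon> "norm Y * prod_list (map norm Vs)"] prod_nonneg[of Vs]
        by (simp add: power2_eq_square mult_ac)
      with L(2)[OF m, of X Y] show "norm (D Vs (X + Y) - D Vs X - D (Y # Vs) X) \<le> \<epsilon> * norm Y * prod_list (map norm Vs)"
        by linarith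
    qed
  qed
  have der: "(D Vs has_derivative (\<lambda>Y. D (Y # Vs) X)) (at X)" for Vs X
  proof -
    have "bounded_linear (\<lambda>Y. D (Y # Vs) X)"
    proof -
      have "norm (D (Y # Vs) X) \<le> norm Y * (C * norm T * wt Vs)" for Y
      proof -
        have "norm (D (Y # Vs) X) \<le> C * (norm (T Y) * wt Vs)" using bd[of "Y # Vs" X] by simp
        also have "\<dots> \<le> C * ((norm T * norm Y) * wt Vs)"
          using C by (intro mult_left_mono mult_right_mono norm_blinfun) auto
        finally show ?thesis by (simp add: mult_ac)
      qed
      then show ?thesis
        using lin[of Vs X] by (intro bounded_linear.intro bounded_linear_axioms.intro) auto
    qed
    moreover have "((\<lambda>Y. norm (D Vs (X + Y) - D Vs X - D (Y # Vs) X) / norm Y) \<longlongrightarrow> 0) (at 0)"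
    proof (rule tendstoI)
      fix \<epsilon> :: real assume "\<epsilon> > 0"
      define P where "P = prod_list (map norm Vs)"
      have P: "P \<ge> 0" by (simp add: P_def prod_nonneg)
      \<comment> \<open>The quotient P / (P + 1) < 1 turns the weak inequality into a strict one and
        covers P = 0.\<close>
      have "\<epsilon> / (P + 1) > 0" using \<open>\<epsilon> > 0\<close> P by simp
      from eps[OF this, of "length Vs" X] obtain \<delta> where \<delta>: "\<delta> > 0"
        "\<And>Y. norm Y < \<delta> \<Longrightarrow> norm (D Vs (X + Y) - D Vs X - D (Y # Vs) X) \<le> \<epsilon> / (P + 1) * norm Y * P"
        unfolding P_def by blast
      have "norm (D Vs (X + Y) - D Vs X - D (Y # Vs) X) / norm Y < \<epsilon>"
        if "norm Y < \<delta>" "Y \<noteq> 0" for Y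
      proof -
        have "norm (D Vs (X + Y) - D Vs X - D (Y # Vs) X) / norm Y \<le> \<epsilon> / (P + 1) * P"
          using \<delta>(2)[OF that(1)] that(2) by (simp add: field_simps)
        also have "\<dots> < \<epsilon>" using \<open>\<epsilon> > 0\<close> P by (simp add: field_simps)
        finally show ?thesis .
      qed
      then show "\<forall>\<^sub>F Y in at 0. dist (norm (D Vs (X + Y) - D Vs X - D (Y # Vs) X) / norm Y) 0 < \<epsilon>"
        unfolding eventually_at using \<delta>(1) by (intro exI[of _ \<delta>]) auto
    qed
    ultimately show ?thesis by (simp add: has_derivative_at)
  qed
  have iter: "iter_deriv (D []) Vs X = D Vs X" for Vs X
  proof (induction Vs arbitrary: X)
    case (Cons V Vs)
    then have "iter_deriv (D []) Vs = D Vs" by (simp add: fun_eq_iff)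
    then show ?case using fun_cong[OF frechet_derivative_at[OF der[of Vs X]], of V] by simp
  qed simp
  then show eq: "iter_deriv (D []) = D" by (simp add: fun_eq_iff)
  have "\<exists>K. \<forall>Vs. length Vs = m \<longrightarrow> norm (D Vs X) \<le> K * prod_list (map norm Vs)" for m X
  proof (intro exI[of _ "C * norm T ^ m"] allI impI)
    fix Vs :: "'v list" assume m: "length Vs = m"
    have "norm (D Vs X) \<le> C * wt Vs" by (rule bd)
    also have "\<dots> \<le> C * (norm T ^ m * prod_list (map norm Vs))"
      using wt_le[of Vs] C m by (intro mult_left_mono) auto
    finally show "norm (D Vs X) \<le> C * norm T ^ m * prod_list (map norm Vs)" by (simp add: mult_ac)
  qed
  moreover have "D Vs differentiable (at X)" for Vs X using der differentiable_def by blast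
  ultimately have "frechet_smooth (D [])"
    unfolding frechet_smooth_def eq using eps by simp
  then show "S_le (D []) C" using C bd by (simp add: S_le_def S_bound_iff eq)
qed

text \<open>New directions are put in front, so the derivatives of \<open>iter_deriv f Vs\<close>
  are \<open>iter_deriv f (Ws @ Vs)\<close>; the fixed directions only contribute the factor
  \<open>wt Vs\<close>.\<close>

lemma S_le_iter:
  assumes "S_le f C"
  shows "S_le (iter_deriv f Vs) (C * wt Vs)"
proof -
  define D where "D Ws = iter_deriv f (Ws @ Vs)" for Ws
  have "S_le (D []) (C * wt Vs)"
  proof (rule S_leI(2)[where K = "C * wt Vs"])
    show "0 \<le> C * wt Vs" using S_le_nonneg[OF assms] by simp
    show "linear (\<lambda>Y. D (Y # Ws) X)" for Ws X
      using S_le_linear[OF assms, of "Ws @ Vs" X] by (simp add: D_def del: iter_deriv.simps)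
    show "norm (D Ws X) \<le> C * wt Vs * wt Ws" for Ws X
      using S_le_bound[OF assms, of "Ws @ Vs" X] by (simp add: D_def mult_ac)
    show "norm (D Ws (X + Y) - D Ws X - D (Y # Ws) X) \<le> C * wt Vs * (norm (T Y))\<^sup>2 * wt Ws" for Ws X Y
      using S_le_remainder[OF assms, of "Ws @ Vs" X Y] by (simp add: D_def mult_ac del: iter_deriv.simps)
  qed
  then show ?thesis by (simp add: D_def)
qed

lemma S_le_lincomb:
  assumes f: "S_le f C" and g: "S_le g D"
  shows "iter_deriv (\<lambda>X. a * f X + b * g X) Vs X = a * iter_deriv f Vs X + b * iter_deriv g Vs X"
    and "S_le (\<lambda>X. a * f X + b * g X) (norm a * C + norm b * D)"
proof -
  define E where "E Vs X = a * iter_deriv f Vs X + b * iter_deriv g Vs X" for Vs X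
  have C: "0 \<le> C" "0 \<le> D" using f g S_le_nonneg by auto
  have *: "norm (a * x + b * y) \<le> (norm a * C + norm b * D) * w"
    if "norm x \<le> C * w" "norm y \<le> D * w" for x y w
  proof -
    have "norm (a * x + b * y) \<le> norm a * norm x + norm b * norm y"
      using norm_triangle_ineq[of "a * x" "b * y"] by (simp add: norm_mult)
    also have "\<dots> \<le> norm a * (C * w) + norm b * (D * w)"
      by (intro add_mono mult_left_mono that) auto
    finally show ?thesis by (simp add: algebra_simps)
  qed
  have lin: "linear (\<lambda>Y. E (Y # Vs) X)" for Vs X
    unfolding E_def
    by (intro linearI; simp only: linear_add[OF S_le_linear[OF f]] linear_add[OF S_le_linear[OF g]]
        linear_scale[OF S_le_linear[OF f]] linear_scale[OF S_le_linear[OF g]] scaleR_conv_of_real)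
      (simp_all add: algebra_simps)
  have rem: "norm (E Vs (X + Y) - E Vs X - E (Y # Vs) X) \<le> (norm a * C + norm b * D) * (norm (T Y))\<^sup>2 * wt Vs"
    for Vs X Y
    using *[OF S_le_remainder[OF f, of Vs X Y, unfolded mult.assoc] S_le_remainder[OF g, of Vs X Y, unfolded mult.assoc]]
    by (simp add: E_def algebra_simps del: iter_deriv.simps)
  have nn: "0 \<le> norm a * C + norm b * D" using C by simp
  have bd: "norm (E Vs X) \<le> (norm a * C + norm b * D) * wt Vs" for Vs X
    unfolding E_def by (intro * S_le_bound f g)
  note S_leI[of "norm a * C + norm b * D" E, OF nn lin bd rem]
  moreover have "E [] = (\<lambda>X. a * f X + b * g X)" by (simp add: E_def fun_eq_iff)
  ultimately show "iter_deriv (\<lambda>X. a * f X + b * g X) Vs X = a * iter_deriv f Vs X + b * iter_deriv g Vs X"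
    and "S_le (\<lambda>X. a * f X + b * g X) (norm a * C + norm b * D)"
    by (simp_all add: E_def)
qed

lemma S_le_zero: "S_le (\<lambda>_. 0) 0"
  using S_leI(2)[of 0 "\<lambda>_ _. 0" 0] by (simp add: linear_iff)

lemma iter_deriv_zero: "iter_deriv (\<lambda>_. 0) Vs (X :: 'v) = 0"
  using S_leI(1)[of 0 "\<lambda>_ _. 0" 0] by (simp add: linear_iff fun_eq_iff)

lemma S_le_cmult:
  assumes f: "S_le f C"
  shows "iter_deriv (\<lambda>X. a * f X) Vs X = a * iter_deriv f Vs X" and "S_le (\<lambda>X. a * f X) (norm a * C)"
  using S_le_lincomb[OF f S_le_zero, of a 0] by simp_all

lemma S_le_scaleR:
  assumes f: "S_le f C"
  shows "iter_deriv (\<lambda>X. r *\<^sub>R f X) Vs X = r *\<^sub>R iter_deriv f Vs X" and "S_le (\<lambda>X. r *\<^sub>R f X) (\<bar>r\<bar> * C)"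
  using S_le_cmult[OF f, of "of_real r"] by (simp_all add: scaleR_conv_of_real)

lemma S_le_add:
  assumes "S_le f C" "S_le g D"
  shows "iter_deriv (\<lambda>X. f X + g X) Vs X = iter_deriv f Vs X + iter_deriv g Vs X"
    and "S_le (\<lambda>X. f X + g X) (C + D)"
  using S_le_lincomb[OF assms, of 1 1] by simp_all

lemma S_le_sum:
  assumes "\<And>k. k \<in> I \<Longrightarrow> S_le (f k) (C k)"
  shows "iter_deriv (\<lambda>X. \<Sum>k\<in>I. f k X) Vs X = (\<Sum>k\<in>I. iter_deriv (f k) Vs X)
      \<and> S_le (\<lambda>X. \<Sum>k\<in>I. f k X) (\<Sum>k\<in>I. C k)"
  using assms
proof (induction I arbitrary: Vs X rule: infinite_finite_induct)
  case (insert i I)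
  then have "S_le (f i) (C i)" "S_le (\<lambda>X. \<Sum>k\<in>I. f k X) (\<Sum>k\<in>I. C k)" by auto
  from S_le_add[OF this] insert show ?case by simp
qed (simp_all add: S_le_zero iter_deriv_zero)

text \<open>The Weierstrass test for all derivatives at once: relative to the weight, the same
  series \<open>C\<close> dominates every order, so the series of derivatives satisfy
  \<open>S_leI\<close>.\<close>

lemma S_le_suminf:
  assumes f: "\<And>k. S_le (f k) (C k)" and C: "summable C"
  shows "(\<lambda>k. iter_deriv (f k) Vs X) sums iter_deriv (\<lambda>X. \<Sum>k. f k X) Vs X"
    and "S_le (\<lambda>X. \<Sum>k. f k X) (\<Sum>k. C k)"
proof -
  define D where "D Vs X = (\<Sum>k. iter_deriv (f k) Vs X)" for Vs X
  have nn: "0 \<le> C k" for k using S_le_nonneg[OF f] .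
  have *: "summable (\<lambda>k. h k) \<and> norm (\<Sum>k. h k) \<le> (\<Sum>k. C k) * w" if "\<And>k. norm (h k) \<le> C k * w" for h :: "nat \<Rightarrow> complex" and w
  proof -
    have Cw: "summable (\<lambda>k. C k * w)" by (intro summable_mult2 C)
    have s: "summable (\<lambda>k. norm (h k))" by (rule summable_comparison_test'[OF Cw, of 0]) (use that in auto)
    have "norm (\<Sum>k. h k) \<le> (\<Sum>k. norm (h k))" by (rule summable_norm[OF s])
    also have "\<dots> \<le> (\<Sum>k. C k * w)" by (intro suminf_le that s Cw)
    also have "\<dots> = (\<Sum>k. C k) * w" by (intro suminf_mult2[symmetric] C)
    finally show ?thesis using summable_norm_cancel[OF s] by simp
  qed
  have sm: "summable (\<lambda>k. iter_deriv (f k) Vs X)" for Vs X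
    using *[of "\<lambda>k. iter_deriv (f k) Vs X" "wt Vs"] S_le_bound[OF f] by blast
  have rem: "norm (D Vs (X + Y) - D Vs X - D (Y # Vs) X) \<le> (\<Sum>k. C k) * (norm (T Y))\<^sup>2 * wt Vs" for Vs X Y
  proof -
    have "D Vs (X + Y) - D Vs X - D (Y # Vs) X
        = (\<Sum>k. iter_deriv (f k) Vs (X + Y) - iter_deriv (f k) Vs X - iter_deriv (f k) (Y # Vs) X)"
      unfolding D_def by (simp only: suminf_diff summable_diff sm)
    then show ?thesis
      using *[OF S_le_remainder[OF f, where Vs = Vs and X = X and Y = Y, unfolded mult.assoc]] by (simp add: mult.assoc)
  qed
  have lin: "linear (\<lambda>Y. D (Y # Vs) X)" for Vs X
  proof (rule linearI)
    show "D ((Y + Z) # Vs) X = D (Y # Vs) X + D (Z # Vs) X" for Y Z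
      unfolding D_def by (simp only: suminf_add sm linear_add[OF S_le_linear[OF f]])
    show "D ((c *\<^sub>R Y) # Vs) X = c *\<^sub>R D (Y # Vs) X" for c Y
      unfolding D_def by (simp only: suminf_scaleR_right sm linear_scale[OF S_le_linear[OF f]])
  qed
  have bd: "norm (D Vs X) \<le> (\<Sum>k. C k) * wt Vs" for Vs X
    unfolding D_def using *[of "\<lambda>k. iter_deriv (f k) Vs X" "wt Vs"] S_le_bound[OF f] by blast
  have "0 \<le> (\<Sum>k. C k)" using nn C by (simp add: suminf_nonneg)
  note S_leI[of "\<Sum>k. C k" D, OF this lin bd rem]
  moreover have "D [] = (\<lambda>X. \<Sum>k. f k X)" by (simp add: D_def fun_eq_iff)
  ultimately show "(\<lambda>k. iter_deriv (f k) Vs X) sums iter_deriv (\<lambda>X. \<Sum>k. f k X) Vs X"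
    and "S_le (\<lambda>X. \<Sum>k. f k X) (\<Sum>k. C k)"
    using sm by (simp_all add: D_def summable_sums)
qed

lemma S_le_mono: "S_le f C \<Longrightarrow> C \<le> D \<Longrightarrow> S_le f D"
  unfolding S_le_def S_bound_iff by (meson mult_right_mono order_trans wt_nonneg)

lemma S_le_imp_S_space: "S_le f C \<Longrightarrow> f \<in> S_space Q"
  using S_le_mono[of f C "C + 1"] by (auto simp: S_space_def S_le_def intro!: exI[of _ "C + 1"])

lemma S_norm_le:
  assumes "S_le f C"
  shows "S_norm Q f \<le> C"
proof (rule field_le_epsilon)
  fix r :: real assume "r > 0"
  have "S_le f (C + r)" using S_le_mono[OF assms] \<open>r > 0\<close> by simp
  then show "S_norm Q f \<le> C + r"
    unfolding S_norm_def using \<open>r > 0\<close> S_le_nonneg[OF assms]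
    by (intro cInf_lower bdd_belowI[of _ 0]) (auto simp: S_le_def)
qed

lemma S_norm_nonneg:
  assumes "f \<in> S_space Q"
  shows "0 \<le> S_norm Q f"
  unfolding S_norm_def using assms by (intro cInf_greatest) (auto simp: S_space_def)

text \<open>Each single inequality in \<open>S_bound\<close> is closed in the constant, so the
  infimum satisfies it too.\<close>

lemma S_space_S_le:
  assumes "f \<in> S_space Q"
  shows "S_le f (S_norm Q f)"
proof -
  have ne: "{C. C > 0 \<and> S_bound Q f C} \<noteq> {}" and sm: "frechet_smooth f"
    using assms by (auto simp: S_space_def)
  have "norm (iter_deriv f Vs X) \<le> S_norm Q f * wt Vs" for Vs X
  proof (rule field_le_epsilon)
    fix r :: real assume r: "r > 0"
    \<comment> \<open>The tolerance is divided by the weight it will be multiplied with; the summand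
      1 covers weight 0.\<close>
    define s where "s = r / (wt Vs + 1)"
    have s: "s > 0" using r by (simp add: s_def add_nonneg_pos)
    have "Inf {C. C > 0 \<and> S_bound Q f C} < S_norm Q f + s" using s by (simp add: S_norm_def)
    then obtain C where "S_bound Q f C" "C < S_norm Q f + s"
      using cInf_lessD[OF ne] by blast
    then have "norm (iter_deriv f Vs X) \<le> (S_norm Q f + s) * wt Vs"
      unfolding S_bound_iff by (meson mult_right_mono order_trans wt_nonneg less_imp_le)
    moreover have "s * wt Vs \<le> r"
      using r mult_left_mono[of "wt Vs" "wt Vs + 1" r] by (simp add: s_def pos_divide_le_eq add_nonneg_pos)
    ultimately show "norm (iter_deriv f Vs X) \<le> S_norm Q f * wt Vs + r" by (simp add: algebra_simps)
  qed
  then show ?thesis using sm S_norm_nonneg[OF assms] by (simp add: S_le_def S_bound_iff)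
qed

end

section \<open>The Laplacian and its exponential\<close>

text \<open>For a Hilbert basis \<open>e\<close> and a selfadjoint T with T T = A, the sum of |T
  e_j|^2 is the trace of A, so \<open>half_trace\<close> below is Tr A / 2.\<close>

locale form_laplacian = form_space T Q
  for T :: "'v::real_normed_vector \<Rightarrow>\<^sub>L 'w::real_normed_vector" and Q +
  fixes e :: "nat \<Rightarrow> 'v"
  assumes summable_form: "summable (\<lambda>j. (norm (T (e j)))\<^sup>2)"
begin

definition half_trace :: real where "half_trace = (\<Sum>j. (norm (T (e j)))\<^sup>2) / 2"

definition half_trace_tail :: "nat \<Rightarrow> real" where
  "half_trace_tail n = (\<Sum>j. (norm (T (e (j + n))))\<^sup>2) / 2"

text \<open>The factor 1/2 makes this the generator of Gaussian averaging with variance parameter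
  equal to time.\<close>

definition lap :: "('v \<Rightarrow> complex) \<Rightarrow> 'v \<Rightarrow> complex" where
  "lap f X = (\<Sum>j. iter_deriv f [e j, e j] X /\<^sub>R 2)"

definition lap_part :: "nat \<Rightarrow> ('v \<Rightarrow> complex) \<Rightarrow> 'v \<Rightarrow> complex" where
  "lap_part n f X = (\<Sum>j<n. iter_deriv f [e j, e j] X /\<^sub>R 2)"

text \<open>As \<open>lap\<close> is bounded for the norm of \<open>S_space Q\<close>, the
  exponential series also makes sense for t < 0, which supplies the inverse.\<close>

definition heat_exp :: "real \<Rightarrow> ('v \<Rightarrow> complex) \<Rightarrow> 'v \<Rightarrow> complex" where
  "heat_exp t f X = (\<Sum>k. (t ^ k / fact k) *\<^sub>R (lap ^^ k) f X)"

lemma half_trace_nonneg: "0 \<le> half_trace"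
  unfolding half_trace_def using suminf_nonneg[OF summable_form] by simp

lemma S_le_lap_term:
  assumes "S_le f C"
  shows "S_le (\<lambda>X. iter_deriv f [e j, e j] X /\<^sub>R 2) ((norm (T (e j)))\<^sup>2 * (C / 2))"
  using S_le_scaleR(2)[OF S_le_iter[OF assms, of "[e j, e j]"], of "inverse 2"]
  by (simp add: power2_eq_square mult_ac del: iter_deriv.simps)

lemma summable_lap_const: "summable (\<lambda>j. (norm (T (e j)))\<^sup>2 * (C / 2))"
  by (intro summable_mult2 summable_form)

text \<open>The two slots e_j, e_j carry the weight |T e_j|^2, whatever further directions are
  differentiated; summation gives the trace.\<close>

lemma S_le_lap:
  assumes "S_le f C"
  shows "S_le (lap f) (half_trace * C)"
proof -
  have "S_le (lap f) (\<Sum>j. (norm (T (e j)))\<^sup>2 * (C / 2))"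
    using S_le_suminf(2)[OF S_le_lap_term[OF assms] summable_lap_const]
    by (simp add: lap_def[abs_def])
  also have "(\<Sum>j. (norm (T (e j)))\<^sup>2 * (C / 2)) = half_trace * C"
    unfolding half_trace_def by (subst suminf_mult2[symmetric, OF summable_form]) simp
  finally show ?thesis .
qed

lemma lap_sums:
  assumes "S_le f C"
  shows "(\<lambda>j. iter_deriv f [e j, e j] X /\<^sub>R 2) sums lap f X"
  using S_le_suminf(1)[OF S_le_lap_term[OF assms] summable_lap_const, of "[]" X]
  by (simp add: lap_def[abs_def] iter_deriv_Nil del: iter_deriv.simps(2))

lemma S_le_lap_part:
  assumes "S_le f C"
  shows "S_le (lap_part n f) (half_trace * C)"
proof -
  have "S_le (lap_part n f) (\<Sum>j<n. (norm (T (e j)))\<^sup>2 * (C / 2))"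
    using S_le_sum[OF S_le_lap_term[OF assms], where I = "{..<n}"] by (simp add: lap_part_def[abs_def])
  moreover have "(\<Sum>j<n. (norm (T (e j)))\<^sup>2 * (C / 2)) \<le> half_trace * C"
  proof -
    have "(\<Sum>j<n. (norm (T (e j)))\<^sup>2) * (C / 2) \<le> (\<Sum>j. (norm (T (e j)))\<^sup>2) * (C / 2)"
      using S_le_nonneg[OF assms] by (intro mult_right_mono sum_le_suminf summable_form) auto
    then show ?thesis unfolding sum_distrib_right by (simp add: half_trace_def)
  qed
  ultimately show ?thesis by (rule S_le_mono)
qed

lemma half_trace_tail_tendsto: "half_trace_tail \<longlonglongrightarrow> 0"
  using tendsto_divide[OF suminf_exist_split2[OF summable_form] tendsto_const[of 2]]
  by (simp add: half_trace_tail_def[abs_def])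

text \<open>The error is a tail of the trace series and uniform in X. It is the only error that
  survives in the interpolation of \<open>avg_heat_exp\<close>.\<close>

lemma lap_part_diff:
  assumes "S_le f C"
  shows "norm (lap_part n f X - lap f X) \<le> half_trace_tail n * C"
proof -
  let ?f = "\<lambda>j. iter_deriv f [e j, e j] X /\<^sub>R 2"
  have s: "summable (\<lambda>j. (norm (T (e (j + n))))\<^sup>2 * (C / 2))"
    using summable_ignore_initial_segment[OF summable_lap_const] .
  have bd: "norm (?f (j + n)) \<le> (norm (T (e (j + n))))\<^sup>2 * (C / 2)" for j
    by (rule S_le_sup[OF S_le_lap_term[OF assms]])
  have sn: "summable (\<lambda>j. norm (?f (j + n)))"
    by (rule summable_comparison_test'[OF s, of 0]) (use bd in auto)
  have "lap f X - lap_part n f X = (\<Sum>j. ?f (j + n))"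
    unfolding lap_part_def
    using suminf_minus_initial_segment[OF sums_summable[OF lap_sums[OF assms]], of n X]
    by (simp add: lap_def del: iter_deriv.simps)
  also have "norm \<dots> \<le> (\<Sum>j. (norm (T (e (j + n))))\<^sup>2 * (C / 2))"
    by (rule order_trans[OF summable_norm[OF sn] suminf_le[OF bd sn s]])
  also have "\<dots> = half_trace_tail n * C"
    unfolding half_trace_tail_def
    by (subst suminf_mult2[symmetric]) (auto intro!: summable_ignore_initial_segment[OF summable_form])
  finally show ?thesis by (simp add: norm_minus_commute)
qed

lemma lap_lincomb:
  assumes "S_le f C" "S_le g D"
  shows "lap (\<lambda>X. a * f X + b * g X) = (\<lambda>X. a * lap f X + b * lap g X)"
proof
  fix X
  have "(\<lambda>j. a * (iter_deriv f [e j, e j] X /\<^sub>R 2) + b * (iter_deriv g [e j, e j] X /\<^sub>R 2))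
      sums (a * lap f X + b * lap g X)"
    by (intro sums_add sums_mult lap_sums[OF assms(1)] lap_sums[OF assms(2)])
  moreover have "(\<lambda>j. iter_deriv (\<lambda>X. a * f X + b * g X) [e j, e j] X /\<^sub>R 2) sums lap (\<lambda>X. a * f X + b * g X) X"
    by (rule lap_sums[OF S_le_lincomb(2)[OF assms]])
  moreover have "a * (x /\<^sub>R 2) + b * (y /\<^sub>R 2) = (a * x + b * y) /\<^sub>R 2" for x y
    by (simp add: scaleR_conv_of_real algebra_simps)
  ultimately show "lap (\<lambda>X. a * f X + b * g X) X = a * lap f X + b * lap g X"
    using sums_unique2 by (simp only: S_le_lincomb(1)[OF assms])
qed

text \<open>Two infinite sums are exchanged by boundedness: \<open>lap\<close> is additive on the
  first n terms, and on the remainder \<open>g n\<close> it is at most \<open>half_trace\<close>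
  times the tail \<open>R n\<close> of the constants.\<close>

lemma lap_suminf:
  assumes f: "\<And>k. S_le (f k) (C k)" and C: "summable C"
  shows "(\<lambda>k. lap (f k) X) sums lap (\<lambda>X. \<Sum>k. f k X) X"
proof -
  define g where "g n X = (\<Sum>k. f (k + n) X)" for n X
  define R where "R n = (\<Sum>k. C (k + n))" for n
  have sm: "summable (\<lambda>k. f k X)" for X
    using sums_summable[OF S_le_suminf(1)[OF f C, of "[]" X]] by simp
  have g: "S_le (g n) (R n)" for n
    unfolding g_def R_def
    by (rule S_le_suminf(2)[OF f]) (rule summable_ignore_initial_segment[OF C])
  have part: "S_le (\<lambda>X. \<Sum>k<n. f k X) (\<Sum>k<n. C k)" for n
    using S_le_sum[of "{..<n}" f C] f by blast
  have lap_part: "lap (\<lambda>X. \<Sum>k<n. f k X) = (\<lambda>X. \<Sum>k<n. lap (f k) X)" for n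
  proof (induction n)
    case 0
    show ?case by (simp add: lap_def fun_eq_iff iter_deriv_zero del: iter_deriv.simps)
  next
    case (Suc n)
    have "lap (\<lambda>X. 1 * (\<Sum>k<n. f k X) + 1 * f n X) = (\<lambda>X. 1 * lap (\<lambda>X. \<Sum>k<n. f k X) X + 1 * lap (f n) X)"
      by (rule lap_lincomb[OF part f])
    then show ?case using Suc by simp
  qed
  have split: "(\<lambda>X. \<Sum>k. f k X) = (\<lambda>X. 1 * (\<Sum>k<n. f k X) + 1 * g n X)" for n
    using suminf_split_initial_segment[OF sm, of _ n] by (simp add: g_def fun_eq_iff add.commute)
  have eq: "lap (\<lambda>X. \<Sum>k. f k X) X = (\<Sum>k<n. lap (f k) X) + lap (g n) X" for n
    unfolding split[of n] lap_lincomb[OF part[of n] g[of n]] lap_part[of n] by simp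
  have "R \<longlonglongrightarrow> 0" unfolding R_def using suminf_exist_split2[OF C] .
  then have "(\<lambda>n. half_trace * R n) \<longlonglongrightarrow> 0" by (rule tendsto_mult_right_zero)
  then have "(\<lambda>n. lap (g n) X) \<longlonglongrightarrow> 0"
    by (rule Lim_null_comparison[rotated]) (intro always_eventually allI S_le_sup[OF S_le_lap[OF g]])
  then have "(\<lambda>n. lap (\<lambda>X. \<Sum>k. f k X) X - lap (g n) X) \<longlonglongrightarrow> lap (\<lambda>X. \<Sum>k. f k X) X - 0"
    by (intro tendsto_intros)
  moreover have "lap (\<lambda>X. \<Sum>k. f k X) X - lap (g n) X = (\<Sum>k<n. lap (f k) X)" for n
    using eq[of n] by simp
  ultimately show ?thesis unfolding sums_def by simp
qed

section \<open>Powers of half the Laplacian and the exponential group\<close>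

lemma S_le_lap_pow:
  assumes "S_le f C"
  shows "S_le ((lap ^^ k) f) (half_trace ^ k * C)"
proof (induction k)
  case (Suc k)
  then show ?case using S_le_lap[OF Suc] by (simp add: mult.assoc)
qed (use assms in simp)

lemma S_le_heat_term:
  assumes "S_le f C"
  shows "S_le (\<lambda>X. (t ^ k / fact k) *\<^sub>R (lap ^^ k) f X) ((\<bar>t\<bar> * half_trace) ^ k / fact k * C)"
  using S_le_scaleR(2)[OF S_le_lap_pow[OF assms, of k], of "t ^ k / fact k"]
  by (simp add: power_mult_distrib power_abs mult.assoc)

lemma exp_const_sums: "(\<lambda>k. x ^ k / fact k * C) sums (exp x * C)" for x C :: real
  using sums_mult2[OF exp_converges[of x], of C] by (simp add: divide_inverse mult.commute)

text \<open>At t = - h this is already the norm estimate claimed for the inverse of the heat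
  operator.\<close>

lemma S_le_heat_exp:
  assumes "S_le f C"
  shows "S_le (heat_exp t f) (exp (\<bar>t\<bar> * half_trace) * C)"
  using S_le_suminf(2)[OF S_le_heat_term[OF assms] sums_summable[OF exp_const_sums]]
    sums_unique[OF exp_const_sums, of "\<bar>t\<bar> * half_trace" C]
  by (simp add: heat_exp_def[abs_def])

lemma heat_exp_sums:
  assumes "S_le f C"
  shows "(\<lambda>k. (t ^ k / fact k) *\<^sub>R iter_deriv ((lap ^^ k) f) Vs X) sums iter_deriv (heat_exp t f) Vs X"
  using S_le_suminf(1)[OF S_le_heat_term[OF assms, of t] sums_summable[OF exp_const_sums], of Vs X]
  by (simp add: heat_exp_def[abs_def] S_le_scaleR(1)[OF S_le_lap_pow[OF assms]])

lemma heat_exp_0: "heat_exp 0 f = f"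
proof
  fix X
  have "heat_exp 0 f X = (\<Sum>k. if k = 0 then f X else 0)"
    unfolding heat_exp_def by (intro suminf_cong) (simp add: power_0_left)
  then show "heat_exp 0 f X = f X" using sums_unique[OF sums_single[of 0 "\<lambda>_. f X"]] by simp
qed

lemma lap_heat_exp:
  assumes "S_le f C"
  shows "lap (heat_exp t f) = heat_exp t (lap f)"
proof
  fix X
  have "(\<lambda>k. lap (\<lambda>X. (t ^ k / fact k) *\<^sub>R (lap ^^ k) f X) X) sums lap (heat_exp t f) X"
    using lap_suminf[OF S_le_heat_term[OF assms, of t] sums_summable[OF exp_const_sums]]
    by (simp add: heat_exp_def[abs_def])
  moreover have "lap (\<lambda>X. (t ^ k / fact k) *\<^sub>R (lap ^^ k) f X) X = (t ^ k / fact k) *\<^sub>R (lap ^^ k) (lap f) X" for k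
    using lap_lincomb[OF S_le_lap_pow[OF assms, of k] S_le_zero, of "of_real (t ^ k / fact k)" 0]
    by (simp add: scaleR_conv_of_real flip: funpow_swap1)
  moreover have "(\<lambda>k. (t ^ k / fact k) *\<^sub>R (lap ^^ k) (lap f) X) sums heat_exp t (lap f) X"
    using heat_exp_sums[OF S_le_lap[OF assms], of t "[]" X] by simp
  ultimately show "lap (heat_exp t f) X = heat_exp t (lap f) X"
    using sums_unique2 by simp
qed

lemma lap_pow_heat_exp:
  assumes "S_le f C"
  shows "(lap ^^ k) (heat_exp t f) = heat_exp t ((lap ^^ k) f)"
proof (induction k)
  case (Suc k)
  then show ?case using lap_heat_exp[OF S_le_lap_pow[OF assms, of k]] by simp
qed simp

lemma heat_exp_lincomb:
  assumes "S_le f C" "S_le g D"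
  shows "heat_exp t (\<lambda>X. a * f X + b * g X) = (\<lambda>X. a * heat_exp t f X + b * heat_exp t g X)"
proof
  fix X
  have pow: "(lap ^^ k) (\<lambda>X. a * f X + b * g X) = (\<lambda>X. a * (lap ^^ k) f X + b * (lap ^^ k) g X)" for k
  proof (induction k)
    case (Suc k)
    then show ?case using lap_lincomb[OF S_le_lap_pow[OF assms(1), of k] S_le_lap_pow[OF assms(2), of k]] by simp
  qed simp
  have "(\<lambda>k. a * ((t ^ k / fact k) *\<^sub>R (lap ^^ k) f X) + b * ((t ^ k / fact k) *\<^sub>R (lap ^^ k) g X))
      sums (a * heat_exp t f X + b * heat_exp t g X)"
    using heat_exp_sums[OF assms(1), of t "[]" X] heat_exp_sums[OF assms(2), of t "[]" X]
    by (intro sums_add sums_mult) simp_all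
  moreover have "(\<lambda>k. (t ^ k / fact k) *\<^sub>R (lap ^^ k) (\<lambda>X. a * f X + b * g X) X)
      sums heat_exp t (\<lambda>X. a * f X + b * g X) X"
    using heat_exp_sums[OF S_le_lincomb(2)[OF assms], where t = t and Vs = "[]" and X = X] by simp
  ultimately show "heat_exp t (\<lambda>X. a * f X + b * g X) X = a * heat_exp t f X + b * heat_exp t g X"
    using sums_unique2 by (simp add: pow scaleR_conv_of_real algebra_simps)
qed

end

text \<open>This is the group law exp (s L) exp (t L) = exp ((s + t) L) at one point, with c n the
  value of L^n f. The double series of s^k t^l / (k! l!) c (k + l) converges absolutely; summed by
  rows it gives \<open>S\<close>, and its diagonals k + l = n give the binomial expansion of (s +
  t)^n.\<close>

lemma double_exp_series:
  fixes c :: "nat \<Rightarrow> complex"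
  assumes c: "\<And>n. norm (c n) \<le> C * M ^ n" and M: "0 \<le> M"
    and row: "\<And>k. (\<lambda>l. (t ^ l / fact l) *\<^sub>R c (k + l)) sums r k"
    and total: "(\<lambda>k. (s ^ k / fact k) *\<^sub>R r k) sums S"
  shows "(\<lambda>n. ((s + t) ^ n / fact n) *\<^sub>R c n) sums S"
proof -
  have C: "0 \<le> C" using order_trans[OF norm_ge_zero c[of 0]] by simp
  define f where "f = (\<lambda>(k, l). (s ^ k / fact k * (t ^ l / fact l)) *\<^sub>R c (k + l))"
  \<comment> \<open>Since |c (k + l)| is at most C M^k M^l, the majorant is a product of two
    exponential series.\<close>
  define B where "B = (\<lambda>(k, l). ((\<bar>s\<bar> * M) ^ k / fact k) * ((\<bar>t\<bar> * M) ^ l / fact l * C))"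
  have exp_has_sum: "((\<lambda>k. x ^ k / fact k * D) has_sum (exp x * D)) UNIV" if "x \<ge> 0" "D \<ge> 0" for x D :: real
  proof (rule norm_summable_imp_has_sum)
    have s: "(\<lambda>k. x ^ k / fact k * D) sums (exp x * D)"
      using sums_mult2[OF exp_converges[of x], of D] by (simp add: divide_inverse mult.commute)
    then show "(\<lambda>k. x ^ k / fact k * D) sums (exp x * D)" .
    show "summable (\<lambda>k. norm (x ^ k / fact k * D))" using sums_summable[OF s] that by simp
  qed
  have "B summable_on (UNIV \<times> UNIV)"
  proof (rule summable_on_SigmaI)
    show "((\<lambda>l. B (k, l)) has_sum ((\<bar>s\<bar> * M) ^ k / fact k * (exp (\<bar>t\<bar> * M) * C))) UNIV" for k
      unfolding B_def split using exp_has_sum[of "\<bar>t\<bar> * M" C] M C by (intro has_sum_cmult_right) auto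
    show "(\<lambda>k. (\<bar>s\<bar> * M) ^ k / fact k * (exp (\<bar>t\<bar> * M) * C)) summable_on UNIV"
      using exp_has_sum[of "\<bar>s\<bar> * M" "exp (\<bar>t\<bar> * M) * C"] M C has_sum_imp_summable by fastforce
    show "0 \<le> B (k, l)" for k l unfolding B_def using M C by simp
  qed
  moreover have fB: "norm (f p) \<le> B p" for p
  proof -
    obtain k l where p: "p = (k, l)" by force
    have "norm (f p) = (\<bar>s\<bar> ^ k / fact k * (\<bar>t\<bar> ^ l / fact l)) * norm (c (k + l))"
      by (simp add: f_def p abs_mult power_abs)
    also have "\<dots> \<le> (\<bar>s\<bar> ^ k / fact k * (\<bar>t\<bar> ^ l / fact l)) * (C * M ^ (k + l))"
      by (intro mult_left_mono c) auto
    also have "\<dots> = B p" by (simp add: B_def p power_mult_distrib power_add)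
    finally show ?thesis .
  qed
  ultimately have abs: "(\<lambda>p. norm (f p)) summable_on (UNIV \<times> UNIV)"
    by (intro Infinite_Sum.abs_summable_on_comparison_test'[of B]) auto
  then obtain S' where S': "(f has_sum S') (UNIV \<times> UNIV)"
    using abs_summable_summable summable_on_def by blast
  have row_sum: "((\<lambda>l. f (k, l)) has_sum ((s ^ k / fact k) *\<^sub>R r k)) UNIV" for k
  proof (rule norm_summable_imp_has_sum)
    show "(\<lambda>l. f (k, l)) sums ((s ^ k / fact k) *\<^sub>R r k)"
      using sums_scaleR_right[OF row[of k], of "s ^ k / fact k"] by (simp add: f_def)
    have "summable (\<lambda>l. B (k, l))"
      unfolding B_def split
      by (intro summable_mult summable_mult2) (use summable_exp[of "\<bar>t\<bar> * M"] in \<open>simp add: divide_inverse mult.commute\<close>)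
    then show "summable (\<lambda>l. norm (f (k, l)))"
      by (rule summable_comparison_test'[of _ 0]) (use fB in auto)
  qed
  have "S' = S"
    using has_sum_imp_sums[OF has_sum_SigmaD[OF S' row_sum]] total sums_unique2 by blast
  \<comment> \<open>Change from rows to diagonals by the bijection (k, l) -> (k + l, k).\<close>
  have "((\<lambda>(n, k). f (k, n - k)) has_sum S') (SIGMA n:UNIV. {..n})"
    using S' by (subst has_sum_reindex_bij_witness[where j = "\<lambda>(n, k). (k, n - k)" and i = "\<lambda>(k, l). (k + l, k)"
        and h = f and T = "UNIV \<times> UNIV"]) auto
  then have "((\<lambda>n. ((s + t) ^ n / fact n) *\<^sub>R c n) has_sum S') UNIV"
  proof (rule has_sum_SigmaD)
    fix n :: nat
    have "((\<lambda>k. f (k, n - k)) has_sum (\<Sum>k\<le>n. f (k, n - k))) {..n}" by (intro has_sum_finite) auto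
    also have "(\<Sum>k\<le>n. f (k, n - k)) = (\<Sum>k\<le>n. s ^ k / fact k * (t ^ (n - k) / fact (n - k))) *\<^sub>R c n"
      by (simp add: f_def scaleR_sum_left)
    also have "(\<Sum>k\<le>n. s ^ k / fact k * (t ^ (n - k) / fact (n - k))) = (s + t) ^ n / fact n"
      by (simp add: binomial_ring sum_divide_distrib binomial_fact field_simps)
    finally show "((\<lambda>k. case (n, k) of (n, k) \<Rightarrow> f (k, n - k)) has_sum ((s + t) ^ n / fact n) *\<^sub>R c n) {..n}"
      by simp
  qed
  then show ?thesis using has_sum_imp_sums \<open>S' = S\<close> by blast
qed

context form_laplacian
begin

text \<open>The group law serves twice: it reduces differentiability at any t to t = 0, and it shows
  that time - h inverts time h.\<close>

lemma heat_exp_add: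
  assumes "S_le f C"
  shows "heat_exp s (heat_exp t f) = heat_exp (s + t) f"
proof
  fix X
  have "(\<lambda>n. ((s + t) ^ n / fact n) *\<^sub>R (lap ^^ n) f X) sums heat_exp s (heat_exp t f) X"
  proof (rule double_exp_series)
    show "norm ((lap ^^ n) f X) \<le> C * half_trace ^ n" for n
      using S_le_sup[OF S_le_lap_pow[OF assms, of n]] by (simp add: mult.commute)
    show "(\<lambda>l. (t ^ l / fact l) *\<^sub>R (lap ^^ (k + l)) f X) sums heat_exp t ((lap ^^ k) f) X" for k
      using heat_exp_sums[OF S_le_lap_pow[OF assms, of k], of t "[]" X]
      by (simp add: add.commute funpow_add)
    show "(\<lambda>k. (s ^ k / fact k) *\<^sub>R heat_exp t ((lap ^^ k) f) X) sums heat_exp s (heat_exp t f) X"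
      using heat_exp_sums[OF S_le_heat_exp[OF assms, of t], of s "[]" X] lap_pow_heat_exp[OF assms] by simp
  qed (rule half_trace_nonneg)
  moreover have "(\<lambda>n. ((s + t) ^ n / fact n) *\<^sub>R (lap ^^ n) f X) sums heat_exp (s + t) f X"
    using heat_exp_sums[OF assms, of "s + t" "[]" X] by simp
  ultimately show "heat_exp s (heat_exp t f) X = heat_exp (s + t) f X" by (rule sums_unique2)
qed

text \<open>The terms k = 0 and k = 1 cancel. After division by r the rest, shifted by 2, is
  resummed to an exponential through 1 / (k + 2)! <= 1 / k!, and a factor |r| is left over.\<close>

lemma heat_exp_difference_quotient:
  assumes f: "S_le f C" and r: "r \<noteq> 0"
  shows "S_le (\<lambda>X. (heat_exp r f X - f X) / of_real r - lap f X)
    (\<bar>r\<bar> * (half_trace\<^sup>2 * exp (\<bar>r\<bar> * half_trace) * C))"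
proof -
  define g where "g k X = inverse r *\<^sub>R ((r ^ (k + 2) / fact (k + 2)) *\<^sub>R (lap ^^ (k + 2)) f X)" for k X
  define D where "D k = (\<bar>r\<bar> * half_trace) ^ k / fact k * (\<bar>r\<bar> * half_trace\<^sup>2 * C)" for k
  have g: "S_le (g k) (D k)" for k
  proof (rule S_le_mono)
    show "S_le (g k) (\<bar>r ^ (k + 1) / fact (k + 2)\<bar> * (half_trace ^ (k + 2) * C))"
    proof -
      have "g k = (\<lambda>X. (r ^ (k + 1) / fact (k + 2)) *\<^sub>R (lap ^^ (k + 2)) f X)"
        using r by (simp add: g_def fun_eq_iff power_add power2_eq_square del: fact_Suc)
      then show ?thesis by (simp only: S_le_scaleR(2)[OF S_le_lap_pow[OF f]])
    qed
    have "\<bar>r ^ (k + 1) / fact (k + 2)\<bar> * (half_trace ^ (k + 2) * C)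
        = (\<bar>r\<bar> * half_trace) ^ k * (\<bar>r\<bar> * half_trace\<^sup>2 * C) / fact (k + 2)"
      by (simp add: power_abs power_mult_distrib power_add power2_eq_square abs_mult del: fact_Suc)
    also have "\<dots> \<le> (\<bar>r\<bar> * half_trace) ^ k * (\<bar>r\<bar> * half_trace\<^sup>2 * C) / fact k"
      using half_trace_nonneg S_le_nonneg[OF f]
      by (intro divide_left_mono fact_mono mult_nonneg_nonneg) auto
    finally show "\<bar>r ^ (k + 1) / fact (k + 2)\<bar> * (half_trace ^ (k + 2) * C) \<le> D k"
      by (simp add: D_def)
  qed
  have D: "D sums (exp (\<bar>r\<bar> * half_trace) * (\<bar>r\<bar> * half_trace\<^sup>2 * C))"
    unfolding D_def by (rule exp_const_sums)
  have "(\<lambda>X. \<Sum>k. g k X) = (\<lambda>X. (heat_exp r f X - f X) / of_real r - lap f X)"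
  proof
    fix X
    have "(\<lambda>k. (r ^ k / fact k) *\<^sub>R (lap ^^ k) f X) sums heat_exp r f X"
      using heat_exp_sums[OF f, of r "[]" X] by simp
    from sums_split_initial_segment[OF this, of 2]
    have "(\<lambda>k. (r ^ (k + 2) / fact (k + 2)) *\<^sub>R (lap ^^ (k + 2)) f X) sums (heat_exp r f X - (f X + r *\<^sub>R lap f X))"
      by (simp add: numeral_2_eq_2)
    from sums_scaleR_right[OF this, of "inverse r"]
    have "(\<lambda>k. g k X) sums (inverse r *\<^sub>R (heat_exp r f X - (f X + r *\<^sub>R lap f X)))"
      unfolding g_def .
    also have "inverse r *\<^sub>R (heat_exp r f X - (f X + r *\<^sub>R lap f X)) = (heat_exp r f X - f X) / of_real r - lap f X"
      using r by (simp add: scaleR_conv_of_real field_simps)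
    finally show "(\<Sum>k. g k X) = (heat_exp r f X - f X) / of_real r - lap f X"
      by (simp add: sums_iff)
  qed
  with S_le_suminf(2)[OF g sums_summable[OF D]] sums_unique[OF D] show ?thesis
    by (simp add: mult_ac)
qed

text \<open>With f = exp (t L) L^k F the group law turns the quotient at t into the quotient of f at
  time 0, and \<open>lap\<close> commutes with the exponential. The limit exists for two-sided
  increments, so it restricts to any set \<open>T'\<close> of times.\<close>

lemma heat_exp_smooth:
  assumes F: "F \<in> S_space Q"
  shows "S_smooth_on Q T' (\<lambda>t. heat_exp t F)"
  unfolding S_smooth_on_def
proof (intro exI[of _ "\<lambda>k t. heat_exp t ((lap ^^ k) F)"] conjI allI ballI)
  note F' = S_le_lap_pow[OF S_space_S_le[OF F]]
  show "heat_exp t ((lap ^^ 0) F) = heat_exp t F" for t by simp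
  show "heat_exp t ((lap ^^ k) F) \<in> S_space Q" for k t
    by (rule S_le_imp_S_space[OF S_le_heat_exp[OF F']])
  fix k t assume "t \<in> T'"
  define f where "f = heat_exp t ((lap ^^ k) F)"
  obtain C where f: "S_le f C" unfolding f_def using S_le_heat_exp[OF F'] by blast
  have bound: "S_norm Q (\<lambda>X. (heat_exp s ((lap ^^ k) F) X - heat_exp t ((lap ^^ k) F) X) / of_real (s - t)
        - heat_exp t ((lap ^^ Suc k) F) X) \<in> {0 .. \<bar>s - t\<bar> * (half_trace\<^sup>2 * exp (\<bar>s - t\<bar> * half_trace) * C)}"
    if "s \<noteq> t" for s
  proof -
    have "heat_exp (s - t) f = heat_exp s ((lap ^^ k) F)"
      unfolding f_def using heat_exp_add[OF F', of "s - t" t k] by simp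
    moreover have "lap f = heat_exp t ((lap ^^ Suc k) F)"
      unfolding f_def using lap_heat_exp[OF F', of t k] by simp
    ultimately have "S_le (\<lambda>X. (heat_exp s ((lap ^^ k) F) X - heat_exp t ((lap ^^ k) F) X) / of_real (s - t)
        - heat_exp t ((lap ^^ Suc k) F) X) (\<bar>s - t\<bar> * (half_trace\<^sup>2 * exp (\<bar>s - t\<bar> * half_trace) * C))"
      using heat_exp_difference_quotient[OF f, of "s - t"] that by (simp add: f_def)
    from S_norm_le[OF this] S_norm_nonneg[OF S_le_imp_S_space[OF this]] show ?thesis by simp
  qed
  have "((\<lambda>s. \<bar>s - t\<bar> * (half_trace\<^sup>2 * exp (\<bar>s - t\<bar> * half_trace) * C)) \<longlongrightarrow>
      \<bar>t - t\<bar> * (half_trace\<^sup>2 * exp (\<bar>t - t\<bar> * half_trace) * C)) (at t within T')"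
    by (intro tendsto_intros)
  then have lim: "((\<lambda>s. \<bar>s - t\<bar> * (half_trace\<^sup>2 * exp (\<bar>s - t\<bar> * half_trace) * C)) \<longlongrightarrow> 0) (at t within T')"
    by simp
  have ev: "\<forall>\<^sub>F s in at t within T'. s \<noteq> t" by (simp add: eventually_at_filter)
  show "((\<lambda>s. S_norm Q (\<lambda>X. (heat_exp s ((lap ^^ k) F) X - heat_exp t ((lap ^^ k) F) X) / of_real (s - t)
        - heat_exp t ((lap ^^ Suc k) F) X)) \<longlongrightarrow> 0) (at t within T')"
  proof (rule tendsto_sandwich[OF _ _ tendsto_const lim])
    show "\<forall>\<^sub>F s in at t within T'. 0 \<le> S_norm Q (\<lambda>X. (heat_exp s ((lap ^^ k) F) X - heat_exp t ((lap ^^ k) F) X) / of_real (s - t)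
        - heat_exp t ((lap ^^ Suc k) F) X)"
      using ev by (rule eventually_mono) (use bound in simp)
    show "\<forall>\<^sub>F s in at t within T'. S_norm Q (\<lambda>X. (heat_exp s ((lap ^^ k) F) X - heat_exp t ((lap ^^ k) F) X) / of_real (s - t)
        - heat_exp t ((lap ^^ Suc k) F) X) \<le> \<bar>s - t\<bar> * (half_trace\<^sup>2 * exp (\<bar>s - t\<bar> * half_trace) * C)"
      using ev by (rule eventually_mono) (use bound in simp)
  qed
qed

end

section \<open>Measures are determined by their characteristic functionals\<close>

text \<open>Levy's uniqueness theorem speaks of probability measures, so both measures are divided
  by their common mass, read off at t = 0; mass 0 is treated apart.\<close>

lemma finite_measure_eqI_char:
  fixes M N :: "real measure"
  assumes fin: "finite_measure M" "finite_measure N" and sets: "sets M = sets borel" "sets N = sets borel"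
    and char: "\<And>t. (\<integral>x. iexp (t * x) \<partial>M) = (\<integral>x. iexp (t * x) \<partial>N)"
  shows "M = N"
proof -
  interpret M: finite_measure M by fact
  interpret N: finite_measure N by fact
  have sp: "space M = UNIV" "space N = UNIV" using sets by (auto dest: sets_eq_imp_space_eq)
  define c where "c = measure M UNIV"
  have cN: "c = measure N UNIV" using char[of 0] by (simp add: c_def sp)
  have eM: "emeasure M UNIV = ennreal c" and eN: "emeasure N UNIV = ennreal c"
    by (simp add: c_def M.emeasure_eq_measure) (simp add: cN N.emeasure_eq_measure)
  show ?thesis
  proof (cases "c = 0")
    case True
    have "emeasure M A = 0" "emeasure N A = 0" for A
      using emeasure_space[of M A] emeasure_space[of N A] eM eN sp True by auto
    then show ?thesis by (intro measure_eqI) (simp_all add: sets)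
  next
    case False
    then have c: "c > 0" using measure_nonneg[of M UNIV] unfolding c_def by linarith
    define D where "D P = density P (\<lambda>_. ennreal (1 / c))" for P :: "real measure"
    have D: "real_distribution (D P)" "char (D P) t = (1 / c) *\<^sub>R (\<integral>x. iexp (t * x) \<partial>P)"
      "A \<in> sets P \<Longrightarrow> emeasure (D P) A = ennreal (1 / c) * emeasure P A"
      if "sets P = sets borel" "emeasure P UNIV = ennreal c" for P t A
    proof -
      have "space P = UNIV" using that(1) by (auto dest: sets_eq_imp_space_eq)
      have "emeasure (D P) UNIV = 1"
        using c that \<open>space P = UNIV\<close>
        by (simp add: D_def emeasure_density nn_integral_cmult ennreal_mult[symmetric])
      then show "real_distribution (D P)"
        using that(1) \<open>space P = UNIV\<close>
        by (intro real_distribution.intro prob_spaceI real_distribution_axioms.intro) (simp_all add: D_def)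
      show "char (D P) t = (1 / c) *\<^sub>R (\<integral>x. iexp (t * x) \<partial>P)"
        unfolding char_def D_def using c that(1)
        by (subst integral_density) (simp_all add: measurable_cong_sets[OF that(1) refl])
      show "A \<in> sets P \<Longrightarrow> emeasure (D P) A = ennreal (1 / c) * emeasure P A"
        by (simp add: D_def emeasure_density nn_integral_cmult_indicator)
    qed
    have "D M = D N"
      by (intro Levy_uniqueness D(1) ext) (simp_all only: sets eM eN D(2) char)
    show ?thesis
    proof (rule measure_eqI)
      fix A assume "A \<in> sets M"
      then have "ennreal (1 / c) * emeasure M A = ennreal (1 / c) * emeasure N A"
        using D(3)[OF sets(1) eM, of A] D(3)[OF sets(2) eN, of A] \<open>D M = D N\<close> sets by simp
      then show "emeasure M A = emeasure N A"
        using c by (subst (asm) ennreal_mult_cancel_left) (simp add: ennreal_eq_0_iff)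
    qed (simp add: sets)
  qed
qed

text \<open>\<open>A\<close> is a vector space of functions, in the application the continuous
  linear functionals. The aim is to pass from uniqueness on the line to sets described by several
  functionals.\<close>

locale same_char =
  fixes M N :: "'a measure" and A :: "('a \<Rightarrow> real) set"
  assumes finM: "finite_measure M" and finN: "finite_measure N" and sets_eq: "sets N = sets M"
    and meas: "a \<in> A \<Longrightarrow> a \<in> borel_measurable M"
    and lin: "a \<in> A \<Longrightarrow> b \<in> A \<Longrightarrow> (\<lambda>x. a x + t * b x) \<in> A"
    and zero: "(\<lambda>_. 0) \<in> A"
    and char_eq: "a \<in> A \<Longrightarrow> (\<integral>x. iexp (a x) \<partial>M) = (\<integral>x. iexp (a x) \<partial>N)"
begin

lemma scale: "a \<in> A \<Longrightarrow> (\<lambda>x. t * a x) \<in> A"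
  using lin[OF zero, of a t] by simp

text \<open>
  To reach products of indicators, one factor \<open>indicator S (b x)\<close> is added at a time.
\<close>
definition good :: "('a \<Rightarrow> real) \<Rightarrow> bool" where
  "good W \<longleftrightarrow> W \<in> borel_measurable M \<and> (\<forall>x. 0 \<le> W x \<and> W x \<le> 1) \<and>
    (\<forall>a\<in>A. (\<integral>x. W x *\<^sub>R iexp (a x) \<partial>M) = (\<integral>x. W x *\<^sub>R iexp (a x) \<partial>N))"

text \<open>The image under \<open>b\<close> of the measure with density \<open>w\<close> is a
  finite measure on the line with known Fourier transform, so \<open>finite_measure_eqI_char\<close>
  applies.\<close>

lemma weighted_slice:
  assumes w: "w \<in> borel_measurable M" "\<And>x. 0 \<le> w x" "\<And>x. w x \<le> B" and b: "b \<in> A"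
    and eq: "\<And>t. (\<integral>x. w x *\<^sub>R iexp (t * b x) \<partial>M) = (\<integral>x. w x *\<^sub>R iexp (t * b x) \<partial>N)"
    and S: "S \<in> sets borel"
  shows "(\<integral>x. w x * indicator S (b x) \<partial>M) = (\<integral>x. w x * indicator S (b x) \<partial>N)"
proof -
  define D where "D P = distr (density P w) borel b" for P :: "'a measure"
  have D: "finite_measure (D P)" "(\<integral>x. iexp (t * x) \<partial>(D P)) = (\<integral>x. w x *\<^sub>R iexp (t * b x) \<partial>P)"
      "measure (D P) S = (\<integral>x. w x * indicator S (b x) \<partial>P)"
    if "finite_measure P" "sets P = sets M" for P t
  proof -
    interpret P: finite_measure P by fact
    have m [measurable]: "w \<in> borel_measurable P" "b \<in> borel_measurable P"
      using w(1) meas[OF b] by (simp_all add: measurable_cong_sets[OF that(2) refl])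
    have "(\<integral>\<^sup>+x. ennreal (w x) \<partial>P) \<le> (\<integral>\<^sup>+x. ennreal B \<partial>P)"
      by (intro nn_integral_mono ennreal_leI w)
    also have "\<dots> < \<infinity>" using P.emeasure_finite[of "space P"]
      by (simp add: less_top[symmetric] ennreal_mult_eq_top_iff)
    finally have "finite_measure (density P w)"
      by (intro finite_measureI) (simp add: emeasure_density)
    then show fin: "finite_measure (D P)"
      unfolding D_def by (intro finite_measure.finite_measure_distr) simp_all
    show "(\<integral>x. iexp (t * x) \<partial>(D P)) = (\<integral>x. w x *\<^sub>R iexp (t * b x) \<partial>P)"
      unfolding D_def by (subst integral_distr) (simp_all add: integral_density w)
    have "measure (D P) S = (\<integral>x. indicator S x \<partial>(D P))" using S by (simp add: D_def)
    also have "\<dots> = (\<integral>x. w x * indicator S (b x) \<partial>P)"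
      unfolding D_def using S by (subst integral_distr) (simp_all add: integral_density w)
    finally show "measure (D P) S = (\<integral>x. w x * indicator S (b x) \<partial>P)" .
  qed
  have "D M = D N"
  proof (rule finite_measure_eqI_char)
    show "(\<integral>x. iexp (t * x) \<partial>D M) = (\<integral>x. iexp (t * x) \<partial>D N)" for t
      by (simp only: D(2)[OF finM refl] D(2)[OF finN sets_eq] eq)
  qed (simp_all add: D finM finN sets_eq, simp_all add: D_def)
  then show ?thesis using D(3)[OF finM refl] D(3)[OF finN sets_eq] by simp
qed

text \<open>The factor \<open>iexp (a x)\<close> is not a density. It is replaced by W (1 + cos a)
  and W (1 + sin a), which are nonnegative and bounded; by Euler's formulas their Fourier integrals
  along \<open>b\<close> only involve the functionals t b, t b + a and t b - a, for which
  \<open>W\<close> is good. Subtracting the slice of \<open>W\<close> recovers cosine and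
  sine.\<close>

lemma good_slice:
  assumes W: "good W" and b: "b \<in> A" and S: "S \<in> sets borel"
  shows "good (\<lambda>x. indicator S (b x) * W x)"
proof -
  have Wm: "W \<in> borel_measurable M" and W01: "0 \<le> W x" "W x \<le> 1"
    and WI: "c \<in> A \<Longrightarrow> (\<integral>x. W x *\<^sub>R iexp (c x) \<partial>M) = (\<integral>x. W x *\<^sub>R iexp (c x) \<partial>N)" for x c
    using W by (auto simp: good_def)
  have bm: "b \<in> borel_measurable M" by (rule meas[OF b])
  have "(\<integral>x. (indicator S (b x) * W x) *\<^sub>R iexp (a x) \<partial>M) = (\<integral>x. (indicator S (b x) * W x) *\<^sub>R iexp (a x) \<partial>N)"
    if a: "a \<in> A" for a
  proof -
    have am: "a \<in> borel_measurable M" by (rule meas[OF a])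
    define wc ws where "wc x = W x * (1 + cos (a x))" and "ws x = W x * (1 + sin (a x))" for x
    define I where "I P c = (\<integral>x. W x *\<^sub>R iexp (c x) \<partial>P)" for P :: "'a measure" and c :: "'a \<Rightarrow> real"
    define R where "R P f = (\<integral>x. f x * indicator S (b x) \<partial>P)" for P :: "'a measure" and f :: "'a \<Rightarrow> real"
    have bnd: "0 \<le> wc x" "wc x \<le> 2" "0 \<le> ws x" "ws x \<le> 2" for x
    proof -
      have "0 \<le> 1 + cos (a x)" "1 + cos (a x) \<le> 2" "0 \<le> 1 + sin (a x)" "1 + sin (a x) \<le> 2"
        using cos_ge_minus_one[of "a x"] sin_ge_minus_one[of "a x"] by (simp_all, linarith+)
      with W01[of x] show "0 \<le> wc x" "wc x \<le> 2" "0 \<le> ws x" "ws x \<le> 2"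
        unfolding wc_def ws_def
        using mult_mono[of "W x" 1 "1 + cos (a x)" 2] mult_mono[of "W x" 1 "1 + sin (a x)" 2] by auto
    qed
    have wm: "wc \<in> borel_measurable M" "ws \<in> borel_measurable M"
      unfolding wc_def ws_def using Wm am by measurable
    have expand: "(\<integral>x. wc x *\<^sub>R iexp (t * b x) \<partial>P)
          = I P (\<lambda>x. t * b x) + (I P (\<lambda>x. t * b x + 1 * a x) + I P (\<lambda>x. t * b x + (-1) * a x)) / 2"
        "(\<integral>x. ws x *\<^sub>R iexp (t * b x) \<partial>P)
          = I P (\<lambda>x. t * b x) + (I P (\<lambda>x. t * b x + 1 * a x) - I P (\<lambda>x. t * b x + (-1) * a x)) / (2 * \<i>)"
        "(\<integral>x. (indicator S (b x) * W x) *\<^sub>R iexp (a x) \<partial>P)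
          = of_real (R P wc - R P W) + \<i> * of_real (R P ws - R P W)"
      if P: "finite_measure P" "sets P = sets M" for P t
    proof -
      interpret P: finite_measure P by fact
      have [measurable]: "W \<in> borel_measurable P" "a \<in> borel_measurable P" "b \<in> borel_measurable P"
        using Wm am bm by (simp_all add: measurable_cong_sets[OF that(2) refl])
      have [measurable]: "wc \<in> borel_measurable P" "ws \<in> borel_measurable P"
        unfolding wc_def ws_def by measurable
      note [measurable] = S
      have int: "integrable P (\<lambda>x. W x *\<^sub>R iexp (c x))" if [measurable]: "c \<in> borel_measurable P" for c
        by (rule P.integrable_const_bound[of _ 1]) (use W01 in \<open>auto simp: norm_mult\<close>)
      have int0: "integrable P (\<lambda>x. W x *\<^sub>R iexp (t * b x))"
        and int1: "integrable P (\<lambda>x. W x *\<^sub>R iexp (t * b x + s * a x))" for s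
        by (intro int; measurable)+
      have c: "of_real (cos y) = (iexp y + iexp (- y)) / 2" "of_real (sin y) = (iexp y - iexp (- y)) / (2 * \<i>)" for y
        by (simp_all add: cos_of_real[symmetric] sin_of_real[symmetric] cos_exp_eq sin_exp_eq)
      have e: "iexp (y + 1 * z) = iexp y * iexp z" "iexp (y + (-1) * z) = iexp y * iexp (- z)" for y z
        by (simp_all add: exp_add[symmetric] algebra_simps)
      have "(\<lambda>x. wc x *\<^sub>R iexp (t * b x)) = (\<lambda>x. W x *\<^sub>R iexp (t * b x)
          + (W x *\<^sub>R iexp (t * b x + 1 * a x) + W x *\<^sub>R iexp (t * b x + (-1) * a x)) / 2)"
        unfolding wc_def e by (simp add: fun_eq_iff scaleR_conv_of_real c algebra_simps add_divide_distrib)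
      then show "(\<integral>x. wc x *\<^sub>R iexp (t * b x) \<partial>P)
          = I P (\<lambda>x. t * b x) + (I P (\<lambda>x. t * b x + 1 * a x) + I P (\<lambda>x. t * b x + (-1) * a x)) / 2"
        unfolding I_def using int0 int1[of 1] int1[of "-1"] by simp
      have "(\<lambda>x. ws x *\<^sub>R iexp (t * b x)) = (\<lambda>x. W x *\<^sub>R iexp (t * b x)
          + (W x *\<^sub>R iexp (t * b x + 1 * a x) - W x *\<^sub>R iexp (t * b x + (-1) * a x)) / (2 * \<i>))"
        unfolding ws_def e by (simp add: fun_eq_iff scaleR_conv_of_real c algebra_simps diff_divide_distrib)
      then show "(\<integral>x. ws x *\<^sub>R iexp (t * b x) \<partial>P)
          = I P (\<lambda>x. t * b x) + (I P (\<lambda>x. t * b x + 1 * a x) - I P (\<lambda>x. t * b x + (-1) * a x)) / (2 * \<i>)"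
        unfolding I_def using int0 int1[of 1] int1[of "-1"] by simp
      have intR: "integrable P (\<lambda>x. f x * indicator S (b x))"
        if [measurable]: "f \<in> borel_measurable P" and "\<And>x. 0 \<le> f x" "\<And>x. f x \<le> 2" for f :: "'a \<Rightarrow> real"
        by (rule P.integrable_const_bound[of _ 2]) (use that in \<open>auto simp: indicator_def\<close>)
      have W2: "W x \<le> 2" for x using W01(2)[of x] by simp
      note intR' = intR[of wc] intR[of ws] intR[of W]
      have "(\<lambda>x. (indicator S (b x) * W x) *\<^sub>R iexp (a x))
          = (\<lambda>x. complex_of_real (wc x * indicator S (b x) - W x * indicator S (b x))
              + \<i> * complex_of_real (ws x * indicator S (b x) - W x * indicator S (b x)))"
        by (simp add: fun_eq_iff wc_def ws_def complex_eq_iff Re_exp Im_exp algebra_simps)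
      then show "(\<integral>x. (indicator S (b x) * W x) *\<^sub>R iexp (a x) \<partial>P)
          = of_real (R P wc - R P W) + \<i> * of_real (R P ws - R P W)"
        unfolding R_def using intR' bnd W01(1) W2
        by (simp del: of_real_diff of_real_mult)
    qed
    have IMN: "I M (\<lambda>x. t * b x) = I N (\<lambda>x. t * b x)" "I M (\<lambda>x. t * b x + s * a x) = I N (\<lambda>x. t * b x + s * a x)" for s t
      unfolding I_def by (intro WI lin scale a b)+
    note E = expand[OF finM refl] expand[OF finN sets_eq]
    have "R M wc = R N wc"
      unfolding R_def by (rule weighted_slice[OF wm(1) bnd(1,2) b _ S]) (simp only: E IMN)
    moreover have "R M ws = R N ws"
      unfolding R_def by (rule weighted_slice[OF wm(2) bnd(3,4) b _ S]) (simp only: E IMN)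
    moreover have "R M W = R N W"
      unfolding R_def by (rule weighted_slice[OF Wm W01 b _ S]) (use IMN(1) in \<open>simp add: I_def\<close>)
    ultimately show ?thesis by (simp only: E)
  qed
  moreover have "(\<lambda>x. indicator S (b x) * W x) \<in> borel_measurable M"
    using Wm bm S by measurable
  moreover have "0 \<le> indicator S (b x) * W x \<and> indicator S (b x) * W x \<le> 1" for x
    using W01[of x] by (auto simp: indicator_def)
  ultimately show ?thesis by (simp add: good_def)
qed

text \<open>The class \<open>E\<close> of sets whose indicator preserves \<open>good\<close> is
  closed under intersection, since two multiplications can be composed, and it contains the
  generators by \<open>good_slice\<close>.\<close>

lemma measures_eq:
  assumes gen: "sets M = sigma_sets UNIV {b -` S | b S. b \<in> A \<and> S \<in> sets borel}"
  shows "M = N"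
proof -
  interpret M: finite_measure M by (rule finM)
  interpret N: finite_measure N by (rule finN)
  have sp: "space M = UNIV"
  proof -
    have "UNIV \<in> sets M" unfolding gen by (rule sigma_sets_top)
    then show ?thesis using sets.sets_into_space by blast
  qed
  define E where "E = {C \<in> sets M. \<forall>W. good W \<longrightarrow> good (\<lambda>x. indicator C x * W x)}"
  have good1: "good (\<lambda>_. 1)" unfolding good_def using char_eq by simp
  show ?thesis
  proof (rule measure_eqI_generator_eq[where E = E and \<Omega> = UNIV and A = "\<lambda>_. UNIV"])
    show "Int_stable E"
    proof (rule Int_stableI)
      fix C D assume C: "C \<in> E" and D: "D \<in> E"
      have "good (\<lambda>x. indicator (C \<inter> D) x * W x)" if "good W" for W
      proof -
        have "good (\<lambda>x. indicator C x * (indicator D x * W x))" using C D that by (simp add: E_def)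
        then show ?thesis by (simp add: indicator_inter_arith mult.assoc)
      qed
      then show "C \<inter> D \<in> E" using C D by (auto simp: E_def)
    qed
    have gen_E: "{b -` S | b S. b \<in> A \<and> S \<in> sets borel} \<subseteq> E"
    proof safe
      fix b :: "'a \<Rightarrow> real" and S :: "real set" assume *: "b \<in> A" "S \<in> sets borel"
      have "b -` S \<in> sets M" using measurable_sets[OF meas[OF *(1)] *(2)] sp by simp
      moreover have "indicator (b -` S) x = (indicator S (b x) :: real)" for x by (simp add: indicator_def)
      ultimately show "b -` S \<in> E" using good_slice[OF _ *] by (simp add: E_def)
    qed
    have "sigma_sets UNIV E = sets M"
    proof
      have "E \<subseteq> sets M" by (auto simp: E_def)
      then show "sigma_sets UNIV E \<subseteq> sets M" using sets.sigma_sets_subset[of E M] sp by simp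
      show "sets M \<subseteq> sigma_sets UNIV E"
        unfolding gen by (rule sigma_sets_mono') (rule gen_E)
    qed
    then show "sets M = sigma_sets UNIV E" "sets N = sigma_sets UNIV E" by (simp_all add: sets_eq)
    show "range (\<lambda>_. UNIV) \<subseteq> E" using sets.top[of M] sp by (simp add: E_def)
    fix C assume C: "C \<in> E"
    \<comment> \<open>Goodness of the indicator itself, tested with the zero functional, is equality
      of the measures of \<open>C\<close>.\<close>
    then have "good (\<lambda>x. indicator C x * 1)" using good1 unfolding E_def by blast
    then have "(\<integral>x. (indicator C x * 1) *\<^sub>R iexp 0 \<partial>M) = (\<integral>x. (indicator C x * 1) *\<^sub>R iexp 0 \<partial>N)"
      using zero by (auto simp only: good_def dest!: bspec[where x = "\<lambda>_. 0"])
    then have "(\<integral>x. complex_of_real (indicator C x) \<partial>M) = (\<integral>x. complex_of_real (indicator C x) \<partial>N)"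
      by (simp add: scaleR_conv_of_real)
    then have "measure M C = measure N C" using C by (simp add: E_def sets_eq)
    then show "emeasure M C = emeasure N C" by (simp add: M.emeasure_eq_measure N.emeasure_eq_measure)
  qed (auto simp: M.emeasure_finite)
qed

end

section \<open>Norming functionals and the Borel sets of a separable space\<close>

definition sublinear :: "('a::real_vector \<Rightarrow> real) \<Rightarrow> bool" where
  "sublinear p \<longleftrightarrow> (\<forall>x y. p (x + y) \<le> p x + p y) \<and> (\<forall>c x. c > 0 \<longrightarrow> p (c *\<^sub>R x) \<le> c * p x)"

lemma sublinearD:
  assumes "sublinear p"
  shows "p (x + y) \<le> p x + p y" and "c > 0 \<Longrightarrow> p (c *\<^sub>R x) = c * p x" and "p 0 = 0" and "- p (- x) \<le> p x"
proof -
  show add: "p (x + y) \<le> p x + p y" for x y using assms by (simp add: sublinear_def)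
  have le: "p (c *\<^sub>R x) \<le> c * p x" if "c > 0" for c x using assms that by (simp add: sublinear_def)
  show "p (c *\<^sub>R x) = c * p x" if "c > 0" for c x
  proof (rule antisym[OF le[OF that]])
    have "p ((1/c) *\<^sub>R (c *\<^sub>R x)) \<le> (1/c) * p (c *\<^sub>R x)" by (rule le) (use that in simp)
    then show "c * p x \<le> p (c *\<^sub>R x)" using that by (simp add: field_simps)
  qed
  from this[of 2 0] show p0: "p 0 = 0" by simp
  show "- p (- x) \<le> p x" using add[of x "- x"] p0 by simp
qed

text \<open>The classical modification of \<open>p\<close> in direction \<open>a\<close>: still
  sublinear and below \<open>p\<close>, but at most - p a at - a. For a minimal \<open>p\<close>
  this yields oddness, and for the norm it forces a dominated functional to attain the norm at
  \<open>a\<close>.\<close>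

definition sublinear_shift :: "('a::real_vector \<Rightarrow> real) \<Rightarrow> 'a \<Rightarrow> 'a \<Rightarrow> real" where
  "sublinear_shift p a x = (INF t\<in>{0..}. p (x + t *\<^sub>R a) - t * p a)"

lemma sublinear_shift_le:
  assumes p: "sublinear p" and "t \<ge> 0"
  shows "sublinear_shift p a x \<le> p (x + t *\<^sub>R a) - t * p a"
  unfolding sublinear_shift_def
proof (rule cINF_lower)
  show "bdd_below ((\<lambda>t. p (x + t *\<^sub>R a) - t * p a) ` {0..})"
  proof (rule bdd_belowI2)
    fix t :: real assume t: "t \<in> {0..}"
    have "t * p a = p (t *\<^sub>R a)" using t sublinearD(2,3)[OF p] by (cases "t = 0") auto
    also have "\<dots> \<le> p (x + t *\<^sub>R a) + p (- x)" using sublinearD(1)[OF p, of "x + t *\<^sub>R a" "- x"] by simp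
    finally show "- p (- x) \<le> p (x + t *\<^sub>R a) - t * p a" by simp
  qed
qed (use assms in simp)

lemma sublinear_shift:
  assumes p: "sublinear p"
  shows "sublinear (sublinear_shift p a)" and "sublinear_shift p a x \<le> p x"
    and "sublinear_shift p a (- a) \<le> - p a"
proof -
  let ?q = "sublinear_shift p a"
  show "?q x \<le> p x" for x using sublinear_shift_le[OF p, of 0 a x] by simp
  show "?q (- a) \<le> - p a" using sublinear_shift_le[OF p, of 1 a "- a"] sublinearD(3)[OF p] by simp
  have ge: "z \<le> ?q x" if "\<And>t. t \<ge> 0 \<Longrightarrow> z \<le> p (x + t *\<^sub>R a) - t * p a" for x z
    unfolding sublinear_shift_def by (rule cINF_greatest) (use that in auto)
  have "?q (x + y) \<le> ?q x + ?q y" for x y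
  proof -
    have "?q (x + y) - (p (x + t *\<^sub>R a) - t * p a) \<le> ?q y" if t: "t \<ge> 0" for t
    proof (rule ge)
      fix s :: real assume s: "s \<ge> 0"
      have "?q (x + y) \<le> p (x + y + (t + s) *\<^sub>R a) - (t + s) * p a"
        by (rule sublinear_shift_le[OF p]) (use s t in simp)
      moreover have "p (x + y + (t + s) *\<^sub>R a) \<le> p (x + t *\<^sub>R a) + p (y + s *\<^sub>R a)"
        using sublinearD(1)[OF p, of "x + t *\<^sub>R a" "y + s *\<^sub>R a"] by (simp add: algebra_simps)
      ultimately show "?q (x + y) - (p (x + t *\<^sub>R a) - t * p a) \<le> p (y + s *\<^sub>R a) - s * p a"
        by (simp add: algebra_simps)
    qed
    then have "?q (x + y) - ?q y \<le> ?q x" by (intro ge) (simp add: algebra_simps)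
    then show ?thesis by simp
  qed
  moreover have "?q (c *\<^sub>R x) \<le> c * ?q x" if c: "c > 0" for c x
  proof -
    have "?q (c *\<^sub>R x) / c \<le> ?q x"
    proof (rule ge)
      fix t :: real assume t: "t \<ge> 0"
      have "?q (c *\<^sub>R x) \<le> p (c *\<^sub>R x + (c * t) *\<^sub>R a) - (c * t) * p a"
        by (rule sublinear_shift_le[OF p]) (use c t in simp)
      also have "p (c *\<^sub>R x + (c * t) *\<^sub>R a) = c * p (x + t *\<^sub>R a)"
        using sublinearD(2)[OF p c, of "x + t *\<^sub>R a"] by (simp add: scaleR_add_right)
      finally show "?q (c *\<^sub>R x) / c \<le> p (x + t *\<^sub>R a) - t * p a"
        using c by (simp add: field_simps)
    qed
    then show ?thesis using c by (simp add: field_simps)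
  qed
  ultimately show "sublinear ?q" by (simp add: sublinear_def)
qed

text \<open>The Hahn-Banach theorem: a minimal sublinear functional is linear.\<close>
lemma sublinear_dominates_linear:
  fixes p :: "'a::real_vector \<Rightarrow> real"
  assumes p: "sublinear p"
  obtains f where "linear f" "\<And>x. f x \<le> p x"
proof -
  define Y where "Y = {q. sublinear q \<and> q \<le> p}"
  define R where "R = (\<lambda>q r :: 'a \<Rightarrow> real. r \<le> q)"
  have "\<exists>m\<in>Y. \<forall>q\<in>Y. R m q \<longrightarrow> q = m"
  proof (rule predicate_Zorn)
    show "partial_order_on Y (relation_of R Y)"
      by (rule partial_order_on_relation_ofI) (auto simp: R_def)
    fix C assume C: "C \<in> Chains (relation_of R Y)"
    then have total: "q \<le> r \<or> r \<le> q" if "q \<in> C" "r \<in> C" for q r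
      using that by (auto simp: Chains_def relation_of_def R_def)
    have CY: "C \<subseteq> Y" using C by (auto simp: Chains_def relation_of_def)
    show "\<exists>u\<in>Y. \<forall>q\<in>C. R q u"
    proof (cases "C = {}")
      case True
      then show ?thesis using p by (auto simp: Y_def)
    next
      case False
      define u where "u x = (INF q\<in>C. q x)" for x
      have sub: "sublinear q" "q x \<le> p x" if "q \<in> C" for q x
        using CY that by (auto simp: Y_def le_fun_def)
      have bdd: "bdd_below ((\<lambda>q. q x) ` C)" for x
      proof (rule bdd_belowI2)
        fix q assume "q \<in> C"
        then show "- p (- x) \<le> q x" using sub(1)[of q] sub(2)[of q "- x"] sublinearD(4)[of q x] by fastforce
      qed
      have le: "u x \<le> q x" if "q \<in> C" for q x unfolding u_def by (rule cINF_lower[OF bdd that])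
      have ge: "z \<le> u x" if "\<And>q. q \<in> C \<Longrightarrow> z \<le> q x" for x z
        unfolding u_def by (rule cINF_greatest[OF False that])
      have "u (x + y) \<le> u x + u y" for x y
      proof -
        \<comment> \<open>The infimum over a chain stays subadditive because two members are
          comparable: the smaller one bounds both values.\<close>
        have "u (x + y) - q x \<le> u y" if q: "q \<in> C" for q
        proof (rule ge)
          fix r assume r: "r \<in> C"
          have "u (x + y) \<le> q x + r y"
            using total[OF q r]
          proof
            assume "q \<le> r"
            then have "q y \<le> r y" by (simp add: le_fun_def)
            then show ?thesis using le[OF q, of "x + y"] sublinearD(1)[OF sub(1)[OF q], of x y] by linarith
          next
            assume "r \<le> q"
            then have "r x \<le> q x" by (simp add: le_fun_def)
            then show ?thesis using le[OF r, of "x + y"] sublinearD(1)[OF sub(1)[OF r], of x y] by linarith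
          qed
          then show "u (x + y) - q x \<le> r y" by simp
        qed
        then have "u (x + y) - u y \<le> u x" by (intro ge) (simp add: algebra_simps)
        then show ?thesis by simp
      qed
      moreover have "u (c *\<^sub>R x) \<le> c * u x" if "c > 0" for c x
      proof -
        have "u (c *\<^sub>R x) / c \<le> u x"
          by (rule ge) (use le[of _ "c *\<^sub>R x"] sublinearD(2)[OF sub(1) that] that in \<open>auto simp: field_simps\<close>)
        then show ?thesis using that by (simp add: field_simps)
      qed
      moreover have "u x \<le> p x" for x using False le sub(2) by (meson all_not_in_conv order_trans)
      ultimately have "u \<in> Y" by (simp add: Y_def sublinear_def le_fun_def)
      moreover have "R q u" if "q \<in> C" for q using le[OF that] by (simp add: R_def le_fun_def)
      ultimately show ?thesis by blast
    qed
  qed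
  then obtain m where m: "sublinear m" "m \<le> p" and min: "\<And>q. sublinear q \<Longrightarrow> q \<le> m \<Longrightarrow> q = m"
    unfolding Y_def R_def by (auto intro: order_trans)
  have odd: "m (- a) = - m a" for a
  proof -
    \<comment> \<open>The shift is sublinear and below the minimal \<open>m\<close>, hence equal to
      it; evaluation at - a gives m (- a) <= - m a.\<close>
    have "sublinear_shift m a = m"
      by (rule min) (auto simp: le_fun_def sublinear_shift[OF m(1)])
    then have "m (- a) \<le> - m a" using sublinear_shift(3)[OF m(1), of a] by simp
    then show ?thesis using sublinearD(4)[OF m(1), of a] by linarith
  qed
  have add: "m (x + y) = m x + m y" for x y
    using sublinearD(1)[OF m(1), of x y] sublinearD(1)[OF m(1), of "x + y" "- y"] odd[of y] by simp
  have "m (c *\<^sub>R x) = c *\<^sub>R m x" for c x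
  proof -
    consider "c > 0" | "c = 0" | "c < 0" by linarith
    then show ?thesis
    proof cases
      case 3
      then have "m ((- c) *\<^sub>R x) = (- c) * m x" by (intro sublinearD(2) m) simp
      then show ?thesis using odd[of "c *\<^sub>R x"] by simp
    qed (use sublinearD(2,3)[OF m(1)] in auto)
  qed
  then have "linear m" using add by (intro linearI)
  moreover have "m x \<le> p x" for x using m(2) by (simp add: le_fun_def)
  ultimately show ?thesis using that by blast
qed

text \<open>The functional is sought below \<open>sublinear_shift norm x0\<close> rather than below
  the norm: there its value at - x0 is at most - |x0|, which forces g x0 >= |x0| without an
  extension from a subspace.\<close>

lemma norming_functional:
  fixes x0 :: "'b::real_normed_vector"
  obtains f :: "'b \<Rightarrow>\<^sub>L real" where "norm f \<le> 1" "f x0 = norm x0"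
proof -
  have n: "sublinear (norm :: 'b \<Rightarrow> real)" by (simp add: sublinear_def norm_triangle_ineq)
  obtain g where g: "linear g" "\<And>x. g x \<le> sublinear_shift norm x0 x"
    using sublinear_dominates_linear[OF sublinear_shift(1)[OF n]] by blast
  have le: "g x \<le> norm x" for x using g(2)[of x] sublinear_shift(2)[OF n, of x0 x] by linarith
  have abs: "norm (g x) \<le> norm x * 1" for x
    using le[of x] le[of "- x"] linear_neg[OF g(1), of x] by simp
  have "bounded_linear g"
    by (rule bounded_linear_intro[where K = 1]) (use g(1) abs in \<open>auto simp: linear_add linear_scale\<close>)
  moreover have "g x0 \<ge> norm x0"
    using g(2)[of "- x0"] sublinear_shift(3)[OF n, of x0] linear_neg[OF g(1), of x0] by simp
  ultimately show ?thesis
    using that[of "Blinfun g"] abs le[of x0] norm_blinfun_bound[of 1 "Blinfun g"]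
    by (auto simp: bounded_linear_Blinfun_apply)
qed

text \<open>Norming functionals at the points of a countable dense set write each closed ball as a
  countable intersection of half spaces, and every open set is a countable union of closed balls
  with centre in that set and rational radius.\<close>

lemma borel_eq_sigma_dual:
  "sets (borel :: 'b::{real_normed_vector, second_countable_topology} measure)
    = sigma_sets UNIV {blinfun_apply a -` S | (a :: 'b \<Rightarrow>\<^sub>L real) S. S \<in> sets borel}"
    (is "_ = sigma_sets UNIV ?G")
proof
  have "?G \<subseteq> sets borel"
    using measurable_sets[OF borel_measurable_continuous_onI[OF linear_continuous_on[OF blinfun.bounded_linear_right]]]
    by force
  then show "sigma_sets UNIV ?G \<subseteq> sets (borel :: 'b measure)"
    using sets.sigma_sets_subset[of ?G "borel :: 'b measure"] by simp
  interpret G: sigma_algebra UNIV "sigma_sets UNIV ?G" by (rule sigma_algebra_sigma_sets) auto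
  obtain D :: "'b set" where D: "countable D" "\<And>X. open X \<Longrightarrow> X \<noteq> {} \<Longrightarrow> \<exists>d\<in>D. d \<in> X"
    using countable_dense_setE by metis
  have dense: "\<exists>d\<in>D. norm (x - d) < r" if "r > 0" for x r
    using D(2)[of "ball x r"] that by (auto simp: dist_norm)
  have "\<exists>f :: 'b \<Rightarrow>\<^sub>L real. norm f \<le> 1 \<and> blinfun_apply f d = norm d" for d using norming_functional by metis
  then obtain f :: "'b \<Rightarrow> 'b \<Rightarrow>\<^sub>L real" where f: "norm (f d) \<le> 1" "blinfun_apply (f d) d = norm d" for d
    by metis
  have f_le: "f d x \<le> norm x" for d x
    using norm_blinfun[of "f d" x] mult_right_mono[OF f(1)[of d] norm_ge_zero[of x]] by simp
  have cball: "cball c r \<in> sigma_sets UNIV ?G" for c r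
  proof -
    have "cball c r = (\<Inter>d\<in>D. blinfun_apply (f d) -` {.. r + f d c})"
    proof (intro set_eqI iffI)
      fix x assume "x \<in> cball c r"
      then have "norm (x - c) \<le> r" by (simp add: dist_norm norm_minus_commute)
      then have "f d x - f d c \<le> r" for d using f_le[of d "x - c"] by (simp add: blinfun.diff_right)
      then show "x \<in> (\<Inter>d\<in>D. blinfun_apply (f d) -` {.. r + f d c})" by (auto simp: algebra_simps)
    next
      fix x assume x: "x \<in> (\<Inter>d\<in>D. blinfun_apply (f d) -` {.. r + f d c})"
      have "norm (x - c) \<le> r"
      proof (rule field_le_epsilon)
        fix s :: real assume "s > 0"
        then obtain d where d: "d \<in> D" "norm (x - c - d) < s / 2" using dense[of "s / 2" "x - c"] by auto
        \<comment> \<open>The dense point \<open>d\<close> is close to x - c, and its norming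
          functional is at most r on x - c; the two errors are below s / 2 each.\<close>
        have "norm (x - c) \<le> norm (x - c - d) + norm d" using norm_triangle_ineq[of "x - c - d" d] by simp
        moreover have "norm d = f d (x - c) - f d (x - c - d)" by (simp add: f(2) blinfun.diff_right)
        moreover have "- f d (x - c - d) \<le> norm (x - c - d)"
          using f_le[of d "- (x - c - d)"] by (simp add: blinfun.minus_right del: minus_diff_eq)
        moreover have "f d (x - c) \<le> r" using x d(1) by (auto simp: blinfun.diff_right algebra_simps)
        ultimately show "norm (x - c) \<le> r + s" using d(2) by linarith
      qed
      then show "x \<in> cball c r" by (simp add: dist_norm norm_minus_commute)
    qed
    also have "\<dots> \<in> sigma_sets UNIV ?G"
    proof (rule G.countable_INT'')
      show "blinfun_apply (f d) -` {.. r + f d c} \<in> sigma_sets UNIV ?G" for d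
      proof (rule sigma_sets.Basic)
        have "{.. r + f d c} \<in> sets borel" by simp
        then show "blinfun_apply (f d) -` {.. r + f d c} \<in> ?G" by blast
      qed
    qed (use D(1) in auto)
    finally show ?thesis .
  qed
  have "U \<in> sigma_sets UNIV ?G" if U: "open U" for U :: "'b set"
  proof -
    define I where "I = {(d, q). d \<in> D \<and> q \<in> \<rat> \<and> cball d q \<subseteq> U}"
    have "U = (\<Union>(d, q)\<in>I. cball d q)"
    proof (intro set_eqI iffI)
      fix x assume "x \<in> U"
      then obtain r where r: "r > 0" "ball x r \<subseteq> U" using U open_contains_ball by blast
      \<comment> \<open>A centre within r / 3 < q puts x into the ball, and all points of the ball
        are within q + r / 3 < r of x.\<close>
      obtain q where q: "q \<in> \<rat>" "r / 3 < q" "q < r / 2" using Rats_dense_in_real[of "r / 3" "r / 2"] r(1) by auto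
      obtain d where d: "d \<in> D" "norm (x - d) < r / 3" using dense[of "r / 3" x] r(1) by auto
      have "cball d q \<subseteq> U"
      proof
        fix y assume "y \<in> cball d q"
        then have "dist x y < r"
          using dist_triangle[of x y d] d(2) q(3) r(1) by (simp add: dist_norm)
        then show "y \<in> U" using r(2) by auto
      qed
      then have "(d, q) \<in> I" using d q by (simp add: I_def)
      moreover have "x \<in> cball d q" using d q by (simp add: dist_norm norm_minus_commute)
      ultimately show "x \<in> (\<Union>(d, q)\<in>I. cball d q)" by blast
    qed (auto simp: I_def)
    moreover have "countable I"
      by (rule countable_subset[of _ "D \<times> \<rat>"]) (auto simp: I_def D(1) countable_rat)
    ultimately show ?thesis
      using G.countable_UN'[of I "\<lambda>(d, q). cball d q"] cball by auto
  qed
  then have "sigma_sets UNIV {U :: 'b set. open U} \<subseteq> sigma_sets UNIV ?G"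
    by (intro sigma_sets_mono) auto
  then show "sets (borel :: 'b measure) \<subseteq> sigma_sets UNIV ?G"
    by (simp add: borel_def)
qed

lemma measure_eqI_dual:
  fixes M N :: "'b::{real_normed_vector, second_countable_topology} measure"
  assumes fin: "finite_measure M" "finite_measure N" and sets: "sets M = sets borel" "sets N = sets borel"
    and char: "\<And>a :: 'b \<Rightarrow>\<^sub>L real. (\<integral>x. iexp (a x) \<partial>M) = (\<integral>x. iexp (a x) \<partial>N)"
  shows "M = N"
proof -
  interpret same_char M N "range (blinfun_apply :: ('b \<Rightarrow>\<^sub>L real) \<Rightarrow> _)"
  proof (rule same_char.intro)
    show "a \<in> borel_measurable M" if "a \<in> range (blinfun_apply :: ('b \<Rightarrow>\<^sub>L real) \<Rightarrow> _)" for a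
      using that by (auto simp: measurable_cong_sets[OF sets(1) refl]
          intro: borel_measurable_continuous_onI linear_continuous_on blinfun.bounded_linear_right)
    show "(\<lambda>x. a x + t * b x) \<in> range (blinfun_apply :: ('b \<Rightarrow>\<^sub>L real) \<Rightarrow> _)"
      if "a \<in> range (blinfun_apply :: ('b \<Rightarrow>\<^sub>L real) \<Rightarrow> _)" "b \<in> range (blinfun_apply :: ('b \<Rightarrow>\<^sub>L real) \<Rightarrow> _)" for a b t
    proof -
      obtain a' b' :: "'b \<Rightarrow>\<^sub>L real" where "a = blinfun_apply a'" "b = blinfun_apply b'" using \<open>a \<in> _\<close> \<open>b \<in> _\<close> by blast
      then have "(\<lambda>x. a x + t * b x) = blinfun_apply (a' + t *\<^sub>R b')"
        by (simp add: fun_eq_iff blinfun.add_left blinfun.scaleR_left)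
      then show ?thesis by blast
    qed
    have "(\<lambda>_. 0) = blinfun_apply (0 :: 'b \<Rightarrow>\<^sub>L real)" by (simp add: fun_eq_iff)
    then show "(\<lambda>_. 0) \<in> range (blinfun_apply :: ('b \<Rightarrow>\<^sub>L real) \<Rightarrow> _)" by blast
    show "sets N = sets M" by (simp add: sets)
    show "(\<integral>x. iexp (a x) \<partial>M) = (\<integral>x. iexp (a x) \<partial>N)"
      if "a \<in> range (blinfun_apply :: ('b \<Rightarrow>\<^sub>L real) \<Rightarrow> _)" for a
      using that char by auto
  qed (rule fin)+
  have "{b -` S | b S. b \<in> range (blinfun_apply :: ('b \<Rightarrow>\<^sub>L real) \<Rightarrow> _) \<and> S \<in> sets borel}
      = {blinfun_apply a -` S | (a :: 'b \<Rightarrow>\<^sub>L real) S. S \<in> sets borel}" by blast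
  then show ?thesis using measures_eq borel_eq_sigma_dual[where 'b = 'b] sets(1) by metis
qed

section \<open>Gaussian variables\<close>

text \<open>A functional on the plane is s fst + t snd, so the hypothesis says that the joint law
  and the product of the marginals have equal characteristic functionals.\<close>

lemma (in prob_space) indep_var_of_char:
  fixes X Y :: "'a \<Rightarrow> real"
  assumes [measurable]: "X \<in> borel_measurable M" "Y \<in> borel_measurable M"
    and char: "\<And>s t. (\<integral>\<omega>. iexp (s * X \<omega> + t * Y \<omega>) \<partial>M)
      = (\<integral>\<omega>. iexp (s * X \<omega>) \<partial>M) * (\<integral>\<omega>. iexp (t * Y \<omega>) \<partial>M)"
  shows "indep_var borel X borel Y"
proof -
  interpret X: prob_space "distr M borel X" by (rule prob_space_distr) simp
  interpret Y: prob_space "distr M borel Y" by (rule prob_space_distr) simp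
  interpret P: pair_prob_space "distr M borel X" "distr M borel Y" ..
  have "distr M borel X \<Otimes>\<^sub>M distr M borel Y = distr M (borel \<Otimes>\<^sub>M borel) (\<lambda>\<omega>. (X \<omega>, Y \<omega>))"
  proof (rule measure_eqI_dual)
    show "finite_measure (distr M borel X \<Otimes>\<^sub>M distr M borel Y)" by unfold_locales
    have "prob_space (distr M (borel \<Otimes>\<^sub>M borel) (\<lambda>\<omega>. (X \<omega>, Y \<omega>)))" by (rule prob_space_distr) simp
    then show "finite_measure (distr M (borel \<Otimes>\<^sub>M borel) (\<lambda>\<omega>. (X \<omega>, Y \<omega>)))"
      by (simp add: prob_space_def)
    show "sets (distr M borel X \<Otimes>\<^sub>M distr M borel Y) = sets (borel :: (real \<times> real) measure)"
      by (simp add: borel_prod[symmetric] cong: sets_pair_measure_cong)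
    show "sets (distr M (borel \<Otimes>\<^sub>M borel) (\<lambda>\<omega>. (X \<omega>, Y \<omega>))) = sets (borel :: (real \<times> real) measure)"
      by (simp add: borel_prod[symmetric])
    fix a :: "(real \<times> real) \<Rightarrow>\<^sub>L real"
    define s t where "s = a (1, 0)" and "t = a (0, 1)"
    have a: "a p = s * fst p + t * snd p" for p
    proof -
      have "p = fst p *\<^sub>R (1, 0) + snd p *\<^sub>R (0, 1)" by (cases p) simp
      then have "a p = fst p *\<^sub>R s + snd p *\<^sub>R t" unfolding s_def t_def
        by (metis blinfun.add_right blinfun.scaleR_right)
      then show ?thesis by (simp add: mult.commute)
    qed
    have "(\<integral>p. iexp (a p) \<partial>(distr M borel X \<Otimes>\<^sub>M distr M borel Y))
        = (\<integral>x. (\<integral>y. iexp (a (x, y)) \<partial>(distr M borel Y)) \<partial>(distr M borel X))"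
    proof (rule P.integral_fst'[symmetric], rule P.integrable_const_bound[of _ 1])
      show "(\<lambda>p. iexp (a p)) \<in> borel_measurable (distr M borel X \<Otimes>\<^sub>M distr M borel Y)"
        unfolding a by measurable
    qed simp
    also have "\<dots> = (\<integral>x. iexp (s * x) \<partial>(distr M borel X)) * (\<integral>y. iexp (t * y) \<partial>(distr M borel Y))"
      by (simp add: a distrib_left exp_add)
    also have "\<dots> = (\<integral>\<omega>. iexp (s * X \<omega>) \<partial>M) * (\<integral>\<omega>. iexp (t * Y \<omega>) \<partial>M)"
      by (subst (1 2) integral_distr) simp_all
    also have "\<dots> = (\<integral>p. iexp (a p) \<partial>(distr M (borel \<Otimes>\<^sub>M borel) (\<lambda>\<omega>. (X \<omega>, Y \<omega>))))"
      unfolding a by (subst integral_distr) (simp_all only: char[symmetric] fst_conv snd_conv, measurable)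
    finally show "(\<integral>p. iexp (a p) \<partial>(distr M borel X \<Otimes>\<^sub>M distr M borel Y))
        = (\<integral>p. iexp (a p) \<partial>(distr M (borel \<Otimes>\<^sub>M borel) (\<lambda>\<omega>. (X \<omega>, Y \<omega>))))" .
  qed
  then show ?thesis by (simp add: indep_var_distribution_eq)
qed

text \<open>Completing the square in the normal density: the Cameron-Martin formula on the
  line.\<close>

lemma std_normal_shift:
  fixes f :: "real \<Rightarrow> 'c::{banach, second_countable_topology}"
  assumes f [measurable]: "f \<in> borel_measurable borel"
  shows "(\<integral>z. exp (s * z - s\<^sup>2 / 2) *\<^sub>R f z \<partial>std_normal_distribution) = (\<integral>z. f (z + s) \<partial>std_normal_distribution)"
proof -
  have "(\<integral>z. exp (s * z - s\<^sup>2 / 2) *\<^sub>R f z \<partial>std_normal_distribution)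
      = (\<integral>z. std_normal_density z *\<^sub>R exp (s * z - s\<^sup>2 / 2) *\<^sub>R f z \<partial>lborel)"
    by (rule integral_density) (auto simp: normal_density_nonneg)
  also have "\<dots> = \<bar>1\<bar> *\<^sub>R (\<integral>z. std_normal_density (s + 1 * z) *\<^sub>R exp (s * (s + 1 * z) - s\<^sup>2 / 2) *\<^sub>R f (s + 1 * z) \<partial>lborel)"
    by (rule lborel_integral_real_affine) simp
  also have "\<dots> = (\<integral>z. std_normal_density z *\<^sub>R f (z + s) \<partial>lborel)"
  proof -
    have "std_normal_density (s + z) * exp (s * (s + z) - s\<^sup>2 / 2) = std_normal_density z" for z
      by (simp add: std_normal_density_def exp_add[symmetric] power2_eq_square field_simps)
    then show ?thesis by (simp add: add.commute)
  qed
  also have "\<dots> = (\<integral>z. f (z + s) \<partial>std_normal_distribution)"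
    by (rule integral_density[symmetric]) (auto simp: normal_density_nonneg)
  finally show ?thesis .
qed

lemma std_normal_prob_space: "prob_space std_normal_distribution"
  using real_dist_normal_dist by (simp add: real_distribution_def)

lemma std_normal_exp:
  shows "integrable std_normal_distribution (\<lambda>z. exp (s * z))"
    and "(\<integral>z. exp (s * z) \<partial>std_normal_distribution) = exp (s\<^sup>2 / 2)"
    and "(\<integral>z. exp (s * z) *\<^sub>R iexp (t * z) \<partial>std_normal_distribution) = exp (s\<^sup>2 / 2) *\<^sub>R (iexp (s * t) * exp (- (t\<^sup>2 / 2)))"
proof -
  interpret prob_space std_normal_distribution by (rule std_normal_prob_space)
  have "(\<integral>z. exp (s * z - s\<^sup>2 / 2) *\<^sub>R (1::real) \<partial>std_normal_distribution) = 1"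
    using std_normal_shift[of "\<lambda>_. 1 :: real" s] prob_space by simp
  moreover have "(\<lambda>z. exp (s * z - s\<^sup>2 / 2) *\<^sub>R (1::real)) = (\<lambda>z. exp (- (s\<^sup>2 / 2)) * exp (s * z))"
    by (simp add: fun_eq_iff exp_add[symmetric] algebra_simps)
  ultimately have 1: "exp (- (s\<^sup>2 / 2)) * (\<integral>z. exp (s * z) \<partial>std_normal_distribution) = 1" by simp
  then show eq: "(\<integral>z. exp (s * z) \<partial>std_normal_distribution) = exp (s\<^sup>2 / 2)"
    by (simp add: exp_minus field_simps)
  \<comment> \<open>A nonintegrable function would have Bochner integral 0, whereas exp (s^2 / 2) is
    positive.\<close>
  then show "integrable std_normal_distribution (\<lambda>z. exp (s * z))"
    using not_integrable_integral_eq by fastforce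
  have "(\<integral>z. exp (s * z) *\<^sub>R iexp (t * z) \<partial>std_normal_distribution)
      = exp (s\<^sup>2 / 2) *\<^sub>R (\<integral>z. exp (s * z - s\<^sup>2 / 2) *\<^sub>R iexp (t * z) \<partial>std_normal_distribution)"
    by (simp add: exp_diff flip: integral_scaleR_right)
  also have "\<dots> = exp (s\<^sup>2 / 2) *\<^sub>R (\<integral>z. iexp (s * t) * iexp (t * z) \<partial>std_normal_distribution)"
    by (subst std_normal_shift) (simp_all add: distrib_left exp_add mult_ac)
  also have "(\<integral>z. iexp (s * t) * iexp (t * z) \<partial>std_normal_distribution) = iexp (s * t) * exp (- (t\<^sup>2 / 2))"
    using fun_cong[OF char_std_normal_distribution, of t] by (simp add: char_def exp_of_real)
  finally show "(\<integral>z. exp (s * z) *\<^sub>R iexp (t * z) \<partial>std_normal_distribution) = exp (s\<^sup>2 / 2) *\<^sub>R (iexp (s * t) * exp (- (t\<^sup>2 / 2)))" .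
qed

text \<open>Fatou's lemma bounds the L^2 distance of \<open>f\<close> and \<open>g\<close> by the
  limit inferior of distances that tend to 0.\<close>

lemma AE_eq_of_L2_limit:
  fixes c :: "nat \<Rightarrow> 'a \<Rightarrow> real"
  assumes [measurable]: "\<And>n. c n \<in> borel_measurable M" "f \<in> borel_measurable M" "g \<in> borel_measurable M"
    and lim: "AE x in M. (\<lambda>n. c n x) \<longlonglongrightarrow> g x"
    and L2: "(\<lambda>n. \<integral>\<^sup>+x. ennreal ((c n x - f x)\<^sup>2) \<partial>M) \<longlonglongrightarrow> 0"
  shows "AE x in M. f x = g x"
proof -
  have "(\<integral>\<^sup>+x. ennreal ((g x - f x)\<^sup>2) \<partial>M) = (\<integral>\<^sup>+x. liminf (\<lambda>n. ennreal ((c n x - f x)\<^sup>2)) \<partial>M)"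
  proof (rule nn_integral_cong_AE)
    show "AE x in M. ennreal ((g x - f x)\<^sup>2) = liminf (\<lambda>n. ennreal ((c n x - f x)\<^sup>2))"
      using lim
    proof eventually_elim
      case (elim x)
      then have "(\<lambda>n. ennreal ((c n x - f x)\<^sup>2)) \<longlonglongrightarrow> ennreal ((g x - f x)\<^sup>2)"
        by (intro tendsto_ennrealI tendsto_intros)
      from lim_imp_Liminf[OF _ this] show ?case by simp
    qed
  qed
  also have "\<dots> \<le> liminf (\<lambda>n. \<integral>\<^sup>+x. ennreal ((c n x - f x)\<^sup>2) \<partial>M)"
    by (rule nn_integral_liminf) measurable
  also have "\<dots> = 0" using L2 by (simp add: lim_imp_Liminf)
  finally have "(\<integral>\<^sup>+x. ennreal ((g x - f x)\<^sup>2) \<partial>M) = 0" by simp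
  then have "AE x in M. ennreal ((g x - f x)\<^sup>2) = 0" by (subst (asm) nn_integral_0_iff_AE) measurable
  then show ?thesis by eventually_elim (simp add: ennreal_eq_0_iff)
qed

section \<open>Gaussian functionals on the Wiener space\<close>

locale wiener_space =
  fixes J :: "'v::{real_inner, banach, second_countable_topology} \<Rightarrow>\<^sub>L 'b::{real_normed_vector, second_countable_topology}"
    and \<nu> :: "'b measure" and h :: real
  assumes dense: "closure (range (\<lambda>a :: 'b \<Rightarrow>\<^sub>L real. a o\<^sub>L J)) = UNIV"
    and wiener: "wiener_measure J h \<nu>" and h: "h > 0"
begin

sublocale prob_space \<nu> using wiener by (simp add: wiener_measure_def)

lemma sets_nu [measurable_cong]: "sets \<nu> = sets borel"
  using wiener by (simp add: wiener_measure_def)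

lemma space_nu [simp]: "space \<nu> = UNIV"
  using sets_nu by (auto dest: sets_eq_imp_space_eq)

lemma dual_measurable [measurable]: "blinfun_apply (a :: 'b \<Rightarrow>\<^sub>L 'c::real_normed_vector) \<in> borel_measurable \<nu>"
  by (intro measurable_compose[OF _ borel_measurable_continuous_onI[OF linear_continuous_on[OF blinfun.bounded_linear_right]]])
    (simp add: measurable_def sets_nu)

text \<open>Stated as the law of sigma z instead of by a density, so that the degenerate case sigma
  = 0 is included.\<close>

definition gauss :: "('b \<Rightarrow> real) \<Rightarrow> real \<Rightarrow> bool" where
  "gauss f \<sigma> \<longleftrightarrow> f \<in> borel_measurable \<nu> \<and> distr \<nu> borel f = distr std_normal_distribution borel (\<lambda>z. \<sigma> * z)"

lemma gaussI:
  assumes [measurable]: "f \<in> borel_measurable \<nu>"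
    and char: "\<And>t. (\<integral>x. iexp (t * f x) \<partial>\<nu>) = of_real (exp (- ((\<sigma> * t)\<^sup>2 / 2)))"
  shows "gauss f \<sigma>"
proof -
  interpret G: prob_space std_normal_distribution by (rule std_normal_prob_space)
  have "distr \<nu> borel f = distr std_normal_distribution borel (\<lambda>z. \<sigma> * z)"
  proof (rule finite_measure_eqI_char)
    show "finite_measure (distr \<nu> borel f)" "finite_measure (distr std_normal_distribution borel (\<lambda>z. \<sigma> * z))"
      by (intro finite_measure_distr G.finite_measure_distr; simp)+
    fix t
    have "(\<integral>x. iexp (t * x) \<partial>(distr \<nu> borel f)) = (\<integral>x. iexp (t * f x) \<partial>\<nu>)"
      by (rule integral_distr) measurable
    also have "\<dots> = of_real (exp (- ((\<sigma> * t)\<^sup>2 / 2)))" by (rule char)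
    also have "\<dots> = (\<integral>z. iexp ((\<sigma> * t) * z) \<partial>std_normal_distribution)"
      using fun_cong[OF char_std_normal_distribution, of "\<sigma> * t"] by (simp add: char_def)
    also have "\<dots> = (\<integral>z. iexp (t * (\<sigma> * z)) \<partial>std_normal_distribution)" by (simp add: mult_ac)
    also have "\<dots> = (\<integral>x. iexp (t * x) \<partial>(distr std_normal_distribution borel (\<lambda>z. \<sigma> * z)))"
      by (rule integral_distr[symmetric]) measurable
    finally show "(\<integral>x. iexp (t * x) \<partial>(distr \<nu> borel f)) = (\<integral>x. iexp (t * x) \<partial>(distr std_normal_distribution borel (\<lambda>z. \<sigma> * z)))" .
  qed simp_all
  then show ?thesis by (simp add: gauss_def)
qed

lemma gauss_integral:
  fixes g :: "real \<Rightarrow> 'c::{banach, second_countable_topology}"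
  assumes "gauss f \<sigma>" and [measurable]: "g \<in> borel_measurable borel"
  shows "(\<integral>x. g (f x) \<partial>\<nu>) = (\<integral>z. g (\<sigma> * z) \<partial>std_normal_distribution)"
    and "integrable \<nu> (\<lambda>x. g (f x)) \<longleftrightarrow> integrable std_normal_distribution (\<lambda>z. g (\<sigma> * z))"
proof -
  have [measurable]: "f \<in> borel_measurable \<nu>" and eq: "distr \<nu> borel f = distr std_normal_distribution borel (\<lambda>z. \<sigma> * z)"
    using assms(1) by (auto simp: gauss_def)
  have "(\<integral>x. g (f x) \<partial>\<nu>) = (\<integral>y. g y \<partial>(distr \<nu> borel f))" by (rule integral_distr[symmetric]) measurable
  also have "\<dots> = (\<integral>z. g (\<sigma> * z) \<partial>std_normal_distribution)" unfolding eq by (rule integral_distr) measurable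
  finally show "(\<integral>x. g (f x) \<partial>\<nu>) = (\<integral>z. g (\<sigma> * z) \<partial>std_normal_distribution)" .
  have "integrable \<nu> (\<lambda>x. g (f x)) \<longleftrightarrow> integrable (distr \<nu> borel f) g" by (rule integrable_distr_eq[symmetric]) measurable
  also have "\<dots> \<longleftrightarrow> integrable std_normal_distribution (\<lambda>z. g (\<sigma> * z))" unfolding eq by (rule integrable_distr_eq) measurable
  finally show "integrable \<nu> (\<lambda>x. g (f x)) \<longleftrightarrow> integrable std_normal_distribution (\<lambda>z. g (\<sigma> * z))" .
qed

lemma gauss_square:
  assumes "gauss f \<sigma>"
  shows "integrable \<nu> (\<lambda>x. (f x)\<^sup>2)" and "(\<integral>x. (f x)\<^sup>2 \<partial>\<nu>) = \<sigma>\<^sup>2"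
    and "(\<integral>\<^sup>+x. ennreal ((f x)\<^sup>2) \<partial>\<nu>) = ennreal (\<sigma>\<^sup>2)"
proof -
  have sq: "integrable std_normal_distribution (\<lambda>z. z\<^sup>2)" "(\<integral>z. z\<^sup>2 \<partial>std_normal_distribution) = (1 :: real)"
    using std_normal_distribution_even_moments[of 1] by simp_all
  show int: "integrable \<nu> (\<lambda>x. (f x)\<^sup>2)"
    by (subst gauss_integral(2)[OF assms]) (simp_all add: power_mult_distrib sq)
  show eq: "(\<integral>x. (f x)\<^sup>2 \<partial>\<nu>) = \<sigma>\<^sup>2"
    by (subst gauss_integral(1)[OF assms]) (simp_all add: power_mult_distrib sq)
  show "(\<integral>\<^sup>+x. ennreal ((f x)\<^sup>2) \<partial>\<nu>) = ennreal (\<sigma>\<^sup>2)"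
    by (subst nn_integral_eq_integral[OF int]) (simp_all add: eq)
qed

lemma dual_gauss: "gauss (blinfun_apply a) (sqrt h * norm (a o\<^sub>L J))"
proof (rule gaussI)
  fix t :: real
  have "(t *\<^sub>R a) o\<^sub>L J = t *\<^sub>R (a o\<^sub>L J)" by (rule blinfun_eqI) (simp add: blinfun.scaleR_left)
  then have n: "(norm ((t *\<^sub>R a) o\<^sub>L J))\<^sup>2 = t\<^sup>2 * (norm (a o\<^sub>L J))\<^sup>2" by (simp add: power_mult_distrib)
  have "(\<integral>x. iexp ((t *\<^sub>R a) x) \<partial>\<nu>) = exp (- complex_of_real (h / 2 * (norm ((t *\<^sub>R a) o\<^sub>L J))\<^sup>2))"
    using wiener by (simp only: wiener_measure_def)
  then show "(\<integral>x. iexp (t * a x) \<partial>\<nu>) = of_real (exp (- ((sqrt h * norm (a o\<^sub>L J) * t)\<^sup>2 / 2)))"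
    unfolding n using h
    by (simp add: blinfun.scaleR_left power_mult_distrib exp_of_real[symmetric] mult_ac)
qed simp

abbreviation ell :: "'v \<Rightarrow> 'b \<Rightarrow> real" where "ell \<equiv> wiener_functional J \<nu>"

lemma compose_diff: "(a - b) o\<^sub>L J = (a o\<^sub>L J) - (b o\<^sub>L J)"
  by (rule blinfun_eqI) (simp add: blinfun.diff_left)

text \<open>By \<open>gauss_square\<close> the map from a o J to \<open>a\<close> is, up to the
  factor sqrt h, isometric into L^2. A subsequence of an approximating sequence converges almost
  everywhere, and Fatou's lemma bounds the distance of its limit to every functional b, which covers
  all approximating sequences at once.\<close>

lemma L2_limit_exists:
  obtains f :: "'b \<Rightarrow> real" and a :: "nat \<Rightarrow> 'b \<Rightarrow>\<^sub>L real" where "f \<in> borel_measurable \<nu>"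
    "\<And>b :: 'b \<Rightarrow>\<^sub>L real. (\<integral>\<^sup>+x. ennreal ((blinfun_apply b x - f x)\<^sup>2) \<partial>\<nu>) \<le> ennreal (h * (norm ((b o\<^sub>L J) - blinfun_inner_right u))\<^sup>2)"
    "(\<lambda>n. a n o\<^sub>L J) \<longlonglongrightarrow> blinfun_inner_right u" "AE x in \<nu>. (\<lambda>n. a n x) \<longlonglongrightarrow> f x"
proof -
  let ?u = "blinfun_inner_right u"
  have "?u \<in> closure (range (\<lambda>a :: 'b \<Rightarrow>\<^sub>L real. a o\<^sub>L J))" using dense by simp
  then have "\<exists>a :: 'b \<Rightarrow>\<^sub>L real. norm ((a o\<^sub>L J) - ?u) < r" if "r > 0" for r
    using that by (force simp: closure_approachable dist_norm)
  then have "\<exists>a :: 'b \<Rightarrow>\<^sub>L real. norm ((a o\<^sub>L J) - ?u) < 1 / real (Suc n)" for n by simp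
  then obtain a :: "nat \<Rightarrow> 'b \<Rightarrow>\<^sub>L real" where a: "norm ((a n o\<^sub>L J) - ?u) < 1 / real (Suc n)" for n by metis
  have lim: "(\<lambda>n. a n o\<^sub>L J) \<longlonglongrightarrow> ?u"
  proof (rule LIM_zero_cancel, rule Lim_null_comparison)
    show "\<forall>\<^sub>F n in sequentially. norm ((a n o\<^sub>L J) - ?u) \<le> 1 / real (Suc n)"
      using a by (intro always_eventually allI less_imp_le)
  qed (rule LIMSEQ_Suc[OF lim_1_over_n])
  \<comment> \<open>The first absolute moment of the standard normal law: the L^1 norm of a
    functional is this constant times its standard deviation.\<close>
  define K where "K = (\<integral>z. \<bar>z\<bar> \<partial>std_normal_distribution)"
  have abs: "(\<integral>x. norm (b x) \<partial>\<nu>) = sqrt h * norm (b o\<^sub>L J) * K" and int: "integrable \<nu> b" for b :: "'b \<Rightarrow>\<^sub>L real"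
  proof -
    have "(\<integral>x. norm (b x) \<partial>\<nu>) = (\<integral>z. norm (sqrt h * norm (b o\<^sub>L J) * z) \<partial>std_normal_distribution)"
      by (rule gauss_integral(1)[OF dual_gauss]) simp
    also have "\<dots> = sqrt h * norm (b o\<^sub>L J) * K" using h by (simp add: K_def abs_mult)
    finally show "(\<integral>x. norm (b x) \<partial>\<nu>) = sqrt h * norm (b o\<^sub>L J) * K" .
    show "integrable \<nu> b"
      using gauss_integral(2)[OF dual_gauss, of "\<lambda>x. x" b] integrable_std_normal_distribution_moment[of 1]
      by (simp add: integrable_mult_right)
  qed
  have "K \<ge> 0" by (simp add: K_def)
  obtain r where r: "strict_mono r" "AE x in \<nu>. Cauchy (\<lambda>n. a (r n) x)"
  proof (rule cauchy_L1_AE_cauchy_subseq[of \<nu> a])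
    fix e :: real assume "e > 0"
    have "Cauchy (\<lambda>n. a n o\<^sub>L J)" using lim LIMSEQ_imp_Cauchy by blast
    moreover have "e / (sqrt h * K + 1) > 0" using \<open>e > 0\<close> h \<open>K \<ge> 0\<close> by (simp add: add_nonneg_pos)
    ultimately obtain N where N: "\<And>i j. i \<ge> N \<Longrightarrow> j \<ge> N \<Longrightarrow> norm ((a i o\<^sub>L J) - (a j o\<^sub>L J)) < e / (sqrt h * K + 1)"
      using CauchyD by metis
    show "\<exists>N. \<forall>i\<ge>N. \<forall>j\<ge>N. (\<integral>x. norm (a i x - a j x) \<partial>\<nu>) < e"
    proof (intro exI allI impI)
      fix i j assume "i \<ge> N" "j \<ge> N"
      let ?n = "norm ((a i o\<^sub>L J) - (a j o\<^sub>L J))"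
      have "(\<integral>x. norm (a i x - a j x) \<partial>\<nu>) = sqrt h * ?n * K"
        using abs[of "a i - a j"] by (simp add: compose_diff blinfun.diff_left)
      also have "\<dots> \<le> ?n * (sqrt h * K + 1)" by (simp add: algebra_simps)
      also have "\<dots> < e"
      proof -
        have "sqrt h * K + 1 > 0" using h \<open>K \<ge> 0\<close> by (simp add: add_nonneg_pos)
        with N[OF \<open>i \<ge> N\<close> \<open>j \<ge> N\<close>] show ?thesis by (simp only: pos_less_divide_eq)
      qed
      finally show "(\<integral>x. norm (a i x - a j x) \<partial>\<nu>) < e" .
    qed
  qed (rule int, blast)
  define f where "f x = lim (\<lambda>n. a (r n) x)" for x
  have f_meas [measurable]: "f \<in> borel_measurable \<nu>"
    unfolding f_def by (rule borel_measurable_lim_metric) simp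
  have conv: "AE x in \<nu>. (\<lambda>n. a (r n) x) \<longlonglongrightarrow> f x"
    using r(2) by eventually_elim (simp add: f_def Cauchy_convergent_iff convergent_LIMSEQ_iff)
  have lim_r: "(\<lambda>n. a (r n) o\<^sub>L J) \<longlonglongrightarrow> ?u" using LIMSEQ_subseq_LIMSEQ[OF lim r(1)] by (simp add: o_def)
  have "(\<integral>\<^sup>+x. ennreal ((blinfun_apply b x - f x)\<^sup>2) \<partial>\<nu>) \<le> ennreal (h * (norm ((b o\<^sub>L J) - ?u))\<^sup>2)" for b :: "'b \<Rightarrow>\<^sub>L real"
  proof -
    have "(\<integral>\<^sup>+x. ennreal ((blinfun_apply b x - f x)\<^sup>2) \<partial>\<nu>) = (\<integral>\<^sup>+x. liminf (\<lambda>n. ennreal (((b - a (r n)) x)\<^sup>2)) \<partial>\<nu>)"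
    proof (rule nn_integral_cong_AE)
      show "AE x in \<nu>. ennreal ((blinfun_apply b x - f x)\<^sup>2) = liminf (\<lambda>n. ennreal (((b - a (r n)) x)\<^sup>2))"
        using conv
      proof eventually_elim
        case (elim x)
        then have "(\<lambda>n. ennreal (((b - a (r n)) x)\<^sup>2)) \<longlonglongrightarrow> ennreal ((blinfun_apply b x - f x)\<^sup>2)"
          unfolding blinfun.diff_left by (intro tendsto_ennrealI tendsto_intros)
        from lim_imp_Liminf[OF _ this] show ?case by simp
      qed
    qed
    also have "\<dots> \<le> liminf (\<lambda>n. \<integral>\<^sup>+x. ennreal (((b - a (r n)) x)\<^sup>2) \<partial>\<nu>)"
      by (rule nn_integral_liminf) measurable
    also have "\<dots> = liminf (\<lambda>n. ennreal (h * (norm ((b o\<^sub>L J) - (a (r n) o\<^sub>L J)))\<^sup>2))"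
      using h by (simp add: gauss_square(3)[OF dual_gauss] compose_diff power_mult_distrib)
    also have "\<dots> = ennreal (h * (norm ((b o\<^sub>L J) - ?u))\<^sup>2)"
      by (intro lim_imp_Liminf tendsto_ennrealI tendsto_intros lim_r) simp
    finally show ?thesis .
  qed
  from that[OF f_meas this lim_r conv] show ?thesis .
qed

lemma ell_spec:
  shows "ell u \<in> borel_measurable \<nu>"
    and "(\<lambda>n. a n o\<^sub>L J) \<longlonglongrightarrow> blinfun_inner_right u \<Longrightarrow>
      (\<lambda>n. \<integral>\<^sup>+x. ennreal ((a n x - ell u x)\<^sup>2) \<partial>\<nu>) \<longlonglongrightarrow> 0"
proof -
  let ?P = "\<lambda>f. f \<in> borel_measurable \<nu> \<and> (\<integral>\<^sup>+x. ennreal ((f x)\<^sup>2) \<partial>\<nu>) < \<infinity> \<and>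
    (\<forall>a :: nat \<Rightarrow> 'b \<Rightarrow>\<^sub>L real. (\<lambda>n. a n o\<^sub>L J) \<longlonglongrightarrow> blinfun_inner_right u \<longrightarrow>
      (\<lambda>n. \<integral>\<^sup>+x. ennreal ((blinfun_apply (a n) x - f x)\<^sup>2) \<partial>\<nu>) \<longlonglongrightarrow> 0)"
  obtain f where f: "f \<in> borel_measurable \<nu>"
    "\<And>b :: 'b \<Rightarrow>\<^sub>L real. (\<integral>\<^sup>+x. ennreal ((blinfun_apply b x - f x)\<^sup>2) \<partial>\<nu>) \<le> ennreal (h * (norm ((b o\<^sub>L J) - blinfun_inner_right u))\<^sup>2)"
    using L2_limit_exists[of u] by blast
  have "?P f"
  proof (intro conjI allI impI)
    have "(\<integral>\<^sup>+x. ennreal (((0 :: 'b \<Rightarrow>\<^sub>L real) x - f x)\<^sup>2) \<partial>\<nu>) < \<infinity>"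
      using le_less_trans[OF f(2)[of 0] ennreal_less_top] by simp
    then show "(\<integral>\<^sup>+x. ennreal ((f x)\<^sup>2) \<partial>\<nu>) < \<infinity>" by simp
    fix a :: "nat \<Rightarrow> 'b \<Rightarrow>\<^sub>L real" assume lim: "(\<lambda>n. a n o\<^sub>L J) \<longlonglongrightarrow> blinfun_inner_right u"
    have "(\<lambda>n. h * (norm ((a n o\<^sub>L J) - blinfun_inner_right u))\<^sup>2) \<longlonglongrightarrow> h * (norm (blinfun_inner_right u - blinfun_inner_right u))\<^sup>2"
      by (intro tendsto_intros lim)
    then have lim': "(\<lambda>n. ennreal (h * (norm ((a n o\<^sub>L J) - blinfun_inner_right u))\<^sup>2)) \<longlonglongrightarrow> 0"
      unfolding ennreal_0[symmetric] by (intro tendsto_ennrealI) simp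
    show "(\<lambda>n. \<integral>\<^sup>+x. ennreal ((a n x - f x)\<^sup>2) \<partial>\<nu>) \<longlonglongrightarrow> 0"
      by (rule tendsto_sandwich[OF _ _ tendsto_const lim']) (simp_all add: f(2))
  qed (rule f)
  then have "?P (ell u)" unfolding wiener_functional_def by (rule someI[where P = ?P])
  then show "ell u \<in> borel_measurable \<nu>"
    and "(\<lambda>n. a n o\<^sub>L J) \<longlonglongrightarrow> blinfun_inner_right u \<Longrightarrow>
      (\<lambda>n. \<integral>\<^sup>+x. ennreal ((a n x - ell u x)\<^sup>2) \<partial>\<nu>) \<longlonglongrightarrow> 0" by blast+
qed

lemmas ell_measurable [measurable] = ell_spec(1)

text \<open>One approximating sequence that converges almost everywhere identifies the chosen
  representative \<open>ell w\<close>; identities for functionals pass to \<open>ell\<close> in this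
  way.\<close>

lemma ell_eqI:
  assumes "(\<lambda>n. c n o\<^sub>L J) \<longlonglongrightarrow> blinfun_inner_right w" "AE x in \<nu>. (\<lambda>n. c n x) \<longlonglongrightarrow> g x"
    and "g \<in> borel_measurable \<nu>"
  shows "AE x in \<nu>. ell w x = g x"
  by (rule AE_eq_of_L2_limit[OF _ ell_measurable assms(3,2) ell_spec(2)[OF assms(1)]]) simp

lemma ell_approx:
  obtains a :: "nat \<Rightarrow> 'b \<Rightarrow>\<^sub>L real"
  where "(\<lambda>n. a n o\<^sub>L J) \<longlonglongrightarrow> blinfun_inner_right u" "AE x in \<nu>. (\<lambda>n. a n x) \<longlonglongrightarrow> ell u x"
proof -
  obtain f and a :: "nat \<Rightarrow> 'b \<Rightarrow>\<^sub>L real" where fa: "f \<in> borel_measurable \<nu>"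
    "(\<lambda>n. a n o\<^sub>L J) \<longlonglongrightarrow> blinfun_inner_right u" "AE x in \<nu>. (\<lambda>n. a n x) \<longlonglongrightarrow> f x"
  proof (rule L2_limit_exists[of u])
    fix f and a :: "nat \<Rightarrow> 'b \<Rightarrow>\<^sub>L real"
    assume "f \<in> borel_measurable \<nu>" "(\<lambda>n. a n o\<^sub>L J) \<longlonglongrightarrow> blinfun_inner_right u"
      "AE x in \<nu>. (\<lambda>n. a n x) \<longlonglongrightarrow> f x"
    then show thesis by (rule that)
  qed
  have "AE x in \<nu>. ell u x = f x" by (rule ell_eqI[OF fa(2,3,1)])
  with fa(3) have "AE x in \<nu>. (\<lambda>n. a n x) \<longlonglongrightarrow> ell u x" by eventually_elim simp
  with fa(2) show ?thesis by (rule that)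
qed

lemma ell_dual:
  assumes "a o\<^sub>L J = blinfun_inner_right w"
  shows "AE x in \<nu>. ell w x = a x"
  by (rule ell_eqI[of "\<lambda>_. a"]) (simp_all add: assms)

text \<open>Representatives are chosen separately for each vector, so linearity holds only outside a
  null set depending on u, v and c. Hence the almost everywhere form of all such rules.\<close>

lemma ell_add_scaleR: "AE x in \<nu>. ell (u + c *\<^sub>R v) x = ell u x + c * ell v x"
proof -
  obtain a :: "nat \<Rightarrow> 'b \<Rightarrow>\<^sub>L real" where a: "(\<lambda>n. a n o\<^sub>L J) \<longlonglongrightarrow> blinfun_inner_right u" "AE x in \<nu>. (\<lambda>n. a n x) \<longlonglongrightarrow> ell u x"
    by (rule ell_approx)
  obtain b :: "nat \<Rightarrow> 'b \<Rightarrow>\<^sub>L real" where b: "(\<lambda>n. b n o\<^sub>L J) \<longlonglongrightarrow> blinfun_inner_right v" "AE x in \<nu>. (\<lambda>n. b n x) \<longlonglongrightarrow> ell v x"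
    by (rule ell_approx)
  show ?thesis
  proof (rule ell_eqI[of "\<lambda>n. a n + c *\<^sub>R b n"])
    have "(a n + c *\<^sub>R b n) o\<^sub>L J = (a n o\<^sub>L J) + c *\<^sub>R (b n o\<^sub>L J)" for n
      by (rule blinfun_eqI) (simp add: blinfun.add_left blinfun.scaleR_left)
    moreover have "blinfun_inner_right (u + c *\<^sub>R v) = blinfun_inner_right u + c *\<^sub>R blinfun_inner_right v"
      by (rule blinfun_eqI) (simp add: blinfun.add_left blinfun.scaleR_left inner_add_left)
    ultimately show "(\<lambda>n. (a n + c *\<^sub>R b n) o\<^sub>L J) \<longlonglongrightarrow> blinfun_inner_right (u + c *\<^sub>R v)"
      by (simp only:) (intro tendsto_intros a b)
    show "AE x in \<nu>. (\<lambda>n. (a n + c *\<^sub>R b n) x) \<longlonglongrightarrow> ell u x + c * ell v x"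
      using a(2) b(2)
    proof eventually_elim
      case (elim x)
      then show ?case unfolding blinfun.add_left blinfun.scaleR_left
        by (auto intro!: tendsto_intros)
    qed
  qed simp
qed

lemma ell_zero: "AE x in \<nu>. ell 0 x = 0"
proof -
  have "(0 :: 'b \<Rightarrow>\<^sub>L real) o\<^sub>L J = blinfun_inner_right 0" by (rule blinfun_eqI) simp
  from ell_dual[OF this] show ?thesis by simp
qed

lemma ell_scaleR: "AE x in \<nu>. ell (c *\<^sub>R v) x = c * ell v x"
  using ell_add_scaleR[of 0 c v] ell_zero by eventually_elim simp

lemma ell_sum:
  assumes "finite I"
  shows "AE x in \<nu>. ell (\<Sum>i\<in>I. c i *\<^sub>R v i) x = (\<Sum>i\<in>I. c i * ell (v i) x)"
  using assms
proof (induction I rule: finite_induct)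
  case empty
  then show ?case using ell_zero by simp
next
  case (insert i I)
  from ell_add_scaleR[of "\<Sum>i\<in>I. c i *\<^sub>R v i" "c i" "v i"] insert.IH show ?case
    by eventually_elim (simp add: insert.hyps add.commute)
qed

lemma ell_gauss: "gauss (ell u) (sqrt h * norm u)"
proof (rule gaussI)
  fix t :: real
  obtain a :: "nat \<Rightarrow> 'b \<Rightarrow>\<^sub>L real" where a: "(\<lambda>n. a n o\<^sub>L J) \<longlonglongrightarrow> blinfun_inner_right u" "AE x in \<nu>. (\<lambda>n. a n x) \<longlonglongrightarrow> ell u x"
    by (rule ell_approx)
  have "(\<lambda>n. \<integral>x. iexp (t * a n x) \<partial>\<nu>) \<longlonglongrightarrow> (\<integral>x. iexp (t * ell u x) \<partial>\<nu>)"
  proof (rule integral_dominated_convergence[where w = "\<lambda>_. 1"])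
    show "AE x in \<nu>. (\<lambda>n. iexp (t * a n x)) \<longlonglongrightarrow> iexp (t * ell u x)"
      using a(2) by eventually_elim (intro tendsto_intros)
  qed auto
  moreover have "(\<integral>x. iexp (t * a n x) \<partial>\<nu>) = of_real (exp (- ((sqrt h * norm (a n o\<^sub>L J) * t)\<^sup>2 / 2)))" for n
    using gauss_integral(1)[OF dual_gauss, of "\<lambda>y. iexp (t * y)" "a n"]
      fun_cong[OF char_std_normal_distribution, of "t * (sqrt h * norm (a n o\<^sub>L J))"]
    by (simp add: char_def mult_ac)
  moreover have "(\<lambda>n. complex_of_real (exp (- ((sqrt h * norm (a n o\<^sub>L J) * t)\<^sup>2 / 2))))
      \<longlonglongrightarrow> of_real (exp (- ((sqrt h * norm (blinfun_inner_right u) * t)\<^sup>2 / 2)))"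
    by (intro tendsto_intros a) simp
  ultimately show "(\<integral>x. iexp (t * ell u x) \<partial>\<nu>) = of_real (exp (- ((sqrt h * norm u * t)\<^sup>2 / 2)))"
    using LIMSEQ_unique by (simp add: norm_blinfun_inner_right)
qed simp

lemma ell_char: "(\<integral>x. iexp (ell u x) \<partial>\<nu>) = of_real (exp (- (h * (norm u)\<^sup>2 / 2)))"
  using gauss_integral(1)[OF ell_gauss, of iexp u]
    fun_cong[OF char_std_normal_distribution, of "sqrt h * norm u"] h
  by (simp add: char_def power_mult_distrib)

text \<open>The characteristic function of s u + t v factorises, since by orthogonality |s u + t
  v|^2 is the sum of the two squares.\<close>

lemma ell_indep:
  assumes "u \<bullet> v = 0"
  shows "indep_var borel (ell u) borel (ell v)"
proof (rule indep_var_of_char)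
  fix s t :: real
  have sc: "(\<integral>x. iexp (r * ell w x) \<partial>\<nu>) = of_real (exp (- (h * r\<^sup>2 * (norm w)\<^sup>2 / 2)))" for r w
  proof -
    have "(\<integral>x. iexp (r * ell w x) \<partial>\<nu>) = (\<integral>x. iexp (ell (r *\<^sub>R w) x) \<partial>\<nu>)"
    proof (rule integral_cong_AE)
      show "AE x in \<nu>. iexp (r * ell w x) = iexp (ell (r *\<^sub>R w) x)"
        using ell_scaleR[of r w] by eventually_elim simp
    qed simp_all
    then show ?thesis by (simp add: ell_char power_mult_distrib mult_ac)
  qed
  have "(\<integral>x. iexp (s * ell u x + t * ell v x) \<partial>\<nu>) = (\<integral>x. iexp (ell (s *\<^sub>R u + t *\<^sub>R v) x) \<partial>\<nu>)"
  proof (rule integral_cong_AE)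
    show "AE x in \<nu>. iexp (s * ell u x + t * ell v x) = iexp (ell (s *\<^sub>R u + t *\<^sub>R v) x)"
      using ell_scaleR[of s u] ell_add_scaleR[of "s *\<^sub>R u" t v] by eventually_elim simp
  qed simp_all
  also have "\<dots> = of_real (exp (- (h * (norm (s *\<^sub>R u + t *\<^sub>R v))\<^sup>2 / 2)))" by (rule ell_char)
  also have "(norm (s *\<^sub>R u + t *\<^sub>R v))\<^sup>2 = s\<^sup>2 * (norm u)\<^sup>2 + t\<^sup>2 * (norm v)\<^sup>2"
    using assms unfolding power2_norm_eq_inner
    by (simp add: inner_add_left inner_add_right inner_commute[of v u] power2_eq_square)
  finally show "(\<integral>x. iexp (s * ell u x + t * ell v x) \<partial>\<nu>) = (\<integral>x. iexp (s * ell u x) \<partial>\<nu>) * (\<integral>x. iexp (t * ell v x) \<partial>\<nu>)"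
    unfolding sc of_real_mult[symmetric] exp_add[symmetric] by (simp add: algebra_simps add_divide_distrib)
qed simp_all

section \<open>The Cameron-Martin formula and integration by parts\<close>

text \<open>The density of the law of J X + x with respect to \<open>\<nu>\<close>; the variance
  parameter enters both terms as 1 / h.\<close>

definition cm_density :: "'v \<Rightarrow> 'b \<Rightarrow> real" where
  "cm_density X x = exp (ell X x / h - (norm X)\<^sup>2 / (2 * h))"

lemma cm_density_measurable [measurable]: "cm_density X \<in> borel_measurable \<nu>"
  unfolding cm_density_def by measurable

lemma exp_ell_integrable: "integrable \<nu> (\<lambda>x. exp (c * ell u x))"
proof -
  have "integrable std_normal_distribution (\<lambda>z. exp (c * (sqrt h * norm u * z)))"
    using std_normal_exp(1)[of "c * (sqrt h * norm u)"] by (simp add: mult_ac)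
  then show ?thesis by (subst gauss_integral(2)[OF ell_gauss, of "\<lambda>y. exp (c * y)"]) simp_all
qed

lemma cm_density_integrable: "integrable \<nu> (cm_density X)"
proof -
  have "integrable \<nu> (\<lambda>x. exp (- ((norm X)\<^sup>2 / (2 * h))) * exp (1 / h * ell X x))"
    by (intro integrable_mult_right exp_ell_integrable)
  then show ?thesis by (simp add: cm_density_def[abs_def] exp_add[symmetric])
qed

text \<open>Both characteristic functionals are computed. For a functional with Riesz vector v = w +
  c X, w orthogonal to X, independence of \<open>ell w\<close> and \<open>ell X\<close> leaves an
  integral in the single Gaussian variable \<open>ell X\<close>, given by
  \<open>std_normal_exp\<close>.\<close>

lemma cameron_martin: "density \<nu> (cm_density X) = distr \<nu> borel (\<lambda>x. J X + x)"
proof (rule measure_eqI_dual)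
  have pos: "0 \<le> cm_density X x" for x by (simp add: cm_density_def)
  have "emeasure (density \<nu> (cm_density X)) UNIV = ennreal (\<integral>x. cm_density X x \<partial>\<nu>)"
    using nn_integral_eq_integral[OF cm_density_integrable] pos by (simp add: emeasure_density)
  then show "finite_measure (density \<nu> (cm_density X))" by (intro finite_measureI) simp
  show "finite_measure (distr \<nu> borel (\<lambda>x. J X + x))" by (rule finite_measure_distr) simp
  fix a :: "'b \<Rightarrow>\<^sub>L real"
  obtain v where v: "a o\<^sub>L J = blinfun_inner_right v" using riesz_representation by blast
  \<comment> \<open>For X = 0 the division yields c = 0, and \<open>cX\<close> holds all the
    same.\<close>
  define c where "c = (v \<bullet> X) / (X \<bullet> X)"
  define w where "w = v - c *\<^sub>R X"
  have cX: "c * (norm X)\<^sup>2 = v \<bullet> X" by (cases "X = 0") (simp_all add: c_def power2_norm_eq_inner)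
  have wX: "w \<bullet> X = 0" using cX by (simp add: w_def inner_diff_left power2_norm_eq_inner)
  have v_eq: "v = w + c *\<^sub>R X" by (simp add: w_def)
  have norm_v: "(norm v)\<^sup>2 = (norm w)\<^sup>2 + c\<^sup>2 * (norm X)\<^sup>2"
    unfolding v_eq power2_norm_eq_inner using wX
    by (simp add: inner_add_left inner_add_right inner_commute[of X w] power2_eq_square)
  have aJX: "a (J X) = v \<bullet> X"
    using arg_cong[OF v, of "\<lambda>b. blinfun_apply b X"] by simp
  define g where "g y = exp (y / h - (norm X)\<^sup>2 / (2 * h)) *\<^sub>R iexp (c * y)" for y
  have [measurable]: "g \<in> borel_measurable borel" unfolding g_def by measurable
  \<comment> \<open>In a standard normal z the integrand is exp (- s^2 / 2) exp (s z) exp (i t z):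
    the normalisation cancels, s t = v . X is the phase of the shift, and t^2 is the variance of c
    times \<open>ell X\<close>.\<close>
  define s t where "s = sqrt h * norm X / h" and "t = c * (sqrt h * norm X)"
  have st: "s\<^sup>2 = (norm X)\<^sup>2 / h" "s * t = v \<bullet> X" "t\<^sup>2 = h * c\<^sup>2 * (norm X)\<^sup>2"
  proof -
    show "s\<^sup>2 = (norm X)\<^sup>2 / h" "t\<^sup>2 = h * c\<^sup>2 * (norm X)\<^sup>2"
      using h by (simp_all add: s_def t_def power_mult_distrib power_divide power2_eq_square[of h])
    have "s * t = (sqrt h * sqrt h) / h * (c * (norm X)\<^sup>2)" by (simp add: s_def t_def power2_eq_square)
    then show "s * t = v \<bullet> X" using h cX by simp
  qed
  have "g (sqrt h * norm X * z) = exp (- (s\<^sup>2 / 2)) *\<^sub>R exp (s * z) *\<^sub>R iexp (t * z)" for z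
    unfolding g_def st(1) scaleR_scaleR exp_add[symmetric] by (simp add: s_def t_def algebra_simps)
  then have "(\<integral>x. g (ell X x) \<partial>\<nu>) = (\<integral>z. exp (- (s\<^sup>2 / 2)) *\<^sub>R exp (s * z) *\<^sub>R iexp (t * z) \<partial>std_normal_distribution)"
    using gauss_integral(1)[OF ell_gauss, of g X] by simp
  also have "\<dots> = exp (- (s\<^sup>2 / 2)) *\<^sub>R (\<integral>z. exp (s * z) *\<^sub>R iexp (t * z) \<partial>std_normal_distribution)"
    by (rule integral_scaleR_right)
  also have "\<dots> = iexp (v \<bullet> X) * exp (- (h * c\<^sup>2 * (norm X)\<^sup>2 / 2))"
    unfolding std_normal_exp(3) by (simp add: st exp_minus flip: of_real_mult)
  finally have intg: "(\<integral>x. g (ell X x) \<partial>\<nu>) = iexp (v \<bullet> X) * exp (- (h * c\<^sup>2 * (norm X)\<^sup>2 / 2))" .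
  have g_int: "integrable \<nu> (\<lambda>x. g (ell X x))"
  proof (rule Bochner_Integration.integrable_bound[OF cm_density_integrable])
    show "AE x in \<nu>. norm (g (ell X x)) \<le> norm (cm_density X x)"
      by (simp add: g_def cm_density_def)
  qed simp
  have "(\<integral>x. iexp (a x) \<partial>(density \<nu> (cm_density X))) = (\<integral>x. cm_density X x *\<^sub>R iexp (a x) \<partial>\<nu>)"
    by (rule integral_density) (simp_all add: pos)
  also have "\<dots> = (\<integral>x. iexp (ell w x) * g (ell X x) \<partial>\<nu>)"
  proof (rule integral_cong_AE)
    show "AE x in \<nu>. cm_density X x *\<^sub>R iexp (a x) = iexp (ell w x) * g (ell X x)"
      using ell_dual[OF v] ell_add_scaleR[of w c X, folded v_eq]
    proof eventually_elim
      case (elim x)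
      then have "a x = ell w x + c * ell X x" by simp
      then show ?case by (simp add: cm_density_def g_def distrib_left exp_add)
    qed
  qed simp_all
  also have "\<dots> = (\<integral>x. iexp (ell w x) \<partial>\<nu>) * (\<integral>x. g (ell X x) \<partial>\<nu>)"
  proof (rule indep_var_lebesgue_integral)
    have "indep_var borel (iexp \<circ> ell w) borel (g \<circ> ell X)"
      by (rule indep_var_compose[OF ell_indep[OF wX]]) simp_all
    then show "indep_var borel (\<lambda>x. iexp (ell w x)) borel (\<lambda>x. g (ell X x))" by (simp add: o_def)
    show "integrable \<nu> (\<lambda>x. iexp (ell w x))" by (rule integrable_const_bound[of _ 1]) simp_all
  qed (rule g_int)
  also have "\<dots> = iexp (a (J X)) * exp (- (h * (norm v)\<^sup>2 / 2))"
    unfolding intg ell_char aJX norm_v of_real_mult[symmetric] mult.left_commute[of "complex_of_real _"]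
    by (simp add: exp_add[symmetric] algebra_simps add_divide_distrib exp_of_real flip: of_real_mult)
  also have "\<dots> = (\<integral>x. iexp (a (J X + x)) \<partial>\<nu>)"
  proof -
    have "(\<integral>x. iexp (a x) \<partial>\<nu>) = exp (- (h * (norm v)\<^sup>2 / 2))"
      using gauss_integral(1)[OF dual_gauss, of iexp a] h
        fun_cong[OF char_std_normal_distribution, of "sqrt h * norm (a o\<^sub>L J)"]
      by (simp add: char_def v norm_blinfun_inner_right power_mult_distrib)
    then show ?thesis by (simp add: blinfun.add_right distrib_left exp_add)
  qed
  also have "\<dots> = (\<integral>x. iexp (a x) \<partial>(distr \<nu> borel (\<lambda>x. J X + x)))"
    by (rule integral_distr[symmetric]) (simp_all add: measurable_cong_sets[OF sets_nu[symmetric] refl])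
  finally show "(\<integral>x. iexp (a x) \<partial>(density \<nu> (cm_density X))) = (\<integral>x. iexp (a x) \<partial>(distr \<nu> borel (\<lambda>x. J X + x)))" .
qed (simp_all add: sets_nu)

lemma shift_measurable: "(\<lambda>x. J X + x) \<in> measurable \<nu> \<nu>"
  by (simp add: measurable_cong_sets[OF refl sets_nu])

lemma shift_measurable' [measurable (raw)]:
  "f \<in> measurable \<nu> N \<Longrightarrow> (\<lambda>x. f (J X + x)) \<in> measurable \<nu> N"
  using measurable_compose[OF shift_measurable] .

text \<open>The shifted measure has a density, so null sets are preserved. This is what gives
  meaning to \<open>ell\<close>, projections and stochastic extensions, determined up to null sets,
  at J X + x.\<close>

lemma AE_shift:
  assumes "AE x in \<nu>. P x"
  shows "AE x in \<nu>. P (J X + x)"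
proof -
  obtain N where N: "{x \<in> space \<nu>. \<not> P x} \<subseteq> N" "emeasure \<nu> N = 0" "N \<in> sets \<nu>"
    using AE_E[OF assms] by blast
  have "N \<in> null_sets (density \<nu> (cm_density X))"
    using N absolutely_continuousI_density[of "cm_density X" \<nu>]
    by (auto simp: absolutely_continuous_def null_sets_def)
  then have "N \<in> null_sets (distr \<nu> borel (\<lambda>x. J X + x))" unfolding cameron_martin .
  then have "(\<lambda>x. J X + x) -` N \<in> null_sets \<nu>"
    using N(3) by (simp add: null_sets_distr_iff sets_nu)
  then show ?thesis by (rule AE_I') (use N(1) in auto)
qed

lemma integral_shift:
  fixes f :: "'b \<Rightarrow> 'c::{banach, second_countable_topology}"
  assumes [measurable]: "f \<in> borel_measurable \<nu>"
  shows "(\<integral>x. f (J X + x) \<partial>\<nu>) = (\<integral>x. cm_density X x *\<^sub>R f x \<partial>\<nu>)"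
proof -
  have f: "f \<in> borel_measurable borel" using assms by (simp add: measurable_cong_sets[OF sets_nu refl])
  have "(\<integral>x. f (J X + x) \<partial>\<nu>) = (\<integral>x. f x \<partial>(distr \<nu> borel (\<lambda>x. J X + x)))"
    by (rule integral_distr[symmetric]) (simp_all add: f)
  also have "\<dots> = (\<integral>x. f x \<partial>(density \<nu> (cm_density X)))" by (simp only: cameron_martin)
  also have "\<dots> = (\<integral>x. cm_density X x *\<^sub>R f x \<partial>\<nu>)"
    by (rule integral_density) (simp_all add: cm_density_def)
  finally show ?thesis .
qed

text \<open>The identity is exact for functionals; the limit is taken at x and at J X + x
  simultaneously, which \<open>AE_shift\<close> permits.\<close>

lemma ell_shift: "AE x in \<nu>. ell w (J X + x) = w \<bullet> X + ell w x"
proof -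
  obtain a :: "nat \<Rightarrow> 'b \<Rightarrow>\<^sub>L real" where a: "(\<lambda>n. a n o\<^sub>L J) \<longlonglongrightarrow> blinfun_inner_right w" "AE x in \<nu>. (\<lambda>n. a n x) \<longlonglongrightarrow> ell w x"
    by (rule ell_approx)
  have "(\<lambda>n. (a n o\<^sub>L J) X) \<longlonglongrightarrow> blinfun_inner_right w X" by (intro tendsto_intros a)
  then have aJ: "(\<lambda>n. a n (J X)) \<longlonglongrightarrow> w \<bullet> X" by simp
  show ?thesis
    using a(2) AE_shift[OF a(2), of X]
  proof eventually_elim
    case (elim x)
    have "(\<lambda>n. a n (J X + x)) \<longlonglongrightarrow> w \<bullet> X + ell w x"
      unfolding blinfun.add_right by (intro tendsto_add aJ elim(1))
    then show ?case using LIMSEQ_unique[OF elim(2)] by simp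
  qed
qed

text \<open>The bound separates epsilon^2 from a factor independent of epsilon, which is integrable
  for the Gaussian p = ell u / h. The term with q is the normalisation of
  \<open>cm_density\<close>.\<close>

lemma exp_second_order:
  fixes p q \<epsilon> :: real
  assumes \<epsilon>: "0 < \<epsilon>" "\<epsilon> \<le> 1" and q: "0 \<le> q"
  shows "\<bar>exp (\<epsilon> * p - \<epsilon>\<^sup>2 * q) - 1 - \<epsilon> * p\<bar> \<le> \<epsilon>\<^sup>2 * (3 * exp (2 * (\<bar>p\<bar> + q)))"
proof -
  define w y where "w = \<bar>p\<bar> + q" and "y = \<epsilon> * p - \<epsilon>\<^sup>2 * q"
  have w: "w \<ge> 0" "w\<^sup>2 \<le> 2 * exp w" "w \<le> exp (2 * w)"
  proof -
    show "w \<ge> 0" using q by (simp add: w_def)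
    then show "w\<^sup>2 \<le> 2 * exp w" using exp_lower_Taylor_quadratic[of w] by linarith
    show "w \<le> exp (2 * w)" using \<open>w \<ge> 0\<close> exp_ge_add_one_self[of "2 * w"] by linarith
  qed
  have \<epsilon>2: "\<epsilon>\<^sup>2 \<le> \<epsilon>" using \<epsilon> by (simp add: power2_eq_square mult_left_le)
  have yw: "\<bar>y\<bar> \<le> \<epsilon> * w"
  proof -
    have "\<bar>y\<bar> \<le> \<epsilon> * \<bar>p\<bar> + \<epsilon>\<^sup>2 * q"
      using \<epsilon>(1) q abs_triangle_ineq4[of "\<epsilon> * p" "\<epsilon>\<^sup>2 * q"] by (simp add: y_def abs_mult)
    also have "\<dots> \<le> \<epsilon> * \<bar>p\<bar> + \<epsilon> * q" using \<epsilon>2 q by (intro add_left_mono mult_right_mono)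
    finally show ?thesis by (simp add: w_def algebra_simps)
  qed
  have yw': "\<bar>y\<bar> \<le> w" using yw mult_right_mono[OF \<epsilon>(2) w(1)] by simp
  obtain t where t: "\<bar>t\<bar> \<le> \<bar>y\<bar>" "exp y = (\<Sum>m<2. y ^ m / fact m) + exp t / fact 2 * y ^ 2"
    using Maclaurin_exp_le[of y 2] by blast
  have "\<bar>exp y - 1 - y\<bar> = exp t / 2 * y\<^sup>2" using t(2) by (simp add: numeral_2_eq_2)
  also have "\<dots> \<le> exp w * (\<epsilon> * w)\<^sup>2"
  proof (intro mult_mono)
    have "exp t \<le> exp w" using t(1) yw' by simp
    then show "exp t / 2 \<le> exp w" using exp_gt_zero[of t] by linarith
    show "y\<^sup>2 \<le> (\<epsilon> * w)\<^sup>2" using power_mono[OF yw abs_ge_zero, of 2] by simp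
  qed auto
  also have "\<dots> \<le> \<epsilon>\<^sup>2 * (2 * exp (2 * w))"
  proof -
    have "exp w * w\<^sup>2 \<le> exp w * (2 * exp w)" using w(2) by (intro mult_left_mono) auto
    also have "\<dots> = 2 * exp (2 * w)" by (simp add: exp_double power2_eq_square)
    finally show ?thesis using mult_left_mono[of "exp w * w\<^sup>2" "2 * exp (2 * w)" "\<epsilon>\<^sup>2"]
      by (simp add: power_mult_distrib mult_ac)
  qed
  finally have 1: "\<bar>exp y - 1 - y\<bar> \<le> \<epsilon>\<^sup>2 * (2 * exp (2 * w))" .
  have "\<epsilon>\<^sup>2 * q \<le> \<epsilon>\<^sup>2 * exp (2 * w)"
    using w(3) by (intro mult_left_mono) (auto simp: w_def)
  then have 2: "\<bar>y - \<epsilon> * p\<bar> \<le> \<epsilon>\<^sup>2 * exp (2 * w)" using q by (simp add: y_def)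
  have "\<bar>exp y - 1 - \<epsilon> * p\<bar> \<le> \<bar>exp y - 1 - y\<bar> + \<bar>y - \<epsilon> * p\<bar>" by linarith
  also have "\<dots> \<le> \<epsilon>\<^sup>2 * (3 * exp (2 * w))" using 1 2 by (simp add: algebra_simps)
  finally show ?thesis by (simp add: y_def w_def)
qed

text \<open>Differentiating the Cameron-Martin formula along \<open>\<epsilon> u\<close> at \<open>\<epsilon> = 0\<close>.\<close>
lemma integration_by_parts:
  fixes g g' :: "'b \<Rightarrow> complex"
  assumes [measurable]: "g \<in> borel_measurable \<nu>" and bd: "\<And>x. norm (g x) \<le> C" and g': "integrable \<nu> g'"
    and rem: "\<And>\<epsilon>. 0 < \<epsilon> \<Longrightarrow> AE x in \<nu>. norm (g (J (\<epsilon> *\<^sub>R u) + x) - g x - \<epsilon> *\<^sub>R g' x) \<le> K * \<epsilon>\<^sup>2"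
  shows "(\<integral>x. ell u x *\<^sub>R g x \<partial>\<nu>) = h *\<^sub>R (\<integral>x. g' x \<partial>\<nu>)"
    and "integrable \<nu> (\<lambda>x. ell u x *\<^sub>R g x)"
proof -
  have C: "C \<ge> 0" using order_trans[OF norm_ge_zero bd] .
  have bounded_int: "integrable \<nu> f" if "f \<in> borel_measurable \<nu>" "\<And>x. norm (f x) \<le> C" for f :: "'b \<Rightarrow> complex"
    by (rule integrable_const_bound[of _ C]) (use that in auto)
  have ell_int: "integrable \<nu> (ell u)"
    using gauss_integral(2)[OF ell_gauss, of "\<lambda>x. x" u] integrable_std_normal_distribution_moment[of 1]
    by (simp add: integrable_mult_right)
  have mult_int: "integrable \<nu> (\<lambda>x. f x *\<^sub>R g x)" if f: "integrable \<nu> f" for f :: "'b \<Rightarrow> real"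
  proof (rule Bochner_Integration.integrable_bound[of _ "\<lambda>x. C * f x"])
    show "integrable \<nu> (\<lambda>x. C * f x)" using f by simp
    show "(\<lambda>x. f x *\<^sub>R g x) \<in> borel_measurable \<nu>" using f by measurable
    show "AE x in \<nu>. norm (f x *\<^sub>R g x) \<le> norm (C * f x)"
      using mult_left_mono[OF bd, of "\<bar>f x\<bar>" for x] C
      by (intro always_eventually allI) (simp add: abs_mult mult.commute)
  qed
  show ell_g: "integrable \<nu> (\<lambda>x. ell u x *\<^sub>R g x)" by (rule mult_int[OF ell_int])
  define q where "q = (norm u)\<^sup>2 / (2 * h)"
  have q: "q \<ge> 0" using h by (simp add: q_def)
  \<comment> \<open>The majorant from \<open>exp_second_order\<close>; the exponential of the
    absolute value is dominated by the sum of the exponentials of both signs.\<close>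
  define H where "H x = 3 * exp (2 * (\<bar>ell u x / h\<bar> + q))" for x
  have H_int: "integrable \<nu> H"
  proof (rule Bochner_Integration.integrable_bound)
    show "integrable \<nu> (\<lambda>x. (3 * exp (2 * q)) * (exp (2 / h * ell u x) + exp ((- (2 / h)) * ell u x)))"
      by (rule integrable_mult_right, rule Bochner_Integration.integrable_add) (rule exp_ell_integrable)+
    show "AE x in \<nu>. norm (H x) \<le> norm ((3 * exp (2 * q)) * (exp (2 / h * ell u x) + exp ((- (2 / h)) * ell u x)))"
    proof (intro always_eventually allI)
      fix x
      have "exp (2 * \<bar>ell u x / h\<bar>) \<le> exp (2 / h * ell u x) + exp ((- (2 / h)) * ell u x)"
        by (cases "ell u x / h \<ge> 0") (simp_all add: abs_if)
      then have "exp (2 * q) * exp (2 * \<bar>ell u x / h\<bar>) \<le> exp (2 * q) * (exp (2 / h * ell u x) + exp ((- (2 / h)) * ell u x))"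
        by (intro mult_left_mono) auto
      then show "norm (H x) \<le> norm ((3 * exp (2 * q)) * (exp (2 / h * ell u x) + exp ((- (2 / h)) * ell u x)))"
        by (simp add: H_def distrib_left exp_add add_nonneg_nonneg mult_ac)
    qed
  qed (simp add: H_def[abs_def])
  define L where "L = (\<integral>x. H x \<partial>\<nu>)"
  \<comment> \<open>\<open>D\<close> measures the failure of the formula. The increment of the
    integral of \<open>g\<close> under the shift by epsilon u is expanded twice, with
    \<open>g'\<close> through \<open>rem\<close> and with \<open>ell u\<close> through
    \<open>cm_density\<close>; the comparison gives |D| = O(epsilon).\<close>
  define D where "D = (\<integral>x. g' x \<partial>\<nu>) - (1 / h) *\<^sub>R (\<integral>x. ell u x *\<^sub>R g x \<partial>\<nu>)"
  have g_int: "integrable \<nu> g" by (rule bounded_int) (simp_all add: bd)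
  have D_le: "norm D \<le> (K + C * L) * \<epsilon>" if \<epsilon>: "0 < \<epsilon>" "\<epsilon> \<le> 1" for \<epsilon>
  proof -
    let ?s = "\<lambda>x. g (J (\<epsilon> *\<^sub>R u) + x)"
    have s_int: "integrable \<nu> ?s" by (rule bounded_int) (simp_all add: bd)
    have "norm (\<integral>x. ?s x - g x - \<epsilon> *\<^sub>R g' x \<partial>\<nu>) \<le> (\<integral>x. norm (?s x - g x - \<epsilon> *\<^sub>R g' x) \<partial>\<nu>)"
      by (rule integral_norm_bound)
    also have "\<dots> \<le> (\<integral>x. K * \<epsilon>\<^sup>2 \<partial>\<nu>)"
      by (rule integral_mono_AE) (use s_int g_int g' rem[OF \<epsilon>(1)] in auto)
    finally have "norm (\<integral>x. ?s x - g x - \<epsilon> *\<^sub>R g' x \<partial>\<nu>) \<le> K * \<epsilon>\<^sup>2" by (simp add: prob_space[unfolded space_nu])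
    then have 1: "norm ((\<integral>x. ?s x \<partial>\<nu>) - (\<integral>x. g x \<partial>\<nu>) - \<epsilon> *\<^sub>R (\<integral>x. g' x \<partial>\<nu>)) \<le> K * \<epsilon>\<^sup>2"
      using s_int g_int g' by simp
    define r where "r x = cm_density (\<epsilon> *\<^sub>R u) x - 1 - (\<epsilon> / h) * ell u x" for x
    have r_int: "integrable \<nu> r"
      unfolding r_def by (intro Bochner_Integration.integrable_diff cm_density_integrable integrable_mult_right ell_int) simp
    have "norm (\<integral>x. r x *\<^sub>R g x \<partial>\<nu>) \<le> (\<integral>x. norm (r x *\<^sub>R g x) \<partial>\<nu>)" by (rule integral_norm_bound)
    also have "\<dots> \<le> (\<integral>x. (C * \<epsilon>\<^sup>2) * H x \<partial>\<nu>)"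
    proof (rule integral_mono_AE)
      show "integrable \<nu> (\<lambda>x. norm (r x *\<^sub>R g x))" by (intro integrable_norm mult_int r_int)
      show "integrable \<nu> (\<lambda>x. (C * \<epsilon>\<^sup>2) * H x)" by (intro integrable_mult_right H_int)
      show "AE x in \<nu>. norm (r x *\<^sub>R g x) \<le> (C * \<epsilon>\<^sup>2) * H x"
        using ell_scaleR[of \<epsilon> u]
      proof eventually_elim
        case (elim x)
        have "r x = exp (\<epsilon> * (ell u x / h) - \<epsilon>\<^sup>2 * q) - 1 - \<epsilon> * (ell u x / h)"
          using elim by (simp add: r_def cm_density_def q_def power_mult_distrib)
        then have "\<bar>r x\<bar> \<le> \<epsilon>\<^sup>2 * H x" using exp_second_order[OF \<epsilon> q, of "ell u x / h"] by (simp add: H_def)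
        then have "\<bar>r x\<bar> * norm (g x) \<le> (\<epsilon>\<^sup>2 * H x) * C" by (intro mult_mono bd) (auto simp: H_def)
        then show ?case by (simp add: mult_ac)
      qed
    qed
    finally have 2: "norm (\<integral>x. r x *\<^sub>R g x \<partial>\<nu>) \<le> C * \<epsilon>\<^sup>2 * L" by (simp add: L_def)
    have "(\<integral>x. r x *\<^sub>R g x \<partial>\<nu>) = (\<integral>x. ?s x \<partial>\<nu>) - (\<integral>x. g x \<partial>\<nu>) - (\<epsilon> / h) *\<^sub>R (\<integral>x. ell u x *\<^sub>R g x \<partial>\<nu>)"
    proof -
      have i1: "integrable \<nu> (\<lambda>x. cm_density (\<epsilon> *\<^sub>R u) x *\<^sub>R g x)" by (rule mult_int[OF cm_density_integrable])
      have i2: "integrable \<nu> (\<lambda>x. (\<epsilon> / h) *\<^sub>R (ell u x *\<^sub>R g x))" using ell_g by (rule integrable_scaleR_right)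
      have "r x *\<^sub>R g x = (cm_density (\<epsilon> *\<^sub>R u) x *\<^sub>R g x - g x) - (\<epsilon> / h) *\<^sub>R (ell u x *\<^sub>R g x)" for x
        by (simp add: r_def scaleR_diff_left)
      then have "(\<integral>x. r x *\<^sub>R g x \<partial>\<nu>) = (\<integral>x. (cm_density (\<epsilon> *\<^sub>R u) x *\<^sub>R g x - g x) - (\<epsilon> / h) *\<^sub>R (ell u x *\<^sub>R g x) \<partial>\<nu>)"
        by simp
      also have "\<dots> = (\<integral>x. cm_density (\<epsilon> *\<^sub>R u) x *\<^sub>R g x \<partial>\<nu>) - (\<integral>x. g x \<partial>\<nu>) - (\<epsilon> / h) *\<^sub>R (\<integral>x. ell u x *\<^sub>R g x \<partial>\<nu>)"
        by (simp only: Bochner_Integration.integral_diff[OF Bochner_Integration.integrable_diff[OF i1 g_int] i2]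
            Bochner_Integration.integral_diff[OF i1 g_int] integral_scaleR_right)
      finally show ?thesis by (simp only: integral_shift[OF assms(1)])
    qed
    then have "\<epsilon> *\<^sub>R D = (\<integral>x. r x *\<^sub>R g x \<partial>\<nu>) - ((\<integral>x. ?s x \<partial>\<nu>) - (\<integral>x. g x \<partial>\<nu>) - \<epsilon> *\<^sub>R (\<integral>x. g' x \<partial>\<nu>))"
      by (simp add: D_def scaleR_diff_right)
    then have "norm (\<epsilon> *\<^sub>R D) \<le> C * \<epsilon>\<^sup>2 * L + K * \<epsilon>\<^sup>2" using norm_triangle_ineq4 1 2 by (smt (verit))
    then have "\<epsilon> * norm D \<le> \<epsilon> * ((K + C * L) * \<epsilon>)" using \<epsilon> by (simp add: power2_eq_square algebra_simps)
    then show ?thesis using \<epsilon>(1) by simp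
  qed
  have "norm D \<le> 0"
  proof (rule LIMSEQ_le[OF tendsto_const])
    show "(\<lambda>n. (K + C * L) * (1 / real (Suc n))) \<longlonglongrightarrow> 0"
      by (rule tendsto_mult_right_zero[OF LIMSEQ_Suc[OF lim_1_over_n]])
    show "\<exists>N. \<forall>n\<ge>N. norm D \<le> (K + C * L) * (1 / real (Suc n))"
      by (intro exI allI impI D_le) auto
  qed
  then have "(\<integral>x. g' x \<partial>\<nu>) = (1 / h) *\<^sub>R (\<integral>x. ell u x *\<^sub>R g x \<partial>\<nu>)" by (simp add: D_def)
  then show "(\<integral>x. ell u x *\<^sub>R g x \<partial>\<nu>) = h *\<^sub>R (\<integral>x. g' x \<partial>\<nu>)" using h by simp
qed

end

section \<open>The heat operator as an exponential\<close>

lemma has_vector_derivative_quadratic: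
  fixes \<phi> :: "real \<Rightarrow> 'a::real_normed_vector"
  assumes "\<And>s. norm (\<phi> s - \<phi> r - (s - r) *\<^sub>R d) \<le> K * (s - r)\<^sup>2"
  shows "(\<phi> has_vector_derivative d) (at r)"
proof -
  have "((\<lambda>s. norm (\<phi> (r + s) - \<phi> r - s *\<^sub>R d) / norm s) \<longlongrightarrow> 0) (at 0)"
  proof (rule tendsto_sandwich[where f = "\<lambda>_. 0" and h = "\<lambda>s. K * \<bar>s\<bar>"])
    have "norm (\<phi> (r + s) - \<phi> r - s *\<^sub>R d) / norm s \<le> K * \<bar>s\<bar>" if "s \<noteq> 0" for s
      using assms[of "r + s"] that by (simp add: divide_le_eq power2_eq_square mult.assoc)
    then show "\<forall>\<^sub>F s in at 0. norm (\<phi> (r + s) - \<phi> r - s *\<^sub>R d) / norm s \<le> K * \<bar>s\<bar>"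
      by (simp add: eventually_at_filter)
    have "((\<lambda>s. K * \<bar>s\<bar>) \<longlongrightarrow> K * \<bar>0\<bar>) (at (0 :: real))" by (intro tendsto_intros)
    then show "((\<lambda>s. K * \<bar>s\<bar>) \<longlongrightarrow> 0) (at (0 :: real))" by simp
  qed (simp_all add: eventually_at_filter)
  then show ?thesis
    unfolding has_vector_derivative_def has_derivative_at
    by (simp add: bounded_linear_scaleR_left)
qed

lemma ennreal_le_sqrt_of_square_le:
  fixes x :: ennreal
  assumes "x\<^sup>2 \<le> ennreal B" "0 \<le> B"
  shows "x \<le> ennreal (sqrt B)"
proof (rule ccontr)
  assume "\<not> ?thesis"
  then have lt: "ennreal (sqrt B) < x" by simp
  have "x < \<top>"
  proof (rule ccontr)
    assume "\<not> x < \<top>"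
    then have "x = \<top>" using less_top by blast
    then show False using assms by (simp add: ennreal_top_eq_mult_iff power2_eq_square top_unique)
  qed
  then obtain r where r: "r \<ge> 0" "x = ennreal r" by (cases x) auto
  then have "r\<^sup>2 \<le> B" using assms by (simp add: ennreal_power)
  moreover have "sqrt B < r" using lt r assms(2) by (simp add: ennreal_less_iff)
  ultimately show False using assms(2) by (smt (verit) real_le_rsqrt)
qed

lemma norm_diff_square_le:
  fixes a b c :: "'a::real_inner"
  shows "(norm (a - b))\<^sup>2 \<le> 2 * (norm (a - c))\<^sup>2 + 2 * (norm (b - c))\<^sup>2"
proof -
  have "norm (a - b) \<le> norm (a - c) + norm (b - c)" using norm_triangle_ineq4[of "a - c" "b - c"] by simp
  then have "(norm (a - b))\<^sup>2 \<le> (norm (a - c) + norm (b - c))\<^sup>2" by (intro power_mono) auto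
  also have "\<dots> \<le> 2 * (norm (a - c))\<^sup>2 + 2 * (norm (b - c))\<^sup>2"
    using zero_le_power2[of "norm (a - c) - norm (b - c)"] by (simp add: power2_sum power2_diff)
  finally show ?thesis .
qed

text \<open>Selfadjointness moves T to the basis: for a projection Y the coordinates of T Y are the
  Gaussian variables Y . T e_j.\<close>

locale heat_setting = wiener_space J \<nu> h + form_laplacian T Q e + hilbert_sequence e
  for J :: "'v::{real_inner, banach, second_countable_topology} \<Rightarrow>\<^sub>L 'b::{real_normed_vector, second_countable_topology}"
    and \<nu> h and T :: "'v \<Rightarrow>\<^sub>L 'v" and Q e +
  assumes selfadj: "selfadjoint_op T"
begin

abbreviation proj :: "'v set \<Rightarrow> 'b \<Rightarrow> 'v" where "proj \<equiv> proj_extension J \<nu>"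

lemma proj_measurable [measurable]: "proj U \<in> borel_measurable \<nu>"
  unfolding proj_extension_def by measurable

lemma T_measurable [measurable (raw)]:
  "Y \<in> borel_measurable M \<Longrightarrow> (\<lambda>x. T (Y x)) \<in> borel_measurable M"
  by (rule measurable_compose[OF _ borel_measurable_continuous_onI[OF linear_continuous_on[OF blinfun.bounded_linear_right]]])

lemma proj_inner:
  assumes "finite U"
  shows "AE x in \<nu>. proj U x \<bullet> v = ell (ortho_proj U v) x"
  using ell_sum[OF assms, of "\<lambda>u. v \<bullet> u" "\<lambda>u. u"]
  by eventually_elim (simp add: proj_extension_def ortho_proj_def inner_sum_left inner_commute[of v] mult.commute)

lemma proj_shift:
  assumes "finite U"
  shows "AE x in \<nu>. proj U (J X + x) = ortho_proj U X + proj U x"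
proof -
  have "AE x in \<nu>. \<forall>u\<in>U. ell u (J X + x) = u \<bullet> X + ell u x"
    using assms by (intro AE_finite_allI ell_shift)
  then show ?thesis
    by eventually_elim
      (simp add: proj_extension_def ortho_proj_def scaleR_add_left sum.distrib inner_commute cong: sum.cong)
qed

text \<open>The squared Hilbert-Schmidt norm of (pi_U - 1) T, which controls how far F o pi_U is
  from its stochastic extension.\<close>

definition defect :: "'v set \<Rightarrow> real" where
  "defect U = (\<Sum>j. (norm (ortho_proj U (T (e j)) - T (e j)))\<^sup>2)"

lemma defect_term_le:
  assumes "finite U" "orthonormal U"
  shows "(norm (ortho_proj U (T (e j)) - T (e j)))\<^sup>2 \<le> (norm (T (e j)))\<^sup>2"
  using norm_ortho_proj_residual_le[OF assms span_zero, of "T (e j)"]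
  by (intro power_mono) (simp_all add: norm_minus_commute)

lemma defect_summable:
  assumes "finite U" "orthonormal U"
  shows "summable (\<lambda>j. (norm (ortho_proj U (T (e j)) - T (e j)))\<^sup>2)"
  by (rule summable_comparison_test'[OF summable_form, of 0]) (use defect_term_le[OF assms] in auto)

lemma defect_nonneg: "finite U \<Longrightarrow> orthonormal U \<Longrightarrow> 0 \<le> defect U"
  unfolding defect_def by (intro suminf_nonneg defect_summable) auto

text \<open>Tannery's theorem: each term tends to 0 and is dominated by |T e_j|^2.\<close>

lemma defect_tendsto:
  assumes U: "\<And>n. finite (U n)" "\<And>n. orthonormal (U n)"
    and inc: "incseq (\<lambda>n. span (U n))" and dn: "closure (\<Union>n. span (U n)) = UNIV"
  shows "(\<lambda>n. defect (U n)) \<longlonglongrightarrow> 0"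
proof -
  have "(\<lambda>n. \<Sum>j. (norm (ortho_proj (U n) (T (e j)) - T (e j)))\<^sup>2) \<longlonglongrightarrow> (\<Sum>j. 0)"
  proof (rule tannerys_theorem[THEN conjunct2, THEN conjunct2])
    show "(\<lambda>n. (norm (ortho_proj (U n) (T (e j)) - T (e j)))\<^sup>2) \<longlonglongrightarrow> 0" for j
    proof -
      have "(\<lambda>n. (norm (ortho_proj (U n) (T (e j)) - T (e j)))\<^sup>2) \<longlonglongrightarrow> (norm (T (e j) - T (e j)))\<^sup>2"
        by (intro tendsto_intros ortho_proj_tendsto U inc dn)
      then show ?thesis by simp
    qed
    show "\<forall>\<^sub>F (j, n) in at_top \<times>\<^sub>F sequentially.
        norm ((norm (ortho_proj (U n) (T (e j)) - T (e j)))\<^sup>2) \<le> (norm (T (e j)))\<^sup>2"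
      using defect_term_le[OF U] by (intro always_eventually) auto
  qed (simp_all add: summable_form)
  then show ?thesis by (simp add: defect_def)
qed

lemma basis_defect_tendsto: "(\<lambda>n. defect (basis n)) \<longlonglongrightarrow> 0"
  by (rule defect_tendsto[OF finite_basis orthonormal_basis incseq_basis closure_span_basis])

text \<open>Parseval in the basis \<open>e\<close>, Tonelli, and the second moment h |d|^2 of
  \<open>ell d\<close>.\<close>

lemma nn_norm_T:
  assumes [measurable]: "Y \<in> borel_measurable \<nu>"
    and ae: "\<And>j. AE x in \<nu>. Y x \<bullet> T (e j) = ell (d j) x"
    and sm: "summable (\<lambda>j. (norm (d j))\<^sup>2)"
  shows "(\<integral>\<^sup>+x. ennreal ((norm (T (Y x)))\<^sup>2) \<partial>\<nu>) = ennreal (h * (\<Sum>j. (norm (d j))\<^sup>2))"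
proof -
  have "ennreal ((norm (T (Y x)))\<^sup>2) = (\<Sum>j. ennreal ((Y x \<bullet> T (e j))\<^sup>2))" for x
  proof -
    have "(\<lambda>j. (Y x \<bullet> T (e j))\<^sup>2) sums (norm (T (Y x)))\<^sup>2"
      using parseval[of "T (Y x)"] selfadj[unfolded selfadjoint_op_def] by simp
    then show ?thesis by (rule suminf_ennreal_eq[symmetric, rotated]) simp
  qed
  then have "(\<integral>\<^sup>+x. ennreal ((norm (T (Y x)))\<^sup>2) \<partial>\<nu>) = (\<integral>\<^sup>+x. (\<Sum>j. ennreal ((Y x \<bullet> T (e j))\<^sup>2)) \<partial>\<nu>)"
    by simp
  also have "\<dots> = (\<Sum>j. \<integral>\<^sup>+x. ennreal ((Y x \<bullet> T (e j))\<^sup>2) \<partial>\<nu>)"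
    by (rule nn_integral_suminf) measurable
  also have "\<dots> = (\<Sum>j. ennreal (h * (norm (d j))\<^sup>2))"
  proof (intro suminf_cong)
    fix j
    have "(\<integral>\<^sup>+x. ennreal ((Y x \<bullet> T (e j))\<^sup>2) \<partial>\<nu>) = (\<integral>\<^sup>+x. ennreal ((ell (d j) x)\<^sup>2) \<partial>\<nu>)"
      by (rule nn_integral_cong_AE) (use ae[of j] in eventually_elim, simp)
    then show "(\<integral>\<^sup>+x. ennreal ((Y x \<bullet> T (e j))\<^sup>2) \<partial>\<nu>) = ennreal (h * (norm (d j))\<^sup>2)"
      using gauss_square(3)[OF ell_gauss, of "d j"] h by (simp add: power_mult_distrib)
  qed
  also have "\<dots> = ennreal (h * (\<Sum>j. (norm (d j))\<^sup>2))"
    using h by (intro suminf_ennreal_eq sums_mult summable_sums sm) auto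
  finally show ?thesis .
qed

text \<open>The coordinates are \<open>ell\<close> of (pi_U - pi_U') T e_j; comparing both
  projections with T e_j itself brings in the two defects.\<close>

lemma proj_diff_L2:
  assumes U: "finite U" "orthonormal U" and U': "finite U'" "orthonormal U'"
  shows "(\<integral>\<^sup>+x. ennreal ((norm (T (proj U x - proj U' x)))\<^sup>2) \<partial>\<nu>) \<le> ennreal (h * (2 * defect U + 2 * defect U'))"
proof -
  define d where "d j = ortho_proj U (T (e j)) - ortho_proj U' (T (e j))" for j
  note s = defect_summable[OF U] defect_summable[OF U']
  have le: "(norm (d j))\<^sup>2 \<le> 2 * (norm (ortho_proj U (T (e j)) - T (e j)))\<^sup>2 + 2 * (norm (ortho_proj U' (T (e j)) - T (e j)))\<^sup>2" for j
    unfolding d_def by (rule norm_diff_square_le)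
  have s2: "summable (\<lambda>j. 2 * (norm (ortho_proj U (T (e j)) - T (e j)))\<^sup>2 + 2 * (norm (ortho_proj U' (T (e j)) - T (e j)))\<^sup>2)"
    by (intro summable_add summable_mult s)
  have sm: "summable (\<lambda>j. (norm (d j))\<^sup>2)"
    by (rule summable_comparison_test'[OF s2, of 0]) (use le in auto)
  have "(\<integral>\<^sup>+x. ennreal ((norm (T (proj U x - proj U' x)))\<^sup>2) \<partial>\<nu>) = ennreal (h * (\<Sum>j. (norm (d j))\<^sup>2))"
  proof (rule nn_norm_T[OF _ _ sm])
    fix j
    show "AE x in \<nu>. (proj U x - proj U' x) \<bullet> T (e j) = ell (d j) x"
      using proj_inner[OF U(1), of "T (e j)"] proj_inner[OF U'(1), of "T (e j)"]
        ell_add_scaleR[of "ortho_proj U (T (e j))" "-1" "ortho_proj U' (T (e j))"]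
      by eventually_elim (simp add: d_def inner_diff_left)
  qed simp
  also have "(\<Sum>j. (norm (d j))\<^sup>2) \<le> (\<Sum>j. 2 * (norm (ortho_proj U (T (e j)) - T (e j)))\<^sup>2 + 2 * (norm (ortho_proj U' (T (e j)) - T (e j)))\<^sup>2)"
    by (intro suminf_le le sm s2)
  also have "\<dots> = 2 * defect U + 2 * defect U'"
    unfolding defect_def using s by (subst suminf_add[symmetric]) (auto simp: suminf_mult intro: summable_mult)
  finally show ?thesis using h by (simp add: ennreal_leI mult_left_mono)
qed

section \<open>Stochastic extensions of functions in \<open>S_space Q\<close>\<close>

lemma S_le_diff_le:
  assumes "S_le F C"
  shows "norm (F X - F Y) \<le> C * norm (T (X - Y))"
  using S_le_lipschitz[OF assms, of "[]" Y "X - Y"] by simp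

lemma S_le_continuous:
  assumes "S_le F C"
  shows "continuous_on UNIV F"
  using has_derivative_continuous[OF S_le_has_derivative[OF assms, of "[]"]]
  by (simp add: continuous_on_eq_continuous_at iter_deriv_Nil)

lemma S_le_measurable:
  assumes "S_le F C" and [measurable]: "Y \<in> borel_measurable \<nu>"
  shows "(\<lambda>x. F (Y x)) \<in> borel_measurable \<nu>"
  using borel_measurable_continuous_onI[OF S_le_continuous[OF assms(1)]] by measurable

lemma S_le_integrable:
  assumes "S_le F C" and "Y \<in> borel_measurable \<nu>"
  shows "integrable \<nu> (\<lambda>x. F (Y x))"
  by (rule integrable_const_bound[of _ C]) (use S_le_sup[OF assms(1)] S_le_measurable[OF assms] in auto)

lemma integral_norm_le_const:
  fixes f :: "'b \<Rightarrow> complex"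
  assumes "\<And>x. norm (f x) \<le> C" "f \<in> borel_measurable \<nu>"
  shows "norm (\<integral>x. f x \<partial>\<nu>) \<le> C"
proof -
  have "norm (\<integral>x. f x \<partial>\<nu>) \<le> (\<integral>x. norm (f x) \<partial>\<nu>)" by (rule integral_norm_bound)
  also have "\<dots> \<le> (\<integral>x. C \<partial>\<nu>)"
    using assms order_trans[OF norm_ge_zero assms(1)] by (intro integral_mono integrable_norm integrable_const_bound[of _ C]) auto
  finally show ?thesis using prob_space by simp
qed

text \<open>The Lipschitz bound for |T .|, then Cauchy-Schwarz against 1 on a probability
  space.\<close>

lemma proj_diff_L1:
  assumes F: "S_le F C" and U: "finite U" "orthonormal U" and U': "finite U'" "orthonormal U'"
  shows "(\<integral>\<^sup>+x. ennreal (norm (F (proj U x) - F (proj U' x))) \<partial>\<nu>)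
    \<le> ennreal (C * sqrt (h * (2 * defect U + 2 * defect U')))"
proof -
  let ?B = "h * (2 * defect U + 2 * defect U')"
  have B: "?B \<ge> 0" using h defect_nonneg[OF U] defect_nonneg[OF U'] by simp
  have C: "C \<ge> 0" by (rule S_le_nonneg[OF F])
  let ?n = "\<lambda>x. ennreal (norm (T (proj U x - proj U' x)))"
  have "(\<integral>\<^sup>+x. ?n x * 1 \<partial>\<nu>)\<^sup>2 \<le> (\<integral>\<^sup>+x. (?n x)\<^sup>2 \<partial>\<nu>) * (\<integral>\<^sup>+x. 1\<^sup>2 \<partial>\<nu>)"
    by (rule Cauchy_Schwarz_nn_integral) simp_all
  also have "\<dots> \<le> ennreal ?B"
    using proj_diff_L2[OF U U'] emeasure_space_1 by (simp add: ennreal_power)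
  finally have "(\<integral>\<^sup>+x. ?n x \<partial>\<nu>) \<le> ennreal (sqrt ?B)"
    by (intro ennreal_le_sqrt_of_square_le B) simp
  then have le: "ennreal C * (\<integral>\<^sup>+x. ?n x \<partial>\<nu>) \<le> ennreal C * ennreal (sqrt ?B)" by (rule mult_left_mono) simp
  have "(\<integral>\<^sup>+x. ennreal (norm (F (proj U x) - F (proj U' x))) \<partial>\<nu>) \<le> (\<integral>\<^sup>+x. ennreal C * ?n x \<partial>\<nu>)"
    using S_le_diff_le[OF F] C by (intro nn_integral_mono) (simp add: ennreal_mult[symmetric])
  also have "\<dots> = ennreal C * (\<integral>\<^sup>+x. ?n x \<partial>\<nu>)" by (rule nn_integral_cmult) simp
  also note le
  also have "ennreal C * ennreal (sqrt ?B) = ennreal (C * sqrt ?B)" using C B by (simp only: ennreal_mult real_sqrt_ge_zero)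
  finally show ?thesis .
qed

text \<open>Along \<open>basis n\<close> the functions are Cauchy in L^1, and \<open>G\<close> is
  the almost everywhere limit of a subsequence. Any other sequence of subspaces is compared with
  this one through the defects and Fatou's lemma, so it has the same limit.\<close>

lemma stochastic_extension_exists:
  assumes F: "S_le F C"
  shows "\<exists>G. stochastic_extension J \<nu> F G"
proof -
  have C: "C \<ge> 0" by (rule S_le_nonneg[OF F])
  have int: "integrable \<nu> (\<lambda>x. F (proj U x))" for U by (rule S_le_integrable[OF F]) simp
  note meas [measurable] = borel_measurable_integrable[OF int]
  note onb = finite_basis orthonormal_basis
  obtain r where r: "strict_mono r" "AE x in \<nu>. Cauchy (\<lambda>k. F (proj (basis (r k)) x))"
  proof (rule cauchy_L1_AE_cauchy_subseq[of \<nu> "\<lambda>n x. F (proj (basis n) x)"])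
    fix \<epsilon> :: real assume "\<epsilon> > 0"
    \<comment> \<open>Chosen so that C sqrt (4 h delta) = C epsilon / (2 (C + 1)) < epsilon.\<close>
    define \<delta> where "\<delta> = (\<epsilon> / (2 * (C + 1)))\<^sup>2 / (4 * h)"
    have \<delta>: "\<delta> > 0" using \<open>\<epsilon> > 0\<close> C h by (simp add: \<delta>_def add_nonneg_pos)
    obtain N where N: "\<And>n. n \<ge> N \<Longrightarrow> defect (basis n) < \<delta>"
      using order_tendstoD(2)[OF basis_defect_tendsto \<delta>] by (auto simp: eventually_sequentially)
    show "\<exists>N. \<forall>i\<ge>N. \<forall>j\<ge>N. (\<integral>x. norm (F (proj (basis i) x) - F (proj (basis j) x)) \<partial>\<nu>) < \<epsilon>"
    proof (intro exI allI impI)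
      fix i j assume ij: "i \<ge> N" "j \<ge> N"
      let ?B = "h * (2 * defect (basis i) + 2 * defect (basis j))"
      have "ennreal (\<integral>x. norm (F (proj (basis i) x) - F (proj (basis j) x)) \<partial>\<nu>) \<le> ennreal (C * sqrt ?B)"
        using proj_diff_L1[OF F onb onb, of i j] nn_integral_eq_integral[of \<nu> "\<lambda>x. norm (F (proj (basis i) x) - F (proj (basis j) x))"]
          int by simp
      moreover have B: "0 \<le> ?B" using h defect_nonneg[OF onb] by simp
      ultimately have "(\<integral>x. norm (F (proj (basis i) x) - F (proj (basis j) x)) \<partial>\<nu>) \<le> C * sqrt ?B"
        using C by (subst (asm) ennreal_le_iff) auto
      also have "sqrt ?B \<le> \<epsilon> / (2 * (C + 1))"
      proof (rule real_le_lsqrt)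
        have "?B \<le> h * (4 * \<delta>)" using h N[OF ij(1)] N[OF ij(2)] by (intro mult_left_mono) auto
        then show "?B \<le> (\<epsilon> / (2 * (C + 1)))\<^sup>2" using h by (simp add: \<delta>_def)
      qed (use C \<open>\<epsilon> > 0\<close> in auto)
      then have "C * sqrt ?B \<le> C * (\<epsilon> / (2 * (C + 1)))" using C by (rule mult_left_mono)
      also have "\<dots> < \<epsilon>" using C \<open>\<epsilon> > 0\<close> by (simp add: field_simps add_nonneg_pos)
      finally show "(\<integral>x. norm (F (proj (basis i) x) - F (proj (basis j) x)) \<partial>\<nu>) < \<epsilon>" .
    qed
  qed (rule int, blast)
  define G where "G x = lim (\<lambda>k. F (proj (basis (r k)) x))" for x
  have [measurable]: "G \<in> borel_measurable \<nu>"
    unfolding G_def by (rule borel_measurable_lim_metric) simp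
  have conv: "AE x in \<nu>. (\<lambda>k. F (proj (basis (r k)) x)) \<longlonglongrightarrow> G x"
    using r(2) by eventually_elim (simp add: G_def Cauchy_convergent_iff convergent_LIMSEQ_iff)
  have "integrable \<nu> G"
  proof (rule integrable_const_bound[of _ C])
    show "AE x in \<nu>. norm (G x) \<le> C"
      using conv by eventually_elim (rule Lim_bounded[OF tendsto_norm], auto intro: S_le_sup[OF F])
  qed simp
  moreover have "(\<lambda>n. \<integral>\<^sup>+x. ennreal (norm (F (proj (U n) x) - G x)) \<partial>\<nu>) \<longlonglongrightarrow> 0"
    if U: "\<And>n. finite (U n)" "\<And>n. orthonormal (U n)" and inc: "incseq (\<lambda>n. span (U n))"
      and dn: "closure (\<Union>n. span (U n)) = UNIV" for U :: "nat \<Rightarrow> 'v set"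
  proof -
    have le: "(\<integral>\<^sup>+x. ennreal (norm (F (proj (U n) x) - G x)) \<partial>\<nu>) \<le> ennreal (C * sqrt (h * (2 * defect (U n))))" for n
    proof -
      have "(\<integral>\<^sup>+x. ennreal (norm (F (proj (U n) x) - G x)) \<partial>\<nu>)
          = (\<integral>\<^sup>+x. liminf (\<lambda>k. ennreal (norm (F (proj (U n) x) - F (proj (basis (r k)) x)))) \<partial>\<nu>)"
      proof (rule nn_integral_cong_AE)
        show "AE x in \<nu>. ennreal (norm (F (proj (U n) x) - G x))
            = liminf (\<lambda>k. ennreal (norm (F (proj (U n) x) - F (proj (basis (r k)) x))))"
          using conv
        proof eventually_elim
          case (elim x)
          then have "(\<lambda>k. ennreal (norm (F (proj (U n) x) - F (proj (basis (r k)) x))))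
              \<longlonglongrightarrow> ennreal (norm (F (proj (U n) x) - G x))"
            by (intro tendsto_ennrealI tendsto_intros)
          from lim_imp_Liminf[OF _ this] show ?case by simp
        qed
      qed
      also have "\<dots> \<le> liminf (\<lambda>k. \<integral>\<^sup>+x. ennreal (norm (F (proj (U n) x) - F (proj (basis (r k)) x))) \<partial>\<nu>)"
        by (rule nn_integral_liminf) measurable
      also have "\<dots> \<le> liminf (\<lambda>k. ennreal (C * sqrt (h * (2 * defect (U n) + 2 * defect (basis (r k))))))"
        by (intro Liminf_mono always_eventually allI proj_diff_L1[OF F U onb])
      also have "\<dots> = ennreal (C * sqrt (h * (2 * defect (U n) + 2 * 0)))"
      proof (rule lim_imp_Liminf)
        have "(\<lambda>k. defect (basis (r k))) \<longlonglongrightarrow> 0"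
          using LIMSEQ_subseq_LIMSEQ[OF basis_defect_tendsto r(1)] by (simp add: o_def)
        then show "(\<lambda>k. ennreal (C * sqrt (h * (2 * defect (U n) + 2 * defect (basis (r k))))))
            \<longlonglongrightarrow> ennreal (C * sqrt (h * (2 * defect (U n) + 2 * 0)))"
          by (intro tendsto_ennrealI tendsto_intros)
      qed simp
      finally show ?thesis by simp
    qed
    have "(\<lambda>n. C * sqrt (h * (2 * defect (U n)))) \<longlonglongrightarrow> C * sqrt (h * (2 * 0))"
      by (intro tendsto_intros defect_tendsto U inc dn)
    then have lim: "(\<lambda>n. ennreal (C * sqrt (h * (2 * defect (U n))))) \<longlonglongrightarrow> 0"
      unfolding ennreal_0[symmetric] by (intro tendsto_ennrealI) simp
    show ?thesis
      by (rule tendsto_sandwich[OF _ _ tendsto_const lim]) (simp_all add: le)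
  qed
  ultimately have "stochastic_extension J \<nu> F G"
    unfolding stochastic_extension_def using int by (auto simp: fun_eq_iff)
  then show ?thesis by blast
qed

text \<open>
  By the Cameron-Martin formula, convergence almost everywhere of \<open>F (proj (basis n) x)\<close> to \<open>G x\<close> survives
  the translation \<open>x \<mapsto> J X + x\<close>.
\<close>
lemma stochastic_extension_average:
  assumes F: "S_le F C" and G: "stochastic_extension J \<nu> F G"
  obtains r where "strict_mono r"
    "(\<lambda>k. \<integral>x. F (ortho_proj (basis (r k)) X + proj (basis (r k)) x) \<partial>\<nu>) \<longlonglongrightarrow> (\<integral>x. G (J X + x) \<partial>\<nu>)"
proof -
  have int: "integrable \<nu> (\<lambda>x. F (proj U x))" for U by (rule S_le_integrable[OF F]) simp
  have G_int: "integrable \<nu> G" using G by (simp add: stochastic_extension_def)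
  note [measurable] = borel_measurable_integrable[OF int] borel_measurable_integrable[OF G_int]
  have "(\<lambda>n. \<integral>\<^sup>+x. ennreal (norm (F (proj (basis n) x) - G x)) \<partial>\<nu>) \<longlonglongrightarrow> 0"
  proof -
    have "(\<forall>n. finite (basis n) \<and> orthonormal (basis n) \<and> span (basis n) = span (basis n)) \<and>
        incseq (\<lambda>n. span (basis n)) \<and> closure (\<Union>n. span (basis n)) = UNIV"
      using finite_basis orthonormal_basis incseq_basis closure_span_basis by simp
    with G[unfolded stochastic_extension_def, THEN conjunct2, THEN spec[of _ "\<lambda>n. span (basis n)"], THEN spec[of _ basis]]
    show ?thesis by blast
  qed
  then have "(\<lambda>n. ennreal (\<integral>x. norm (F (proj (basis n) x) - G x) \<partial>\<nu>)) \<longlonglongrightarrow> 0"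
    using nn_integral_eq_integral[of \<nu> "\<lambda>x. norm (F (proj (basis n) x) - G x)" for n] int G_int by simp
  then have "(\<lambda>n. \<integral>x. norm (F (proj (basis n) x) - G x) \<partial>\<nu>) \<longlonglongrightarrow> 0"
    by (subst (asm) ennreal_tendsto_0_iff) auto
  then obtain r where r: "strict_mono r" "AE x in \<nu>. (\<lambda>k. F (proj (basis (r k)) x) - G x) \<longlonglongrightarrow> 0"
    using tendsto_L1_AE_subseq[of \<nu> "\<lambda>n x. F (proj (basis n) x) - G x"] int G_int by auto
  have "(\<lambda>k. \<integral>x. F (proj (basis (r k)) (J X + x)) \<partial>\<nu>) \<longlonglongrightarrow> (\<integral>x. G (J X + x) \<partial>\<nu>)"
  proof (rule integral_dominated_convergence[where w = "\<lambda>_. C"])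
    show "AE x in \<nu>. (\<lambda>k. F (proj (basis (r k)) (J X + x))) \<longlonglongrightarrow> G (J X + x)"
      using AE_shift[OF r(2), of X] by eventually_elim (rule LIM_zero_cancel)
  qed (use S_le_sup[OF F] in auto)
  moreover have "(\<integral>x. F (proj (basis (r k)) (J X + x)) \<partial>\<nu>)
      = (\<integral>x. F (ortho_proj (basis (r k)) X + proj (basis (r k)) x) \<partial>\<nu>)" for k
  proof (rule integral_cong_AE)
    show "AE x in \<nu>. F (proj (basis (r k)) (J X + x)) = F (ortho_proj (basis (r k)) X + proj (basis (r k)) x)"
      using proj_shift[OF finite_basis, of "r k" X] by eventually_elim simp
    show "(\<lambda>x. F (ortho_proj (basis (r k)) X + proj (basis (r k)) x)) \<in> borel_measurable \<nu>"
      by (rule S_le_measurable[OF F]) simp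
  qed simp
  ultimately show ?thesis using that r(1) by simp
qed

section \<open>Gaussian averages in finitely many coordinates\<close>

definition avg :: "nat \<Rightarrow> ('v \<Rightarrow> complex) \<Rightarrow> 'v \<Rightarrow> real \<Rightarrow> complex" where
  "avg n f X r = (\<integral>x. f (X + r *\<^sub>R proj (basis n) x) \<partial>\<nu>)"

lemma avg_le:
  assumes "S_le f C"
  shows "norm (avg n f X r) \<le> C"
  unfolding avg_def by (rule integral_norm_le_const) (use S_le_sup[OF assms] in \<open>auto intro!: S_le_measurable[OF assms]\<close>)

lemma avg_diff:
  assumes "S_le f C" "S_le g D"
  shows "avg n f X r - avg n g X r = avg n (\<lambda>X. f X - g X) X r"
  unfolding avg_def
  by (rule Bochner_Integration.integral_diff[symmetric]) (auto intro!: S_le_integrable[OF assms(1)] S_le_integrable[OF assms(2)])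

lemma ortho_proj_basis:
  assumes "j < n"
  shows "ortho_proj (basis n) (e j) = e j"
proof -
  have "ortho_proj (basis n) (e j) = (\<Sum>i<n. (e j \<bullet> e i) *\<^sub>R e i)"
    by (simp add: ortho_proj_def sum_basis)
  also have "\<dots> = (\<Sum>i<n. if i = j then e j else 0)"
  proof (intro sum.cong refl)
    fix i
    show "(e j \<bullet> e i) *\<^sub>R e i = (if i = j then e j else 0)"
      using ortho[of j i] unit[of j] by (cases "e j = 0") (auto simp: norm_eq_1)
  qed
  also have "\<dots> = e j" using assms by simp
  finally show ?thesis .
qed

lemma proj_basis: "proj (basis n) x = (\<Sum>j<n. ell (e j) x *\<^sub>R e j)"
  unfolding proj_extension_def by (simp add: sum_basis)

text \<open>For j < n the shift by epsilon e_j moves the argument by exactly epsilon r e_j, so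
  \<open>integration_by_parts\<close> applies with the derivative r d^2 f (e_j, e_j) and the error
  from \<open>S_le_remainder\<close>.\<close>

lemma avg_by_parts:
  assumes f: "S_le f C" and j: "j < n"
  shows "(\<integral>x. ell (e j) x *\<^sub>R iter_deriv f [e j] (X + r *\<^sub>R proj (basis n) x) \<partial>\<nu>)
      = (h * r) *\<^sub>R avg n (iter_deriv f [e j, e j]) X r"
    and "integrable \<nu> (\<lambda>x. ell (e j) x *\<^sub>R iter_deriv f [e j] (X + r *\<^sub>R proj (basis n) x))"
proof -
  define g where "g x = iter_deriv f [e j] (X + r *\<^sub>R proj (basis n) x)" for x
  define g' where "g' x = r *\<^sub>R iter_deriv f [e j, e j] (X + r *\<^sub>R proj (basis n) x)" for x
  have g_meas: "g \<in> borel_measurable \<nu>"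
    unfolding g_def by (rule S_le_measurable[OF S_le_iter[OF f]]) simp
  have g_bd: "norm (g x) \<le> C * wt [e j]" for x
    unfolding g_def by (rule S_le_bound[OF f])
  have g'_int: "integrable \<nu> g'"
    unfolding g'_def by (rule integrable_scaleR_right, rule S_le_integrable[OF S_le_iter[OF f]]) simp
  have rem: "AE x in \<nu>. norm (g (J (\<epsilon> *\<^sub>R e j) + x) - g x - \<epsilon> *\<^sub>R g' x)
      \<le> (C * r\<^sup>2 * (norm (T (e j)))\<^sup>2 * wt [e j]) * \<epsilon>\<^sup>2" for \<epsilon>
    using proj_shift[OF finite_basis, of n "\<epsilon> *\<^sub>R e j"]
  proof eventually_elim
    case (elim x)
    let ?Z = "X + r *\<^sub>R proj (basis n) x"
    have "ortho_proj (basis n) (\<epsilon> *\<^sub>R e j) = \<epsilon> *\<^sub>R ortho_proj (basis n) (e j)"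
      by (simp add: ortho_proj_def scaleR_sum_right)
    then have "X + r *\<^sub>R proj (basis n) (J (\<epsilon> *\<^sub>R e j) + x) = ?Z + (\<epsilon> * r) *\<^sub>R e j"
      using elim by (simp add: ortho_proj_basis[OF j] algebra_simps)
    then have "g (J (\<epsilon> *\<^sub>R e j) + x) = iter_deriv f [e j] (?Z + (\<epsilon> * r) *\<^sub>R e j)" by (simp only: g_def)
    moreover have "\<epsilon> *\<^sub>R g' x = iter_deriv f [(\<epsilon> * r) *\<^sub>R e j, e j] ?Z"
      using linear_scale[OF S_le_linear[OF f, of "[e j]" ?Z], of "\<epsilon> * r" "e j"] by (simp only: g'_def scaleR_scaleR)
    ultimately have "norm (g (J (\<epsilon> *\<^sub>R e j) + x) - g x - \<epsilon> *\<^sub>R g' x)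
        \<le> C * (norm (T ((\<epsilon> * r) *\<^sub>R e j)))\<^sup>2 * wt [e j]"
      using S_le_remainder[OF f, of "[e j]" ?Z "(\<epsilon> * r) *\<^sub>R e j"] by (simp only: g_def)
    also have "\<dots> = (C * r\<^sup>2 * (norm (T (e j)))\<^sup>2 * wt [e j]) * \<epsilon>\<^sup>2"
      by (simp add: blinfun.scaleR_right power_mult_distrib mult_ac)
    finally show ?case .
  qed
  note ibp = integration_by_parts[OF g_meas g_bd g'_int rem]
  show "(\<integral>x. ell (e j) x *\<^sub>R iter_deriv f [e j] (X + r *\<^sub>R proj (basis n) x) \<partial>\<nu>)
      = (h * r) *\<^sub>R avg n (iter_deriv f [e j, e j]) X r"
    using ibp(1) by (simp add: g_def g'_def avg_def del: iter_deriv.simps)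
  show "integrable \<nu> (\<lambda>x. ell (e j) x *\<^sub>R iter_deriv f [e j] (X + r *\<^sub>R proj (basis n) x))"
    using ibp(2) by (simp add: g_def del: iter_deriv.simps)
qed

text \<open>The chain rule gives df in the direction Z_n, the sum of the vectors ell e_j e_j.
  Integration by parts replaces each coefficient by h r times a derivative along e_j, and the 2
  compensates the 1/2 in \<open>lap_part\<close>. The quadratic error C (s - r)^2 |T Z_n|^2 is
  integrable, which justifies differentiation under the integral.\<close>

lemma avg_derivative:
  assumes f: "S_le f C"
  shows "(avg n f X has_vector_derivative (2 * h * r) *\<^sub>R avg n (lap_part n f) X r) (at r)"
proof -
  let ?Z = "proj (basis n)"
  \<comment> \<open>The projection for the empty set is 0, so \<open>proj_diff_L2\<close> bounds the
    second moment of T Z_n.\<close>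
  have empty: "finite {}" "orthonormal {}" by (auto simp: orthonormal_def)
  define V where "V = (\<integral>x. (norm (T (?Z x)))\<^sup>2 \<partial>\<nu>)"
  have V_int: "integrable \<nu> (\<lambda>x. (norm (T (?Z x)))\<^sup>2)"
  proof (rule integrableI_bounded)
    have "(\<integral>\<^sup>+x. ennreal (norm ((norm (T (?Z x)))\<^sup>2)) \<partial>\<nu>) \<le> ennreal (h * (2 * defect (basis n) + 2 * defect {}))"
      using proj_diff_L2[OF finite_basis orthonormal_basis empty, of n] by (simp add: proj_extension_def[of J \<nu> "{}"])
    from le_less_trans[OF this ennreal_less_top]
    show "(\<integral>\<^sup>+x. ennreal (norm ((norm (T (?Z x)))\<^sup>2)) \<partial>\<nu>) < \<infinity>" by simp
  qed simp
  define D where "D x = (\<Sum>j<n. ell (e j) x *\<^sub>R iter_deriv f [e j] (X + r *\<^sub>R ?Z x))" for x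
  have D: "D x = iter_deriv f [?Z x] (X + r *\<^sub>R ?Z x)" for x
    unfolding D_def proj_basis[of n x]
    using linear_sum[OF S_le_linear[OF f, of "[]"], of "\<lambda>j. ell (e j) x *\<^sub>R e j" "{..<n}"]
      linear_scale[OF S_le_linear[OF f, of "[]"]] by (simp del: iter_deriv.simps)
  have D_int: "integrable \<nu> D"
    unfolding D_def by (rule Bochner_Integration.integrable_sum) (rule avg_by_parts(2)[OF f], simp)
  have intD: "(\<integral>x. D x \<partial>\<nu>) = (2 * h * r) *\<^sub>R avg n (lap_part n f) X r"
  proof -
    have "(\<integral>x. D x \<partial>\<nu>) = (\<Sum>j<n. \<integral>x. ell (e j) x *\<^sub>R iter_deriv f [e j] (X + r *\<^sub>R ?Z x) \<partial>\<nu>)"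
      unfolding D_def by (rule Bochner_Integration.integral_sum) (rule avg_by_parts(2)[OF f], simp)
    also have "\<dots> = (\<Sum>j<n. (h * r) *\<^sub>R avg n (iter_deriv f [e j, e j]) X r)"
      by (intro sum.cong refl avg_by_parts(1)[OF f]) simp
    also have "\<dots> = (2 * h * r) *\<^sub>R (\<Sum>j<n. \<integral>x. iter_deriv f [e j, e j] (X + r *\<^sub>R ?Z x) /\<^sub>R 2 \<partial>\<nu>)"
      by (simp add: avg_def scaleR_sum_right del: iter_deriv.simps)
    also have "(\<Sum>j<n. \<integral>x. iter_deriv f [e j, e j] (X + r *\<^sub>R ?Z x) /\<^sub>R 2 \<partial>\<nu>) = avg n (lap_part n f) X r"
      unfolding avg_def lap_part_def
      by (rule Bochner_Integration.integral_sum[symmetric], rule integrable_scaleR_right, rule S_le_integrable[OF S_le_iter[OF f]]) simp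
    finally show ?thesis .
  qed
  have "norm (avg n f X s - avg n f X r - (s - r) *\<^sub>R (\<integral>x. D x \<partial>\<nu>)) \<le> (C * V) * (s - r)\<^sup>2" for s
  proof -
    have i1: "integrable \<nu> (\<lambda>x. f (X + t *\<^sub>R ?Z x))" for t by (rule S_le_integrable[OF f]) simp
    have i2: "integrable \<nu> (\<lambda>x. (s - r) *\<^sub>R D x)" using D_int by (rule integrable_scaleR_right)
    note i3 = Bochner_Integration.integrable_diff[OF i1[of s] i1[of r]]
    have "avg n f X s - avg n f X r - (s - r) *\<^sub>R (\<integral>x. D x \<partial>\<nu>)
        = (\<integral>x. f (X + s *\<^sub>R ?Z x) - f (X + r *\<^sub>R ?Z x) - (s - r) *\<^sub>R D x \<partial>\<nu>)"
      unfolding avg_def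
      by (simp only: Bochner_Integration.integral_diff[OF i3 i2] Bochner_Integration.integral_diff[OF i1 i1] integral_scaleR_right)
    also have "norm \<dots> \<le> (\<integral>x. norm (f (X + s *\<^sub>R ?Z x) - f (X + r *\<^sub>R ?Z x) - (s - r) *\<^sub>R D x) \<partial>\<nu>)"
      by (rule integral_norm_bound)
    also have "\<dots> \<le> (\<integral>x. (C * (s - r)\<^sup>2) * (norm (T (?Z x)))\<^sup>2 \<partial>\<nu>)"
    proof (rule integral_mono)
      show "integrable \<nu> (\<lambda>x. norm (f (X + s *\<^sub>R ?Z x) - f (X + r *\<^sub>R ?Z x) - (s - r) *\<^sub>R D x))"
        by (rule integrable_norm[OF Bochner_Integration.integrable_diff[OF i3 i2]])
      show "integrable \<nu> (\<lambda>x. (C * (s - r)\<^sup>2) * (norm (T (?Z x)))\<^sup>2)" by (rule integrable_mult_right[OF V_int])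
      fix x
      have "(s - r) *\<^sub>R D x = iter_deriv f [(s - r) *\<^sub>R ?Z x] (X + r *\<^sub>R ?Z x)"
        using linear_scale[OF S_le_linear[OF f, of "[]"]] by (simp add: D del: iter_deriv.simps)
      moreover have "X + r *\<^sub>R ?Z x + (s - r) *\<^sub>R ?Z x = X + s *\<^sub>R ?Z x" by (simp add: algebra_simps)
      moreover have "C * (norm (T ((s - r) *\<^sub>R ?Z x)))\<^sup>2 * wt [] = (C * (s - r)\<^sup>2) * (norm (T (?Z x)))\<^sup>2"
        by (simp add: blinfun.scaleR_right power_mult_distrib)
      ultimately show "norm (f (X + s *\<^sub>R ?Z x) - f (X + r *\<^sub>R ?Z x) - (s - r) *\<^sub>R D x) \<le> (C * (s - r)\<^sup>2) * (norm (T (?Z x)))\<^sup>2"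
        using S_le_remainder[OF f, of "[]" "X + r *\<^sub>R ?Z x" "(s - r) *\<^sub>R ?Z x"]
        by (simp only: iter_deriv_Nil)
    qed
    also have "\<dots> = (C * V) * (s - r)\<^sup>2" by (simp add: V_def)
    finally show ?thesis .
  qed
  then show ?thesis unfolding intD by (rule has_vector_derivative_quadratic)
qed

text \<open>
  \<open>r \<mapsto> \<Sum>\<^sub>k (h (1 - r\<^sup>2))\<^sup>k / k! avg n (lap\<^sup>k F) X r\<close> interpolates between \<open>heat_exp h F X\<close> at \<open>r = 0\<close> and the
  Gaussian average of \<open>F\<close> at \<open>r = 1\<close>; up to the truncation, its derivative only involves the
  difference of \<open>lap\<close> and \<open>lap_part n\<close>.
\<close>
lemma avg_heat_exp:
  assumes F: "S_le F C"
  shows "norm (avg n F X 1 - heat_exp h F X) \<le> 2 * h * half_trace_tail n * exp (h * half_trace) * C"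
proof -
  define M where "M = half_trace"
  have M: "M \<ge> 0" unfolding M_def by (rule half_trace_nonneg)
  have C: "C \<ge> 0" by (rule S_le_nonneg[OF F])
  define \<delta> where "\<delta> = half_trace_tail n"
  have \<delta>: "\<delta> \<ge> 0"
    unfolding \<delta>_def half_trace_tail_def
    by (intro divide_nonneg_nonneg suminf_nonneg summable_ignore_initial_segment[OF summable_form]) auto
  define f where "f k = (lap ^^ k) F" for k
  have f: "S_le (f k) (M ^ k * C)" for k unfolding f_def M_def by (rule S_le_lap_pow[OF F])
  \<comment> \<open>Coefficients of the exponential at the remaining time h (1 - r^2), as r Z_n
    accounts for variance h r^2. The series is truncated at K so that only finite sums are
    differentiated.\<close>
  define c where "c k r = (h * (1 - r\<^sup>2)) ^ k / fact k" for k and r :: real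
  define \<Phi> where "\<Phi> K r = (\<Sum>k<Suc K. c k r *\<^sub>R avg n (f k) X r)" for K r
  define \<Phi>' where "\<Phi>' K r = (2 * h * r) *\<^sub>R ((\<Sum>k<Suc K. c k r *\<^sub>R avg n (lap_part n (f k)) X r)
      - (\<Sum>k<K. c k r *\<^sub>R avg n (f (Suc k)) X r))" for K r
  have c_nonneg: "0 \<le> c k r" and c_le: "c k r \<le> h ^ k / fact k" if "0 \<le> r" "r \<le> 1" for k r
  proof -
    have r2: "0 \<le> 1 - r\<^sup>2" "1 - r\<^sup>2 \<le> 1" using that by (simp_all add: power_le_one)
    then show "0 \<le> c k r" using h by (simp add: c_def)
    have "(h * (1 - r\<^sup>2)) ^ k \<le> h ^ k" using r2 h by (intro power_mono) (auto simp: mult_le_cancel_left1)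
    then show "c k r \<le> h ^ k / fact k" by (simp add: c_def divide_right_mono)
  qed
  \<comment> \<open>Differentiation lowers k by one with the factor - 2 h r, opposite to the factor
    in \<open>avg_derivative\<close>, so both contributions can be paired.\<close>
  have c_deriv: "(c k has_vector_derivative (if k = 0 then 0 else - (2 * h * r) * c (k - 1) r)) (at r)" for k r
  proof (cases k)
    case 0
    then show ?thesis by (simp add: c_def[abs_def])
  next
    case (Suc m)
    have "((\<lambda>r. h * (1 - r\<^sup>2)) has_real_derivative h * (- (2 * r))) (at r)"
      by (auto intro!: derivative_eq_intros)
    from DERIV_cdivide[OF DERIV_power[OF this, of k], of "fact k"]
    have "(c k has_real_derivative real k * (h * (- (2 * r)) * (h * (1 - r\<^sup>2)) ^ (k - Suc 0)) / fact k) (at r)"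
      by (simp only: c_def[abs_def])
    moreover have "real k * (h * (- (2 * r)) * (h * (1 - r\<^sup>2)) ^ (k - Suc 0)) / fact k = - (2 * h * r) * c (k - 1) r"
      by (simp add: Suc c_def del: of_nat_Suc)
    ultimately show ?thesis by (simp add: Suc has_real_derivative_iff_has_vector_derivative)
  qed
  have deriv: "(\<Phi> K has_vector_derivative \<Phi>' K r) (at r)" for K r
  proof -
    define d where "d k = c k r *\<^sub>R ((2 * h * r) *\<^sub>R avg n (lap_part n (f k)) X r)
        + (if k = 0 then 0 else - (2 * h * r) * c (k - 1) r) *\<^sub>R avg n (f k) X r" for k
    have "(\<Phi> K has_vector_derivative (\<Sum>k<Suc K. d k)) (at r)"
      unfolding \<Phi>_def d_def
      by (intro has_vector_derivative_sum has_vector_derivative_scaleR avg_derivative[OF f])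
        (use c_deriv in \<open>simp add: has_real_derivative_iff_has_vector_derivative\<close>)
    also have "(\<Sum>k<Suc K. d k) = (\<Sum>k<Suc K. (2 * h * r) *\<^sub>R (c k r *\<^sub>R avg n (lap_part n (f k)) X r))
        + (\<Sum>k<Suc K. (if k = 0 then 0 else - (2 * h * r) * c (k - 1) r) *\<^sub>R avg n (f k) X r)"
      by (simp only: d_def sum.distrib scaleR_left_commute)
    also have "(\<Sum>k<Suc K. (if k = 0 then 0 else - (2 * h * r) * c (k - 1) r) *\<^sub>R avg n (f k) X r)
        = - ((2 * h * r) *\<^sub>R (\<Sum>k<K. c k r *\<^sub>R avg n (f (Suc k)) X r))"
      by (simp only: sum.lessThan_Suc_shift) (simp add: scaleR_sum_right sum_negf)
    finally show ?thesis by (simp only: \<Phi>'_def scaleR_sum_right scaleR_diff_right add_uminus_conv_diff)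
  qed
  have bound: "norm (\<Phi>' K r) \<le> 2 * h * (\<delta> * (exp (h * M) * C) + h ^ K / fact K * (M ^ Suc K * C))"
    if r: "0 \<le> r" "r \<le> 1" for K r
  proof -
    have lap_f: "lap (f k) = f (Suc k)" for k by (simp add: f_def)
    have term_le: "norm (c k r *\<^sub>R avg n (lap_part n (f k)) X r - c k r *\<^sub>R avg n (f (Suc k)) X r)
        \<le> (h * M) ^ k / fact k * (\<delta> * C)" for k
    proof -
      have "norm (avg n (lap_part n (f k)) X r - avg n (f (Suc k)) X r) \<le> \<delta> * (M ^ k * C)"
      proof -
        have "avg n (lap_part n (f k)) X r - avg n (f (Suc k)) X r = avg n (\<lambda>X. lap_part n (f k) X - lap (f k) X) X r"
          using avg_diff[OF S_le_lap_part[OF f] f, where n = n and X = X and r = r] by (simp only: lap_f)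
        also have "norm \<dots> \<le> \<delta> * (M ^ k * C)"
          unfolding avg_def \<delta>_def
        proof (rule integral_norm_le_const)
          show "(\<lambda>x. lap_part n (f k) (X + r *\<^sub>R proj (basis n) x) - lap (f k) (X + r *\<^sub>R proj (basis n) x)) \<in> borel_measurable \<nu>"
            by (intro borel_measurable_diff S_le_measurable[OF S_le_lap_part[OF f]] S_le_measurable[OF S_le_lap[OF f]]) simp_all
        qed (rule lap_part_diff[OF f])
        finally show ?thesis .
      qed
      then have "c k r * norm (avg n (lap_part n (f k)) X r - avg n (f (Suc k)) X r) \<le> h ^ k / fact k * (\<delta> * (M ^ k * C))"
        using c_nonneg[OF r] c_le[OF r] h by (intro mult_mono) auto
      then show ?thesis using c_nonneg[OF r] by (simp add: scaleR_diff_right[symmetric] power_mult_distrib mult_ac)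
    qed
    \<comment> \<open>Terms with equal coefficient are paired; the truncation leaves the term k = K
      unpaired, and its bound vanishes as K grows.\<close>
    have split: "(\<Sum>k<Suc K. c k r *\<^sub>R avg n (lap_part n (f k)) X r) - (\<Sum>k<K. c k r *\<^sub>R avg n (f (Suc k)) X r)
        = (\<Sum>k<Suc K. c k r *\<^sub>R avg n (lap_part n (f k)) X r - c k r *\<^sub>R avg n (f (Suc k)) X r) + c K r *\<^sub>R avg n (f (Suc K)) X r"
      by (simp add: sum_subtractf)
    have n1: "norm (\<Sum>k<Suc K. c k r *\<^sub>R avg n (lap_part n (f k)) X r - c k r *\<^sub>R avg n (f (Suc k)) X r) \<le> \<delta> * (exp (h * M) * C)"
    proof -
      have "norm (\<Sum>k<Suc K. c k r *\<^sub>R avg n (lap_part n (f k)) X r - c k r *\<^sub>R avg n (f (Suc k)) X r)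
          \<le> (\<Sum>k<Suc K. (h * M) ^ k / fact k * (\<delta> * C))"
        by (rule sum_norm_le) (rule term_le)
      also have "\<dots> \<le> (\<Sum>k. (h * M) ^ k / fact k * (\<delta> * C))"
        using h M \<delta> C by (intro sum_le_suminf sums_summable[OF exp_const_sums]) auto
      also have "\<dots> = exp (h * M) * (\<delta> * C)" by (rule sums_unique[OF exp_const_sums, symmetric])
      finally show ?thesis by (simp add: mult_ac)
    qed
    have n2: "norm (c K r *\<^sub>R avg n (f (Suc K)) X r) \<le> h ^ K / fact K * (M ^ Suc K * C)"
      using c_nonneg[OF r] c_le[OF r] avg_le[OF f, of n "Suc K" X r] h
      by (simp only: norm_scaleR abs_of_nonneg) (intro mult_mono; simp)
    have "norm ((\<Sum>k<Suc K. c k r *\<^sub>R avg n (lap_part n (f k)) X r) - (\<Sum>k<K. c k r *\<^sub>R avg n (f (Suc k)) X r))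
        \<le> \<delta> * (exp (h * M) * C) + h ^ K / fact K * (M ^ Suc K * C)"
      unfolding split by (rule norm_triangle_le[OF add_mono[OF n1 n2]])
    moreover have "2 * h * r \<le> 2 * h" using r h by simp
    ultimately show ?thesis
      unfolding \<Phi>'_def norm_scaleR using r h by (intro mult_mono) simp_all
  qed
  have \<Phi>1: "\<Phi> K 1 = avg n F X 1" for K
  proof -
    have "\<Phi> K 1 = (\<Sum>k<Suc K. if k = 0 then avg n F X 1 else 0)"
      unfolding \<Phi>_def by (intro sum.cong) (auto simp: c_def f_def)
    then show ?thesis by simp
  qed
  have \<Phi>0: "\<Phi> K 0 = (\<Sum>k<Suc K. (h ^ k / fact k) *\<^sub>R f k X)" for K
    using prob_space by (simp add: \<Phi>_def c_def avg_def)
  have "norm (avg n F X 1 - (\<Sum>k<Suc K. (h ^ k / fact k) *\<^sub>R f k X))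
      \<le> 2 * h * (\<delta> * (exp (h * M) * C) + h ^ K / fact K * (M ^ Suc K * C))" for K
  proof -
    have "norm (\<Phi> K 1 - \<Phi> K 0) \<le> 2 * h * (\<delta> * (exp (h * M) * C) + h ^ K / fact K * (M ^ Suc K * C))"
      by (rule segment_bound[where g' = "\<Phi>' K"]) (rule deriv, rule bound)
    then show ?thesis by (simp only: \<Phi>1 \<Phi>0)
  qed
  moreover have "(\<lambda>K. norm (avg n F X 1 - (\<Sum>k<Suc K. (h ^ k / fact k) *\<^sub>R f k X))) \<longlonglongrightarrow> norm (avg n F X 1 - heat_exp h F X)"
  proof -
    have "(\<lambda>k. (h ^ k / fact k) *\<^sub>R f k X) sums heat_exp h F X"
      using heat_exp_sums[OF F, of h "[]" X] by (simp add: f_def)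
    then have "(\<lambda>K. \<Sum>k<Suc K. (h ^ k / fact k) *\<^sub>R f k X) \<longlonglongrightarrow> heat_exp h F X"
      unfolding sums_def by (rule LIMSEQ_Suc)
    then show ?thesis by (intro tendsto_intros)
  qed
  moreover have "(\<lambda>K. 2 * h * (\<delta> * (exp (h * M) * C) + h ^ K / fact K * (M ^ Suc K * C))) \<longlonglongrightarrow> 2 * h * (\<delta> * (exp (h * M) * C) + 0)"
  proof -
    have "(\<lambda>K. (h * M) ^ K / fact K * (M * C)) \<longlonglongrightarrow> 0"
      by (rule summable_LIMSEQ_zero[OF sums_summable[OF exp_const_sums]])
    then have "(\<lambda>K. h ^ K / fact K * (M ^ Suc K * C)) \<longlonglongrightarrow> 0" by (simp add: power_mult_distrib mult_ac)
    then show ?thesis by (intro tendsto_intros)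
  qed
  ultimately have "norm (avg n F X 1 - heat_exp h F X) \<le> 2 * h * (\<delta> * (exp (h * M) * C) + 0)"
    using LIMSEQ_le by blast
  then show ?thesis by (simp add: \<delta>_def M_def mult_ac)
qed

lemma avg_tendsto:
  assumes F: "S_le F C"
  shows "(\<lambda>n. avg n F X 1) \<longlonglongrightarrow> heat_exp h F X"
proof (rule LIM_zero_cancel, rule Lim_null_comparison)
  show "\<forall>\<^sub>F n in sequentially. norm (avg n F X 1 - heat_exp h F X) \<le> 2 * h * half_trace_tail n * exp (h * half_trace) * C"
    by (intro always_eventually allI avg_heat_exp[OF F])
  have "(\<lambda>n. 2 * h * half_trace_tail n * exp (h * half_trace) * C) \<longlonglongrightarrow> 2 * h * 0 * exp (h * half_trace) * C"
    by (intro tendsto_intros half_trace_tail_tendsto)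
  then show "(\<lambda>n. 2 * h * half_trace_tail n * exp (h * half_trace) * C) \<longlonglongrightarrow> 0" by simp
qed

text \<open>The translated \<open>G\<close> is reached by averages around pi_n X. The Lipschitz
  bound replaces pi_n X by X, and these averages tend to the exponential along the full sequence, so
  the limit along the subsequence agrees.\<close>

lemma heat_integral_eq:
  assumes F: "S_le F C" and G: "stochastic_extension J \<nu> F G"
  shows "(\<integral>x. G (J X + x) \<partial>\<nu>) = heat_exp h F X"
proof -
  have lim: "(\<lambda>n. \<integral>x. F (ortho_proj (basis n) X + proj (basis n) x) \<partial>\<nu>) \<longlonglongrightarrow> heat_exp h F X"
  proof -
    have le: "norm ((\<integral>x. F (ortho_proj (basis n) X + proj (basis n) x) \<partial>\<nu>) - avg n F X 1)
        \<le> C * norm (T (ortho_proj (basis n) X - X))" for n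
    proof -
      have "(\<integral>x. F (ortho_proj (basis n) X + proj (basis n) x) \<partial>\<nu>) - avg n F X 1
          = (\<integral>x. F (ortho_proj (basis n) X + proj (basis n) x) - F (X + 1 *\<^sub>R proj (basis n) x) \<partial>\<nu>)"
        unfolding avg_def by (rule Bochner_Integration.integral_diff[symmetric]; rule S_le_integrable[OF F]; simp)
      also have "norm \<dots> \<le> C * norm (T (ortho_proj (basis n) X - X))"
      proof (rule integral_norm_le_const)
        show "norm (F (ortho_proj (basis n) X + proj (basis n) x) - F (X + 1 *\<^sub>R proj (basis n) x))
            \<le> C * norm (T (ortho_proj (basis n) X - X))" for x
          using S_le_diff_le[OF F, of "ortho_proj (basis n) X + proj (basis n) x" "X + proj (basis n) x"] by simp
        show "(\<lambda>x. F (ortho_proj (basis n) X + proj (basis n) x) - F (X + 1 *\<^sub>R proj (basis n) x)) \<in> borel_measurable \<nu>"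
          by (intro borel_measurable_diff S_le_measurable[OF F]) simp_all
      qed
      finally show ?thesis .
    qed
    have lim0: "(\<lambda>n. C * norm (T (ortho_proj (basis n) X - X))) \<longlonglongrightarrow> 0"
    proof -
      have "(\<lambda>n. C * norm (T (ortho_proj (basis n) X - X))) \<longlonglongrightarrow> C * norm (T (X - X))"
        by (intro tendsto_intros ortho_proj_tendsto finite_basis orthonormal_basis incseq_basis closure_span_basis)
      then show ?thesis by simp
    qed
    have "(\<lambda>n. (\<integral>x. F (ortho_proj (basis n) X + proj (basis n) x) \<partial>\<nu>) - avg n F X 1) \<longlonglongrightarrow> 0"
      by (rule Lim_null_comparison[OF _ lim0]) (intro always_eventually allI le)
    from tendsto_add[OF this avg_tendsto[OF F, of X]] show ?thesis by simp
  qed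
  obtain r where r: "strict_mono r"
    "(\<lambda>k. \<integral>x. F (ortho_proj (basis (r k)) X + proj (basis (r k)) x) \<partial>\<nu>) \<longlonglongrightarrow> (\<integral>x. G (J X + x) \<partial>\<nu>)"
    by (rule stochastic_extension_average[OF F G])
  from LIMSEQ_subseq_LIMSEQ[OF lim r(1)] r(2) show ?thesis
    by (intro LIMSEQ_unique) (auto simp: o_def)
qed

text \<open>The candidate derivatives are the exponentials of the derivatives of F. Being limits of
  averages, they inherit bound and remainder with the same C, where the series would give exp (h Tr
  A / 2) C; \<open>S_leI\<close> identifies them as derivatives.\<close>

lemma heat_exp_contraction:
  assumes F: "S_le F C"
  shows "S_le (heat_exp h F) C"
proof -
  define D where "D Vs = heat_exp h (iter_deriv F Vs)" for Vs
  note D = S_le_iter[OF F]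
  have lim: "(\<lambda>n. avg n (iter_deriv F Vs) X 1) \<longlonglongrightarrow> D Vs X" for Vs X
    unfolding D_def by (rule avg_tendsto[OF D])
  have "S_le (D []) C"
  proof (rule S_leI(2)[where K = C])
    show "0 \<le> C" by (rule S_le_nonneg[OF F])
    show "linear (\<lambda>Y. D (Y # Vs) X)" for Vs X
    proof (rule linearI)
      fix Y Z and c :: real
      have "iter_deriv F ((Y + Z) # Vs) = (\<lambda>X. 1 * iter_deriv F (Y # Vs) X + 1 * iter_deriv F (Z # Vs) X)"
        using linear_add[OF S_le_linear[OF F]] by (simp add: fun_eq_iff del: iter_deriv.simps)
      then show "D ((Y + Z) # Vs) X = D (Y # Vs) X + D (Z # Vs) X"
        using heat_exp_lincomb[OF D[of "Y # Vs"] D[of "Z # Vs"], of h 1 1] by (simp add: D_def del: iter_deriv.simps)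
      have "iter_deriv F ((c *\<^sub>R Y) # Vs) = (\<lambda>X. of_real c * iter_deriv F (Y # Vs) X + 0 * iter_deriv F (Y # Vs) X)"
        using linear_scale[OF S_le_linear[OF F]] by (simp add: fun_eq_iff scaleR_conv_of_real del: iter_deriv.simps)
      then show "D ((c *\<^sub>R Y) # Vs) X = c *\<^sub>R D (Y # Vs) X"
        using heat_exp_lincomb[OF D[of "Y # Vs"] D[of "Y # Vs"], of h "of_real c" 0]
        by (simp add: D_def scaleR_conv_of_real del: iter_deriv.simps)
    qed
    show "norm (D Vs X) \<le> C * wt Vs" for Vs X
      by (rule Lim_bounded[OF tendsto_norm[OF lim]]) (use avg_le[OF D] in auto)
    show "norm (D Vs (X + Y) - D Vs X - D (Y # Vs) X) \<le> C * (norm (T Y))\<^sup>2 * wt Vs" for Vs X Y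
    proof (rule Lim_bounded[OF tendsto_norm[OF tendsto_diff[OF tendsto_diff[OF lim lim] lim]]], intro allI impI)
      fix n :: nat assume "n \<ge> 0"
      let ?Z = "\<lambda>x. 1 *\<^sub>R proj (basis n) x"
      have i: "integrable \<nu> (\<lambda>x. iter_deriv F Ws (W + ?Z x))" for Ws W
        by (rule S_le_integrable[OF D]) simp
      have "avg n (iter_deriv F Vs) (X + Y) 1 - avg n (iter_deriv F Vs) X 1 - avg n (iter_deriv F (Y # Vs)) X 1
          = (\<integral>x. iter_deriv F Vs (X + Y + ?Z x) - iter_deriv F Vs (X + ?Z x) - iter_deriv F (Y # Vs) (X + ?Z x) \<partial>\<nu>)"
        unfolding avg_def
        by (simp only: Bochner_Integration.integral_diff[OF Bochner_Integration.integrable_diff[OF i i] i]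
            Bochner_Integration.integral_diff[OF i i])
      also have "norm \<dots> \<le> C * (norm (T Y))\<^sup>2 * wt Vs"
      proof (rule integral_norm_le_const)
        show "norm (iter_deriv F Vs (X + Y + ?Z x) - iter_deriv F Vs (X + ?Z x) - iter_deriv F (Y # Vs) (X + ?Z x))
            \<le> C * (norm (T Y))\<^sup>2 * wt Vs" for x
          using S_le_remainder[OF F, of Vs "X + ?Z x" Y] by (simp add: add_ac del: iter_deriv.simps)
        show "(\<lambda>x. iter_deriv F Vs (X + Y + ?Z x) - iter_deriv F Vs (X + ?Z x) - iter_deriv F (Y # Vs) (X + ?Z x)) \<in> borel_measurable \<nu>"
          by (intro borel_measurable_diff S_le_measurable[OF D]) simp_all
      qed
      finally show "norm (avg n (iter_deriv F Vs) (X + Y) 1 - avg n (iter_deriv F Vs) X 1 - avg n (iter_deriv F (Y # Vs)) X 1)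
          \<le> C * (norm (T Y))\<^sup>2 * wt Vs" .
    qed
  qed
  then show ?thesis by (simp add: D_def iter_deriv_Nil)
qed

end

section \<open>Operator norms, inversion and the concrete setting\<close>

context form_laplacian
begin

lemma heat_exp_in_S_space: "F \<in> S_space Q \<Longrightarrow> heat_exp t F \<in> S_space Q"
  using S_le_imp_S_space[OF S_le_heat_exp[OF S_space_S_le]] .

text \<open>Formulated for any \<open>K\<close> that agrees with the exponential on
  \<open>S_space Q\<close>, as nothing is known elsewhere about \<open>heat_op\<close> and
  \<open>inv_into\<close>; it serves for both.\<close>

lemma heat_exp_operator:
  assumes K: "\<And>F. F \<in> S_space Q \<Longrightarrow> K F = heat_exp t F"
    and B: "\<And>F C. S_le F C \<Longrightarrow> S_le (heat_exp t F) (B * C)" and B0: "0 \<le> B"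
  shows "S_bounded_linear Q K" and "S_opnorm Q K \<le> B"
proof -
  have norm_le: "S_norm Q (K F) \<le> B * S_norm Q F" if "F \<in> S_space Q" for F
    using S_norm_le[OF B[OF S_space_S_le[OF that]]] K[OF that] by simp
  show "S_bounded_linear Q K"
    unfolding S_bounded_linear_def
  proof (intro conjI ballI allI)
    show "K ` S_space Q \<subseteq> S_space Q" using K heat_exp_in_S_space by auto
    show "\<exists>B. \<forall>F\<in>S_space Q. S_norm Q (K F) \<le> B * S_norm Q F" using norm_le by blast
    fix f assume f: "f \<in> S_space Q"
    note f' = S_space_S_le[OF f]
    show "K (\<lambda>X. c * f X) = (\<lambda>X. c * K f X)" for c
      using K[OF S_le_imp_S_space[OF S_le_cmult(2)[OF f', of c]]] K[OF f] heat_exp_lincomb[OF f' f', of t c 0] by simp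
    fix g assume g: "g \<in> S_space Q"
    show "K (\<lambda>X. f X + g X) = (\<lambda>X. K f X + K g X)"
      using K[OF S_le_imp_S_space[OF S_le_add(2)[OF f' S_space_S_le[OF g]]]] K[OF f] K[OF g]
        heat_exp_lincomb[OF f' S_space_S_le[OF g], of t 1 1] by simp
  qed
  show "S_opnorm Q K \<le> B"
    unfolding S_opnorm_def
  proof (rule cSUP_least)
    show "S_space Q \<noteq> {}" using S_le_imp_S_space[OF S_le_zero] by blast
    fix F assume F: "F \<in> S_space Q"
    \<comment> \<open>If F has norm 0, the quotient is 0 by convention, and 0 <= B is used.\<close>
    show "S_norm Q (K F) / S_norm Q F \<le> B"
      using norm_le[OF F] S_norm_nonneg[OF F] B0 by (cases "S_norm Q F = 0") (simp_all add: divide_le_eq)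
  qed
qed

end

context heat_setting
begin

text \<open>\<open>heat_integral_eq\<close> holds for every stochastic extension, so existence of
  one settles the choice made in \<open>heat_op\<close>.\<close>

lemma heat_op_eq:
  assumes F: "F \<in> S_space Q" and \<mu>: "\<mu> h = \<nu>"
  shows "heat_op J \<mu> h F = heat_exp h F"
proof
  fix X
  have F': "S_le F (S_norm Q F)" by (rule S_space_S_le[OF F])
  have "stochastic_extension J \<nu> F (SOME G. stochastic_extension J \<nu> F G)"
    by (rule someI_ex[OF stochastic_extension_exists[OF F']])
  from heat_integral_eq[OF F' this, of X] show "heat_op J \<mu> h F X = heat_exp h F X"
    using h by (simp add: heat_op_def \<mu>)
qed

text \<open>By the group law the inverse is the exponential at time - h. The bound for
  \<open>H\<close> comes from averaging, the one for the inverse from the exponential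
  series.\<close>

lemma heat_isomorphism:
  assumes H: "\<And>F. F \<in> S_space Q \<Longrightarrow> H F = heat_exp h F"
  shows "S_isomorphism Q H" and "S_opnorm Q H \<le> 1"
    and "S_opnorm Q (inv_into (S_space Q) H) \<le> exp (h * half_trace)"
proof -
  have inverse: "heat_exp (- t) (heat_exp t F) = F" if "F \<in> S_space Q" for t F
    using heat_exp_add[OF S_space_S_le[OF that], of "- t" t] by (simp add: heat_exp_0)
  have bij: "bij_betw H (S_space Q) (S_space Q)"
  proof (rule bij_betwI[where g = "heat_exp (- h)"])
    show "H (heat_exp (- h) F) = F" if "F \<in> S_space Q" for F
      using inverse[OF that, of "- h"] H[OF heat_exp_in_S_space[OF that]] by simp
  qed (simp_all add: H inverse heat_exp_in_S_space)
  have inv: "inv_into (S_space Q) H F = heat_exp (- h) F" if F: "F \<in> S_space Q" for F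
  proof (rule inv_into_f_eq)
    show "inj_on H (S_space Q)" using bij by (rule bij_betw_imp_inj_on)
    show "H (heat_exp (- h) F) = F"
      using inverse[OF F, of "- h"] H[OF heat_exp_in_S_space[OF F]] by simp
  qed (rule heat_exp_in_S_space[OF F])
  have 1: "S_bounded_linear Q H" "S_opnorm Q H \<le> 1"
    using heat_exp_operator[of H h 1] H heat_exp_contraction by simp_all
  have bound: "S_le (heat_exp (- h) F) (exp (h * half_trace) * C)" if "S_le F C" for F C
    using S_le_heat_exp[OF that, of "- h"] h by simp
  have 2: "S_bounded_linear Q (inv_into (S_space Q) H)"
    "S_opnorm Q (inv_into (S_space Q) H) \<le> exp (h * half_trace)"
    using heat_exp_operator[OF inv bound] by simp_all
  show "S_isomorphism Q H" using bij 1(1) 2(1) by (simp add: S_isomorphism_def)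
  show "S_opnorm Q H \<le> 1" by (rule 1(2))
  show "S_opnorm Q (inv_into (S_space Q) H) \<le> exp (h * half_trace)" by (rule 2(2))
qed

end

text \<open>A functional on the product is the sum of its restrictions to both factors; each is
  approximated up to r / 2.\<close>

lemma square_embedding_dense:
  fixes J :: "'h::real_normed_vector \<Rightarrow>\<^sub>L 'b::real_normed_vector"
  assumes dense: "closure (range (\<lambda>a :: 'b \<Rightarrow>\<^sub>L real. a o\<^sub>L J)) = UNIV"
  shows "closure (range (\<lambda>a :: ('b \<times> 'b) \<Rightarrow>\<^sub>L real. a o\<^sub>L square_embedding J)) = UNIV"
proof -
  have "\<phi> \<in> closure (range (\<lambda>a :: ('b \<times> 'b) \<Rightarrow>\<^sub>L real. a o\<^sub>L square_embedding J))" for \<phi> :: "('h \<times> 'h) \<Rightarrow>\<^sub>L real"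
    unfolding closure_approachable
  proof (intro allI impI)
    fix r :: real assume "r > 0"
    define \<phi>1 \<phi>2 where "\<phi>1 = Blinfun (\<lambda>x. \<phi> (x, 0))" and "\<phi>2 = Blinfun (\<lambda>x. \<phi> (0, x))"
    have \<phi>12: "blinfun_apply \<phi>1 = (\<lambda>x. \<phi> (x, 0))" "blinfun_apply \<phi>2 = (\<lambda>x. \<phi> (0, x))"
      unfolding \<phi>1_def \<phi>2_def
      by (intro bounded_linear_Blinfun_apply bounded_linear_compose[OF blinfun.bounded_linear_right]
          bounded_linear_Pair bounded_linear_ident bounded_linear_zero)+
    have "\<exists>a :: 'b \<Rightarrow>\<^sub>L real. norm ((a o\<^sub>L J) - \<psi>) < r / 2" for \<psi>
    proof -
      have "\<psi> \<in> closure (range (\<lambda>a :: 'b \<Rightarrow>\<^sub>L real. a o\<^sub>L J))" using dense by simp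
      then show ?thesis using \<open>r > 0\<close> by (force simp: closure_approachable dist_norm dest!: spec[of _ "r / 2"])
    qed
    then obtain a1 a2 :: "'b \<Rightarrow>\<^sub>L real" where a: "norm ((a1 o\<^sub>L J) - \<phi>1) < r / 2" "norm ((a2 o\<^sub>L J) - \<phi>2) < r / 2"
      by metis
    define a where "a = (a1 o\<^sub>L fst_blinfun) + (a2 o\<^sub>L snd_blinfun)"
    have "norm ((a o\<^sub>L square_embedding J) - \<phi>) \<le> norm ((a1 o\<^sub>L J) - \<phi>1) + norm ((a2 o\<^sub>L J) - \<phi>2)"
    proof (rule norm_blinfun_bound)
      fix p :: "'h \<times> 'h"
      obtain x y where p: "p = (x, y)" by force
      have "\<phi> (x, y) = \<phi> (x, 0) + \<phi> (0, y)" by (simp add: blinfun.add_right[symmetric])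
      then have "((a o\<^sub>L square_embedding J) - \<phi>) p = ((a1 o\<^sub>L J) - \<phi>1) x + ((a2 o\<^sub>L J) - \<phi>2) y"
        by (simp add: p a_def \<phi>12 blinfun.diff_left blinfun.add_left)
      also have "norm \<dots> \<le> norm ((a1 o\<^sub>L J) - \<phi>1) * norm x + norm ((a2 o\<^sub>L J) - \<phi>2) * norm y"
        by (intro norm_triangle_le add_mono norm_blinfun)
      also have "\<dots> \<le> norm ((a1 o\<^sub>L J) - \<phi>1) * norm p + norm ((a2 o\<^sub>L J) - \<phi>2) * norm p"
        using norm_fst_le[of x y] norm_snd_le[of y x] unfolding p by (intro add_mono mult_left_mono) auto
      finally show "norm (((a o\<^sub>L square_embedding J) - \<phi>) p)
          \<le> (norm ((a1 o\<^sub>L J) - \<phi>1) + norm ((a2 o\<^sub>L J) - \<phi>2)) * norm p" by (simp add: algebra_simps)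
    qed simp
    then have "dist (a o\<^sub>L square_embedding J) \<phi> < r" using a by (simp add: dist_norm)
    then show "\<exists>y\<in>range (\<lambda>a :: ('b \<times> 'b) \<Rightarrow>\<^sub>L real. a o\<^sub>L square_embedding J). dist y \<phi> < r" by blast
  qed
  then show ?thesis by auto
qed

text \<open>\<open>trace_class\<close> gives summability for the modulus, which is A by
  \<open>is_modulus_nonneg_op\<close>. The sequence \<open>e\<close> lists the very basis selected
  in \<open>op_trace\<close>, so the sum is the trace by definition.\<close>

lemma trace_class_sums:
  fixes A T :: "'v::{real_inner, banach, second_countable_topology} \<Rightarrow>\<^sub>L 'v"
  assumes A: "selfadjoint_op A" "nonneg_op A" "trace_class A"
    and T: "\<And>x. A x \<bullet> x = (norm (T x))\<^sup>2"
  obtains e where "hilbert_sequence e" "(\<lambda>j. (norm (T (e j)))\<^sup>2) sums op_trace A"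
proof -
  define U where "U = (SOME U :: 'v set. hilbert_basis U)"
  have U: "hilbert_basis U" unfolding U_def by (rule someI_ex[OF hilbert_basis_exists])
  obtain P where P: "is_modulus A P" "(\<lambda>u. P u \<bullet> u) summable_on U"
    using A(3) U by (auto simp: trace_class_def)
  have "(\<lambda>u. A u \<bullet> u) summable_on U"
    using P(2) is_modulus_nonneg_op[OF A(1,2) P(1)] by simp
  moreover obtain e where e: "hilbert_sequence e"
    "\<And>g :: 'v \<Rightarrow> real. g 0 = 0 \<Longrightarrow> g summable_on U \<Longrightarrow> (\<lambda>i. g (e i)) sums (\<Sum>\<^sub>\<infinity>u\<in>U. g u)"
    using hilbert_basis_enumerate[OF U] by blast
  ultimately have "(\<lambda>i. A (e i) \<bullet> e i) sums op_trace A"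
    using e(2)[of "\<lambda>u. A u \<bullet> u"] by (simp add: op_trace_def U_def[symmetric])
  then show ?thesis using that[OF e(1)] by (simp only: T)
qed

theorem theorem2p3:
  fixes J :: "'h::{real_inner, banach, second_countable_topology}
                \<Rightarrow>\<^sub>L 'b::{banach, second_countable_topology}"
    and \<nu> :: "real \<Rightarrow> ('b \<times> 'b) measure"
    and A :: "('h \<times> 'h) \<Rightarrow>\<^sub>L ('h \<times> 'h)"
    and Q :: "'h \<times> 'h \<Rightarrow> real"
  assumes infinite_dim: "\<not> (\<exists>U :: 'h set. finite U \<and> span U = UNIV)"
    and wiener: "wiener_embedding J"
    and gauss: "\<And>t. t > 0 \<Longrightarrow> wiener_measure (square_embedding J) t (\<nu> t)"
    and selfadj: "selfadjoint_op A"
    and nonneg: "nonneg_op A"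
    and trace: "trace_class A"
    and Q: "\<And>X. Q X = A X \<bullet> X"
  shows "(\<forall>F\<in>S_space Q. S_smooth_on Q {0..} (\<lambda>h. heat_op (square_embedding J) \<nu> h F)) \<and>
    (\<forall>h>0.
      S_isomorphism Q (heat_op (square_embedding J) \<nu> h) \<and>
      S_opnorm Q (heat_op (square_embedding J) \<nu> h) \<le> 1 \<and>
      S_opnorm Q (inv_into (S_space Q) (heat_op (square_embedding J) \<nu> h))
        \<le> exp (h / 2 * op_trace A))"
proof -
  obtain T where T: "selfadjoint_op T" "\<And>x. T (T x) = A x"
    by (rule nonneg_op_sqrt_exists[OF selfadj nonneg]) blast
  have T_norm: "A x \<bullet> x = (norm (T x))\<^sup>2" for x
    using T(1)[unfolded selfadjoint_op_def, rule_format, of "T x" x] by (simp only: T(2) power2_norm_eq_inner)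
  obtain e where e: "hilbert_sequence e" "(\<lambda>j. (norm (T (e j)))\<^sup>2) sums op_trace A"
    by (rule trace_class_sums[OF selfadj nonneg trace T_norm])
  interpret L: form_laplacian T Q e
    by unfold_locales (simp_all add: Q T_norm sums_summable[OF e(2)])
  have half_trace: "L.half_trace = op_trace A / 2"
    using sums_unique[OF e(2)] by (simp add: L.half_trace_def)
  \<comment> \<open>\<open>T\<close> and \<open>e\<close> do not depend on h, so the same
    \<open>L.heat_exp\<close> describes the heat operators for all h.\<close>
  have setting: "heat_setting (square_embedding J) (\<nu> h) h T Q e" if "h > 0" for h
    by (intro heat_setting.intro wiener_space.intro heat_setting_axioms.intro L.form_laplacian_axioms e(1)
        square_embedding_dense gauss that T(1)) (use wiener in \<open>simp_all add: wiener_embedding_def\<close>)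
  have eq: "heat_op (square_embedding J) \<nu> h F = L.heat_exp h F" if "F \<in> S_space Q" "h \<ge> 0" for F h
  proof (cases "h = 0")
    case True
    then show ?thesis by (simp add: heat_op_def L.heat_exp_0 fun_eq_iff)
  next
    case False
    then have "h > 0" using that(2) by simp
    then show ?thesis by (intro heat_setting.heat_op_eq[OF setting] that(1) refl)
  qed
  \<comment> \<open>\<open>S_smooth_on\<close> evaluates the function only at points of {0..}, where
    \<open>eq\<close> replaces it by the exponential, h = 0 included.\<close>
  have "S_smooth_on Q {0..} (\<lambda>h. heat_op (square_embedding J) \<nu> h F)" if F: "F \<in> S_space Q" for F
    using L.heat_exp_smooth[OF F, of "{0..}"] by (simp add: S_smooth_on_def eq[OF F])
  moreover have "S_isomorphism Q (heat_op (square_embedding J) \<nu> h)"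
    "S_opnorm Q (heat_op (square_embedding J) \<nu> h) \<le> 1"
    "S_opnorm Q (inv_into (S_space Q) (heat_op (square_embedding J) \<nu> h)) \<le> exp (h / 2 * op_trace A)" if "h > 0" for h
    using heat_setting.heat_isomorphism[OF setting[OF that], of "heat_op (square_embedding J) \<nu> h"] eq that
    by (simp_all add: half_trace)
  ultimately show ?thesis by blast
qed

end
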